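(* Let $D:f=0$ be a hypersurface of degree $d$ in $\mathbb{P}^n$ over $\mathbb{C}$ with isolated singularities, let $T=(n+1)(d-2)$, and assume that $d\le ct(D)$. Then $D$ is projectively rigid if and only if $\dim M(f)_{T-d}=\tau(D)$.
   Context: $S=\mathbb{C}[x_0,\dots,x_n]$ is the graded polynomial ring and $S_r$ is the vector space of homogeneous polynomials of degree $r$. For $f\in S_d$, the Jacobian ideal $J=J_f\subset S$ is the ideal generated by the partial derivatives $f_0,\dots,f_n$ of $f$ with respect to $x_0,\dots,x_n$, and the graded Milnor algebra is $M(f)=S/J_f$, with homogeneous components $M(f)_k$. The saturation of $J$ is $\hat J=\{h\in S : (x_0,\dots,x_n)^m h\subset J \text{ for some } m\ge 0\}$. The hypersurface $D:f=0$ of degree $d$ is called projectively rigid if $\hat J_d/J_d=0$ (degree $d$ homogeneous components). The coincidence threshold of $D$ is $$ct(D)=\max \{q : \dim M(f)_k=\dim M(f_s)_k \text{ for all } k \leq q\},$$ where $f_s\in S_d$ is a homogeneous polynomial of the same degree $d$ such that $f_s=0$ is a smooth hypersurface in $\mathbb{P}^n$ (the dimensions $\dim M(f_s)_k$ do not depend on the choice of $f_s$). $\tau(D)$ is the total (global) Tjurina number of $D$, i.e. the sum of the Tjurina numbers of all singularities of $D$; the Tjurina number of an isolated hypersurface singularity with local equation $g=0$ in local coordinates $u_1,\dots,u_n$ is $\dim_{\mathbb{C}}\mathbb{C}\{u_1,\dots,u_n\}/(g,\partial g/\partial u_1,\dots,\partial g/\partial u_n)$. Dimensions are over $\mathbb{C}$.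 *)

theory Defs
  imports "HOL-Analysis.Analysis" "HOL-Library.Poly_Mapping" "HOL-Library.Extended_Nat"
begin

section \<open>Dimension of a quotient space\<close>

locale quotient_space = vector_space scale
  for scale :: "'a::field \<Rightarrow> 'b::ab_group_add \<Rightarrow> 'b"
begin

text \<open>For subspaces \<open>W \<subseteq> V\<close>: the residue classes of the elements of \<open>B\<close> are pairwise
  distinct and form a basis of \<open>V / W\<close>.\<close>

definition quotient_basis :: "'b set \<Rightarrow> 'b set \<Rightarrow> 'b set \<Rightarrow> bool" where
  "quotient_basis V W B \<longleftrightarrow>
     B \<subseteq> V \<and>
     (\<forall>t c. finite t \<longrightarrow> t \<subseteq> B \<longrightarrow> (\<Sum>b\<in>t. scale (c b) b) \<in> W \<longrightarrow> (\<forall>b\<in>t. c b = 0)) \<and>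
     (\<forall>v\<in>V. \<exists>b\<in>span B. v - b \<in> W)"

definition quotient_dim :: "'b set \<Rightarrow> 'b set \<Rightarrow> enat" where
  "quotient_dim V W =
     (if \<exists>B. finite B \<and> quotient_basis V W B
      then enat (card (SOME B. finite B \<and> quotient_basis V W B)) else \<infinity>)"

end

section \<open>Ideals of a subring\<close>

text \<open>In the following, \<open>R\<close> is (the carrier of) a subring of the ambient type.\<close>

definition ideal_gen :: "'a::comm_ring_1 set \<Rightarrow> 'a set \<Rightarrow> 'a set" where
  "ideal_gen R G = {\<Sum>g\<in>t. h g * g | t h. finite t \<and> t \<subseteq> G \<and> h ` t \<subseteq> R}"

primrec ideal_power :: "'a::comm_ring_1 set \<Rightarrow> 'a set \<Rightarrow> nat \<Rightarrow> 'a set" where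
  "ideal_power R I 0 = R"
| "ideal_power R I (Suc m) = ideal_gen R {a * b | a b. a \<in> ideal_power R I m \<and> b \<in> I}"

section \<open>Polynomials\<close>

text \<open>Exponent vectors are finitely supported functions. A polynomial ring in finitely many
  variables is a subring of the polynomials in variables indexed by all of \<^typ>\<open>nat\<close>.\<close>

type_synonym monom = "nat \<Rightarrow>\<^sub>0 nat"
type_synonym mpoly = "monom \<Rightarrow>\<^sub>0 complex"

definition mdeg :: "monom \<Rightarrow> nat" where
  "mdeg m = (\<Sum>i\<in>Poly_Mapping.keys m. Poly_Mapping.lookup m i)"

definition mpoly_scale :: "complex \<Rightarrow> mpoly \<Rightarrow> mpoly" where
  "mpoly_scale c p = Poly_Mapping.single 0 c * p"

definition mpoly_var :: "nat \<Rightarrow> mpoly" where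
  "mpoly_var i = Poly_Mapping.single (Poly_Mapping.single i 1) 1"

text \<open>\<open>polys n\<close> is \<open>S = \<complex>[x\<^sub>0, \<dots>, x\<^sub>n]\<close> (so \<open>n + 1\<close> variables), and \<open>homog n r\<close> is \<open>S\<^sub>r\<close>, which is
  zero for \<open>r < 0\<close>.\<close>

definition polys :: "nat \<Rightarrow> mpoly set" where
  "polys n = {p. \<forall>m\<in>Poly_Mapping.keys p. Poly_Mapping.keys m \<subseteq> {..n}}"

definition homog :: "nat \<Rightarrow> int \<Rightarrow> mpoly set" where
  "homog n r = {p \<in> polys n. \<forall>m\<in>Poly_Mapping.keys p. int (mdeg m) = r}"

text \<open>The coefficient of \<open>x\<^sup>m\<close> in \<open>\<partial>p/\<partial>x\<^sub>i\<close> is \<open>(m\<^sub>i + 1)\<close> times that of \<open>x\<^sub>i x\<^sup>m\<close> in \<open>p\<close>.\<close>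

lift_definition mpoly_deriv :: "nat \<Rightarrow> mpoly \<Rightarrow> mpoly" is
  "\<lambda>i p m. of_nat (Poly_Mapping.lookup m i + 1) * p (m + Poly_Mapping.single i 1)"
proof -
  fix i and p :: "monom \<Rightarrow> complex"
  let ?s = "\<lambda>m :: monom. m + Poly_Mapping.single i (1::nat)"
  assume "finite {m. p m \<noteq> 0}"
  moreover have "inj ?s"
    by (simp add: inj_def)
  ultimately have "finite (?s -` {m. p m \<noteq> 0})"
    by (rule finite_vimageI)
  then show "finite {m. of_nat (Poly_Mapping.lookup m i + 1) * p (?s m) \<noteq> 0}"
    by (rule rev_finite_subset) auto
qed

text \<open>Substitution of ring elements \<open>x i\<close> for the variables, along the coefficient map \<open>\<phi>\<close>.\<close>

definition mpoly_subst :: "(complex \<Rightarrow> 'a::comm_ring_1) \<Rightarrow> (nat \<Rightarrow> 'a) \<Rightarrow> mpoly \<Rightarrow> 'a" where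
  "mpoly_subst \<phi> x p = (\<Sum>m\<in>Poly_Mapping.keys p.
     \<phi> (Poly_Mapping.lookup p m) * (\<Prod>i\<in>Poly_Mapping.keys m. x i ^ Poly_Mapping.lookup m i))"

abbreviation mpoly_eval :: "mpoly \<Rightarrow> (nat \<Rightarrow> complex) \<Rightarrow> complex" where
  "mpoly_eval p x \<equiv> mpoly_subst (\<lambda>c. c) x p"

global_interpretation mpoly: quotient_space mpoly_scale
  defines mpoly_quotient_dim = mpoly.quotient_dim
  by unfold_locales
    (simp_all add: mpoly_scale_def distrib_left distrib_right single_add
      mult_single mult.assoc [symmetric])

section \<open>The Jacobian ideal and the Milnor algebra\<close>

definition jacobian_ideal :: "nat \<Rightarrow> mpoly \<Rightarrow> mpoly set" where
  "jacobian_ideal n f = ideal_gen (polys n) {mpoly_deriv i f | i. i \<le> n}"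

definition milnor_dim :: "nat \<Rightarrow> mpoly \<Rightarrow> int \<Rightarrow> enat" where
  "milnor_dim n f k = mpoly_quotient_dim (homog n k) (jacobian_ideal n f \<inter> homog n k)"

definition irrelevant_ideal :: "nat \<Rightarrow> mpoly set" where
  "irrelevant_ideal n = ideal_gen (polys n) {mpoly_var i | i. i \<le> n}"

definition saturation :: "nat \<Rightarrow> mpoly set \<Rightarrow> mpoly set" where
  "saturation n J = {h \<in> polys n.
     \<exists>m. \<forall>g\<in>ideal_power (polys n) (irrelevant_ideal n) m. g * h \<in> J}"

definition projectively_rigid :: "nat \<Rightarrow> nat \<Rightarrow> mpoly \<Rightarrow> bool" where
  "projectively_rigid n d f \<longleftrightarrow>
     mpoly_quotient_dim (saturation n (jacobian_ideal n f) \<inter> homog n (int d))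
                        (jacobian_ideal n f \<inter> homog n (int d)) = 0"

text \<open>The second polynomial \<open>fs\<close> is the equation of a smooth hypersurface of the same degree.
  The threshold is \<open>\<infinity>\<close> if the dimensions agree in all degrees, for instance if \<open>f = 0\<close> is smooth.\<close>

definition coincidence_threshold :: "nat \<Rightarrow> mpoly \<Rightarrow> mpoly \<Rightarrow> enat" where
  "coincidence_threshold n f fs =
     Sup {enat q | q. \<forall>k \<le> int q. milnor_dim n f k = milnor_dim n fs k}"

section \<open>Formal and convergent power series\<close>

typedef mfps = "UNIV :: (monom \<Rightarrow> complex) set"
  morphisms mfps_nth Abs_mfps ..

setup_lifting type_definition_mfps

lemma mfps_eqI: "(\<And>m. mfps_nth a m = mfps_nth b m) \<Longrightarrow> a = b"
  by transfer auto

definition antidiag :: "monom \<Rightarrow> (monom \<times> monom) set" where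
  "antidiag m = {(k, l). k + l = m}"

lemma finite_antidiag [simp]: "finite (antidiag m)"
proof -
  let ?K = "Poly_Mapping.keys m"
  let ?D = "{k. \<forall>i. Poly_Mapping.lookup k i \<le> Poly_Mapping.lookup m i}"
  let ?r = "\<lambda>k. restrict (Poly_Mapping.lookup k) ?K"
  have "inj_on ?r ?D"
  proof (rule inj_onI, rule poly_mapping_eqI)
    fix k l i assume D: "k \<in> ?D" "l \<in> ?D" and eq: "?r k = ?r l"
    show "Poly_Mapping.lookup k i = Poly_Mapping.lookup l i"
    proof (cases "i \<in> ?K")
      case True
      then show ?thesis using fun_cong [OF eq, of i] by simp
    next
      case False
      then have "Poly_Mapping.lookup m i = 0" by (simp add: in_keys_iff)
      then show ?thesis using D by (metis (mono_tags, lifting) le_zero_eq mem_Collect_eq)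
    qed
  qed
  moreover have "?r ` ?D \<subseteq> (\<Pi>\<^sub>E i\<in>?K. {..Poly_Mapping.lookup m i})"
    by (auto simp: PiE_def Pi_def)
  moreover have "finite (\<Pi>\<^sub>E i\<in>?K. {..Poly_Mapping.lookup m i})"
    by (intro finite_PiE) auto
  ultimately have fin: "finite ?D"
    by (meson finite_imageD finite_subset)
  have "antidiag m \<subseteq> ?D \<times> ?D"
    by (auto simp: antidiag_def lookup_add)
  then show ?thesis
    using fin by (meson finite_SigmaI finite_subset)
qed

instantiation mfps :: comm_ring_1
begin

lift_definition zero_mfps :: mfps is "\<lambda>_. 0" .
lift_definition one_mfps :: mfps is "\<lambda>m. if m = 0 then 1 else 0" .
lift_definition plus_mfps :: "mfps \<Rightarrow> mfps \<Rightarrow> mfps" is "\<lambda>a b m. a m + b m" .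
lift_definition minus_mfps :: "mfps \<Rightarrow> mfps \<Rightarrow> mfps" is "\<lambda>a b m. a m - b m" .
lift_definition uminus_mfps :: "mfps \<Rightarrow> mfps" is "\<lambda>a m. - a m" .
lift_definition times_mfps :: "mfps \<Rightarrow> mfps \<Rightarrow> mfps" is
  "\<lambda>a b m. \<Sum>(k, l)\<in>antidiag m. a k * b l" .

instance
proof
  fix a b c :: mfps
  show "a * b * c = a * (b * c)"
  proof (transfer, rule ext)
    fix a b c :: "monom \<Rightarrow> complex" and m
    have "(\<Sum>(k, l)\<in>antidiag m. (\<Sum>(p, q)\<in>antidiag k. a p * b q) * c l) =
        (\<Sum>(x, y)\<in>(SIGMA x:antidiag m. antidiag (fst x)). a (fst y) * b (snd y) * c (snd x))"
      by (subst sum.Sigma [symmetric]) (auto simp: sum_distrib_right case_prod_beta)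
    also have "\<dots> = (\<Sum>(x, y)\<in>(SIGMA x:antidiag m. antidiag (snd x)).
        a (fst x) * (b (fst y) * c (snd y)))"
      by (rule sum.reindex_bij_witness
            [of _ "\<lambda>((p, r), (q, l)). ((p + q, l), (p, q))" "\<lambda>((k, l), (p, q)). ((p, q + l), (q, l))"])
         (auto simp: antidiag_def ac_simps)
    also have "\<dots> = (\<Sum>(p, r)\<in>antidiag m. a p * (\<Sum>(q, l)\<in>antidiag r. b q * c l))"
      by (subst sum.Sigma [symmetric]) (auto simp: sum_distrib_left case_prod_beta)
    finally show "(\<Sum>(k, l)\<in>antidiag m. (\<Sum>(p, q)\<in>antidiag k. a p * b q) * c l) =
        (\<Sum>(p, r)\<in>antidiag m. a p * (\<Sum>(q, l)\<in>antidiag r. b q * c l))" .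
  qed
  show "a * b = b * a"
  proof (transfer, rule ext)
    fix a b :: "monom \<Rightarrow> complex" and m
    show "(\<Sum>(k, l)\<in>antidiag m. a k * b l) = (\<Sum>(k, l)\<in>antidiag m. b k * a l)"
      by (rule sum.reindex_bij_witness [of _ prod.swap prod.swap])
         (auto simp: antidiag_def ac_simps)
  qed
  show "1 * a = a"
  proof (transfer, rule ext)
    fix a :: "monom \<Rightarrow> complex" and m
    have "(\<Sum>(k, l)\<in>antidiag m. (if k = 0 then 1 else 0) * a l) =
        (\<Sum>(k, l)\<in>{(0 :: monom, m)}. (if k = 0 then 1 else 0) * a l)"
      by (rule sum.mono_neutral_right, simp) (auto simp: antidiag_def split: if_splits)
    then show "(\<Sum>(k, l)\<in>antidiag m. (if k = 0 then 1 else 0) * a l) = a m"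
      by simp
  qed
  show "(a + b) * c = a * c + b * c"
    by transfer (simp add: fun_eq_iff case_prod_beta distrib_right sum.distrib)
qed (transfer; simp add: fun_eq_iff)+

end

lift_definition mfps_const :: "complex \<Rightarrow> mfps" is "\<lambda>c m. if m = 0 then c else 0" .

lift_definition mfps_var :: "nat \<Rightarrow> mfps" is
  "\<lambda>i m. if m = Poly_Mapping.single i 1 then 1 else 0" .

lift_definition mfps_scale :: "complex \<Rightarrow> mfps \<Rightarrow> mfps" is "\<lambda>c a m. c * a m" .

lift_definition mfps_deriv :: "nat \<Rightarrow> mfps \<Rightarrow> mfps" is
  "\<lambda>i a m. of_nat (Poly_Mapping.lookup m i + 1) * a (m + Poly_Mapping.single i 1)" .

global_interpretation mfps: quotient_space mfps_scale
  defines mfps_quotient_dim = mfps.quotient_dim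
  by unfold_locales (transfer; simp add: fun_eq_iff algebra_simps)+

text \<open>The ring \<open>\<complex>{u\<^sub>j | j \<in> V}\<close> of power series that converge absolutely on some polydisc.\<close>

definition convergent_series :: "nat set \<Rightarrow> mfps set" where
  "convergent_series V = {a.
     (\<forall>m. mfps_nth a m \<noteq> 0 \<longrightarrow> Poly_Mapping.keys m \<subseteq> V) \<and>
     (\<exists>r::real. r > 0 \<and> (\<lambda>m. norm (mfps_nth a m) * r ^ mdeg m) summable_on UNIV)}"

definition tjurina_number :: "nat set \<Rightarrow> mfps \<Rightarrow> enat" where
  "tjurina_number V g = mfps_quotient_dim (convergent_series V)
     (ideal_gen (convergent_series V) (insert g {mfps_deriv j g | j. j \<in> V}))"

section \<open>Hypersurfaces in projective space\<close>

definition homog_coords :: "nat \<Rightarrow> (nat \<Rightarrow> complex) set" where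
  "homog_coords n = {x. (\<exists>i\<le>n. x i \<noteq> 0) \<and> (\<forall>i>n. x i = 0)}"

definition proj_point :: "(nat \<Rightarrow> complex) \<Rightarrow> (nat \<Rightarrow> complex) set" where
  "proj_point x = {\<lambda>i. c * x i | c. c \<noteq> 0}"

definition singular_coords :: "nat \<Rightarrow> mpoly \<Rightarrow> (nat \<Rightarrow> complex) set" where
  "singular_coords n f = {x \<in> homog_coords n.
     mpoly_eval f x = 0 \<and> (\<forall>i\<le>n. mpoly_eval (mpoly_deriv i f) x = 0)}"

definition singular_points :: "nat \<Rightarrow> mpoly \<Rightarrow> (nat \<Rightarrow> complex) set set" where
  "singular_points n f = proj_point ` singular_coords n f"

definition smooth_hypersurface :: "nat \<Rightarrow> mpoly \<Rightarrow> bool" where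
  "smooth_hypersurface n f \<longleftrightarrow> singular_points n f = {}"

text \<open>Every singular point is isolated in the singular locus for the classical topology: the
  images in projective space of the boxes around \<open>x\<close> form a neighbourhood basis of the point
  with homogeneous coordinates \<open>x\<close>.\<close>

definition isolated_singularities :: "nat \<Rightarrow> mpoly \<Rightarrow> bool" where
  "isolated_singularities n f \<longleftrightarrow>
     (\<forall>x\<in>singular_coords n f. \<exists>e>0. \<forall>y\<in>singular_coords n f.
        (\<forall>i\<le>n. dist (y i) (x i) < e) \<longrightarrow> proj_point y = proj_point x)"

text \<open>The equation of \<open>f = 0\<close> in the chart \<open>x\<^sub>i = 1\<close>, in the affine coordinates
  \<open>u\<^sub>j = x\<^sub>j/x\<^sub>i - p\<^sub>j/p\<^sub>i\<close> for \<open>j \<noteq> i\<close>, centred at the point with homogeneous coordinates \<open>p\<close>.\<close>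

definition local_equation :: "mpoly \<Rightarrow> nat \<Rightarrow> (nat \<Rightarrow> complex) \<Rightarrow> mfps" where
  "local_equation f i p =
     mpoly_subst mfps_const (\<lambda>j. if j = i then 1 else mfps_const (p j / p i) + mfps_var j) f"

text \<open>The Tjurina number does not depend on the coordinates of the point or on the chart.\<close>

definition tjurina_at :: "nat \<Rightarrow> mpoly \<Rightarrow> (nat \<Rightarrow> complex) set \<Rightarrow> enat" where
  "tjurina_at n f P =
     (let p = (SOME p. p \<in> P); i = (SOME i. i \<le> n \<and> p i \<noteq> 0)
      in tjurina_number ({..n} - {i}) (local_equation f i p))"

text \<open>The set \<open>singular_points n f\<close> is finite if the singularities are isolated, by compactness
  of projective space.\<close>

definition total_tjurina :: "nat \<Rightarrow> mpoly \<Rightarrow> enat" where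
  "total_tjurina n f = (\<Sum>P\<in>singular_points n f. tjurina_at n f P)"

end

theory Submission
  imports Defs "HOL-Computational_Algebra.Fundamental_Theorem_Algebra"
begin

text \<open>Let \<open>e = d - 1\<close>, let \<open>J\<close> be the Jacobian ideal of \<open>f\<close>, and choose a linear form \<open>l\<close> that vanishes
  at no singular point. Suitable linear combinations \<open>g\<^sub>0, \<dots>, g\<^sub>n\<close> of the partial derivatives generate
  \<open>J\<close> and make \<open>g\<^sub>0, \<dots>, g\<^bsub>n - 1\<^esub>, l\<^sup>r\<close> a complete intersection for all \<open>r \<ge> 1\<close>. Its quotient
  ring \<open>R\<close> is Gorenstein, so multiplication by \<open>g\<^sub>n\<close> on \<open>R\<close> has the same rank in complementary degrees.
  For large \<open>r\<close> the ring \<open>R / (g\<^sub>n) = M(f) / (l\<^sup>r)\<close> agrees with \<open>M(f)\<close> in degree \<open>T - k\<close>, while in the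
  complementary degree \<open>k + r\<close> one takes the cokernel of \<open>l\<^sup>r\<close> on \<open>M(f)\<close>, whose kernel is the quotient
  of the saturation \<open>J'\<close> of \<open>J\<close> by \<open>J\<close>. This gives
  \<open>dim M(f)\<^bsub>T - k\<^esub> + dim M(f)\<^sub>k = dim M(f\<^sub>s)\<^sub>k + \<tau> + dim (J' / J)\<^sub>k\<close>, where \<open>\<tau>\<close> is the eventual value of
  \<open>dim M(f)\<^sub>k\<close>. The Nullstellensatz identifies \<open>\<tau>\<close> with the sum of the Tjurina numbers, and for
  \<open>k = d\<close> the terms \<open>dim M(f)\<^sub>d\<close> and \<open>dim M(f\<^sub>s)\<^sub>d\<close> cancel.

  That the complete intersections in question are regular and Gorenstein is seen by starting from the
  variables \<open>x\<^sub>0, \<dots>, x\<^sub>n\<close> and exchanging one element at a time, keeping the quotient finite-dimensional.\<close>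

text \<open>Everything is a dimension count in finite-dimensional graded pieces. For a form
  \<open>b\<close> of degree \<beta>, multiplication by \<open>b\<close> relates the Hilbert
  functions of \<open>I\<close>, \<open>I + (b)\<close> and \<open>I : b\<close>; ranks, regularity
  and stabilization are all read off from this relation. The two degrees in the formula are forced
  by the socle degree \<open>n (e - 1) + r - 1\<close> of \<open>R\<close>: multiplication by
  \<open>g_n\<close> out of degree \<open>T - k - e\<close> is dual to that out of degree
  \<open>k + r - e\<close>, since these two degrees and \<open>e\<close> add up to it for
  \<open>T = (n + 1) (e - 1)\<close>. The form \<open>f_s\<close> enters because the Hilbert
  function of a regular sequence depends only on its degrees: below degree \<open>r\<close>,
  \<open>R\<close> looks like the quotient by \<open>n\<close> forms of degree \<open>e\<close>, and
  one more regular form of degree \<open>e\<close> turns that into \<open>M(f_s)\<close>. The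
  Nullstellensatz has two uses. With \<open>h = 1\<close> it converts the absence of common zeros
  into finite-dimensionality; with general \<open>h\<close> it produces forms that isolate one zero
  of \<open>J\<close> from the others, which ties germs to global forms.\<close>

subsection \<open>Quotients of vector spaces\<close>

context quotient_space
begin

lemma quotient_basis_subset: "quotient_basis V W B \<Longrightarrow> B \<subseteq> V"
  by (simp add: quotient_basis_def)

lemma quotient_basis_indep:
  "quotient_basis V W B \<Longrightarrow> finite t \<Longrightarrow> t \<subseteq> B \<Longrightarrow> (\<Sum>b\<in>t. scale (c b) b) \<in> W \<Longrightarrow> b \<in> t \<Longrightarrow> c b = 0"
  by (auto simp: quotient_basis_def)

lemma quotient_basis_span: "quotient_basis V W B \<Longrightarrow> v \<in> V \<Longrightarrow> \<exists>b\<in>span B. v - b \<in> W"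
  by (auto simp: quotient_basis_def)

lemma quotient_basis_repr:
  assumes "quotient_basis V W B" "finite B" "v \<in> V"
  shows "\<exists>c. v - (\<Sum>b\<in>B. scale (c b) b) \<in> W"
  using quotient_basis_span[OF assms(1,3)] unfolding span_finite[OF assms(2)] by auto

lemma quotient_basisI:
  assumes "finite B" "B \<subseteq> V" "subspace W"
    and ind: "\<And>c b. (\<Sum>b\<in>B. scale (c b) b) \<in> W \<Longrightarrow> b \<in> B \<Longrightarrow> c b = 0"
    and rep: "\<And>v. v \<in> V \<Longrightarrow> \<exists>c. v - (\<Sum>b\<in>B. scale (c b) b) \<in> W"
  shows "quotient_basis V W B"
  unfolding quotient_basis_def
proof (intro conjI allI impI ballI)
  fix t c b assume t: "finite t" "t \<subseteq> B" "(\<Sum>b\<in>t. scale (c b) b) \<in> W" "b \<in> t"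
  have "(\<Sum>b\<in>B. scale (if b \<in> t then c b else 0) b) = (\<Sum>b\<in>t. scale (c b) b)"
    using t assms(1) by (intro sum.mono_neutral_cong_right) auto
  then have "(if b \<in> t then c b else 0) = 0"
    using t ind[of "\<lambda>b. if b \<in> t then c b else 0" b] by auto
  then show "c b = 0" using t by simp
next
  fix v assume "v \<in> V"
  then show "\<exists>b\<in>span B. v - b \<in> W"
    using rep[of v] unfolding span_finite[OF assms(1)] by blast
qed (use assms in auto)

text \<open>Subtracting suitable \<open>w a\<close> in \<open>W\<close> moves each \<open>a\<close>
  in \<open>A\<close> into \<open>span B\<close>. If \<open>D\<close> is a basis of the span of
  these corrections, then \<open>A\<close> and \<open>D\<close> together are independent and lie in
  \<open>span (B \<union> D)\<close>; the elements of \<open>D\<close> cancel in the count.\<close>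

lemma quotient_basis_card_le:
  assumes W: "subspace W" and B: "finite B" "quotient_basis V W B"
    and t: "finite A" "A \<subseteq> V" and ind: "\<And>c b. (\<Sum>b\<in>A. scale (c b) b) \<in> W \<Longrightarrow> b \<in> A \<Longrightarrow> c b = 0"
  shows "card A \<le> card B"
proof -
  have "\<forall>a\<in>A. \<exists>w\<in>W. a - w \<in> span B"
  proof
    fix a assume "a \<in> A"
    then obtain b where "b \<in> span B" "a - b \<in> W"
      using quotient_basis_span[OF B(2)] t by blast
    then show "\<exists>w\<in>W. a - w \<in> span B" by (intro bexI[of _ "a - b"]) auto
  qed
  then obtain w where w: "\<And>a. a \<in> A \<Longrightarrow> w a \<in> W \<and> a - w a \<in> span B" by metis
  obtain D where D: "D \<subseteq> w ` A" "independent D" "w ` A \<subseteq> span D"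
    using maximal_independent_subset[of "w ` A"] by blast
  have finD: "finite D" using D(1) t(1) by (meson finite_imageI finite_subset)
  have DW: "span D \<subseteq> W" using D(1) w W by (intro span_minimal) auto
  have disj: "A \<inter> D = {}"
  proof (rule ccontr)
    assume "A \<inter> D \<noteq> {}"
    then obtain a where a: "a \<in> A" "a \<in> D" by auto
    have "(\<Sum>b\<in>A. scale (if b = a then 1 else 0) b) = (\<Sum>b\<in>A. if b = a then b else 0)"
      by (intro sum.cong) auto
    also have "\<dots> = a" using a t by simp
    finally have "(\<Sum>b\<in>A. scale (if b = a then 1 else 0) b) \<in> W"
      using a(2) DW span_base[of a D] by auto
    then show False using ind[OF _ a(1), of "\<lambda>b. if b = a then 1 else 0"] by simp
  qed
  have "independent (A \<union> D)"
  proof (rule independent_if_scalars_zero)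
    fix f x assume s: "(\<Sum>x\<in>A \<union> D. scale (f x) x) = 0" and x: "x \<in> A \<union> D"
    have eq: "(\<Sum>x\<in>A. scale (f x) x) + (\<Sum>x\<in>D. scale (f x) x) = 0"
      using s disj t finD by (simp add: sum.union_disjoint)
    have DD: "(\<Sum>x\<in>D. scale (f x) x) \<in> span D"
      by (intro span_sum span_scale span_base)
    then have "- (\<Sum>x\<in>D. scale (f x) x) \<in> W" using DW W subspace_neg by blast
    then have "(\<Sum>x\<in>A. scale (f x) x) \<in> W"
      using eq by (metis eq_neg_iff_add_eq_0)
    then have fA: "f b = 0" if "b \<in> A" for b using ind that by blast
    then have "(\<Sum>x\<in>D. scale (f x) x) = 0" using eq by simp
    then have "f b = 0" if "b \<in> D" for b
      using D(2) that finD independent_explicit_finite_subsets by blast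
    then show "f x = 0" using x fA by auto
  qed (use t finD in auto)
  moreover have "A \<union> D \<subseteq> span (B \<union> D)"
  proof
    fix x assume "x \<in> A \<union> D"
    then show "x \<in> span (B \<union> D)"
    proof
      assume "x \<in> A"
      then have "x - w x \<in> span B" "w x \<in> span D" using w D by auto
      then have "x - w x + w x \<in> span (B \<union> D)"
        using span_mono[of B "B \<union> D"] span_mono[of D "B \<union> D"] by (intro span_add) auto
      then show ?thesis by simp
    qed (auto intro: span_base)
  qed
  ultimately have "card (A \<union> D) \<le> card (B \<union> D)"
    using independent_span_bound[of "B \<union> D" "A \<union> D"] B finD by auto
  also have "\<dots> \<le> card B + card D" by (rule card_Un_le)
  finally show ?thesis using disj t finD by (simp add: card_Un_disjoint)
qed

text \<open>Frees \<open>quotient_dim\<close> from the basis that \<open>SOME\<close> picks.\<close>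

lemma quotient_dim_eq:
  assumes "subspace W" "finite B" "quotient_basis V W B"
  shows "quotient_dim V W = enat (card B)"
proof -
  define C where "C = (SOME B. finite B \<and> quotient_basis V W B)"
  have C: "finite C" "quotient_basis V W C"
    using someI_ex[of "\<lambda>B. finite B \<and> quotient_basis V W B"] assms(2,3) unfolding C_def by blast+
  have "card C = card B"
  proof (rule antisym)
    show "card C \<le> card B"
      by (rule quotient_basis_card_le[OF assms C(1)])
        (use C quotient_basis_subset quotient_basis_indep[OF C(2) C(1)] in auto)
    show "card B \<le> card C"
      by (rule quotient_basis_card_le[OF assms(1) C assms(2)])
        (use assms quotient_basis_subset quotient_basis_indep[OF assms(3,2)] in auto)
  qed
  moreover have "quotient_dim V W = enat (card C)"
    unfolding quotient_dim_def C_def using assms by auto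
  ultimately show ?thesis by simp
qed

definition fin_quotient :: "'b set \<Rightarrow> 'b set \<Rightarrow> bool" where
  "fin_quotient V W \<longleftrightarrow> (\<exists>B. finite B \<and> quotient_basis V W B)"

text \<open>Natural numbers let dimension identities be combined by linear arithmetic; the value is
  meaningful only under \<open>fin_quotient\<close>.\<close>

definition qdim :: "'b set \<Rightarrow> 'b set \<Rightarrow> nat" where
  "qdim V W = the_enat (quotient_dim V W)"

lemma qdim_eq: "subspace W \<Longrightarrow> finite B \<Longrightarrow> quotient_basis V W B \<Longrightarrow> qdim V W = card B"
  by (simp add: qdim_def quotient_dim_eq)

lemma quotient_dim_qdim: "subspace W \<Longrightarrow> fin_quotient V W \<Longrightarrow> quotient_dim V W = enat (qdim V W)"
  unfolding fin_quotient_def by (metis quotient_dim_eq qdim_eq)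

text \<open>A basis \<open>C\<close> of \<open>W\<close> extends to a basis \<open>D\<close> of
  \<open>V\<close>, and \<open>D - C\<close> then represents a basis of the quotient.\<close>

lemma fin_quotient_if_spanned:
  assumes "finite X" "V \<subseteq> span X" "subspace V" "subspace W" "W \<subseteq> V"
  shows "fin_quotient V W"
proof -
  obtain C where C: "C \<subseteq> W" "independent C" "W \<subseteq> span C"
    using maximal_independent_subset by blast
  obtain D where D: "C \<subseteq> D" "D \<subseteq> V" "independent D" "V \<subseteq> span D"
    using maximal_independent_subset_extend[of C V] C assms(5) by blast
  have fin: "finite D" using independent_span_bound[OF assms(1) D(3)] D assms(2) by auto
  have "quotient_basis V W (D - C)"
  proof (rule quotient_basisI)
    fix c b assume s: "(\<Sum>b\<in>D - C. scale (c b) b) \<in> W" and b: "b \<in> D - C"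
    then have "(\<Sum>b\<in>D - C. scale (c b) b) \<in> span C" using C by blast
    then obtain c' where c': "(\<Sum>b\<in>D - C. scale (c b) b) = (\<Sum>b\<in>C. scale (c' b) b)"
      using span_finite[of C] fin D(1) finite_subset by blast
    have "(\<Sum>b\<in>D. scale (if b \<in> C then - c' b else c b) b)
        = (\<Sum>b\<in>D - C. scale (if b \<in> C then - c' b else c b) b)
          + (\<Sum>b\<in>C. scale (if b \<in> C then - c' b else c b) b)"
      using D(1) fin by (rule sum.subset_diff)
    also have "\<dots> = (\<Sum>b\<in>D - C. scale (c b) b) + - (\<Sum>b\<in>C. scale (c' b) b)"
      by (intro arg_cong2[of _ _ _ _ "(+)"]) (auto simp: sum_negf[symmetric] intro: sum.cong)
    also have "\<dots> = 0" using c' by simp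
    finally have s0: "(\<Sum>b\<in>D. scale (if b \<in> C then - c' b else c b) b) = 0" .
    have "\<forall>b\<in>D. (if b \<in> C then - c' b else c b) = 0"
      by (rule independentD[OF D(3) fin order_refl s0, THEN ballI])
    then show "c b = 0" using b by auto
  next
    fix v assume "v \<in> V"
    then obtain c where "v = (\<Sum>b\<in>D. scale (c b) b)"
      using span_finite[OF fin] D(4) by blast
    then have "v = (\<Sum>b\<in>D - C. scale (c b) b) + (\<Sum>b\<in>C. scale (c b) b)"
      using D(1) fin by (simp add: sum.subset_diff)
    moreover have "(\<Sum>b\<in>C. scale (c b) b) \<in> W"
      using C(1) assms(4) by (intro subspace_sum subspace_scale) auto
    ultimately show "\<exists>c. v - (\<Sum>b\<in>D - C. scale (c b) b) \<in> W"
      by (metis add_diff_cancel_left')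
  qed (use fin D assms in auto)
  then show ?thesis using fin unfolding fin_quotient_def by blast
qed

text \<open>Reducing a relation modulo \<open>W\<close> isolates the coefficients on
  \<open>A\<close>; once these vanish, reducing modulo \<open>U\<close> isolates those on
  \<open>B\<close>.\<close>

lemma quotient_basis_Un:
  assumes sU: "subspace U" "subspace W" and UW: "U \<subseteq> W" "W \<subseteq> V"
    and A: "finite A" "quotient_basis V W A" and B: "finite B" "quotient_basis W U B"
  shows "A \<inter> B = {}" "quotient_basis V U (A \<union> B)"
proof -
  show disj: "A \<inter> B = {}"
  proof (rule ccontr)
    assume "A \<inter> B \<noteq> {}"
    then obtain a where a: "a \<in> A" "a \<in> B" by auto
    then have "a \<in> W" using quotient_basis_subset B by blast
    then show False
      using quotient_basis_indep[OF A(2), of "{a}" "\<lambda>_. 1" a] a by simp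
  qed
  show "quotient_basis V U (A \<union> B)"
  proof (rule quotient_basisI)
    show "A \<union> B \<subseteq> V" using A B UW quotient_basis_subset by blast
  next
    fix c b assume s: "(\<Sum>b\<in>A \<union> B. scale (c b) b) \<in> U" and b: "b \<in> A \<union> B"
    have eq: "(\<Sum>b\<in>A \<union> B. scale (c b) b) = (\<Sum>b\<in>A. scale (c b) b) + (\<Sum>b\<in>B. scale (c b) b)"
      using A B disj by (simp add: sum.union_disjoint)
    have BW: "(\<Sum>b\<in>B. scale (c b) b) \<in> W"
      using quotient_basis_subset[OF B(2)] sU by (intro subspace_sum subspace_scale) auto
    then have "(\<Sum>b\<in>A. scale (c b) b) \<in> W"
      using s eq UW sU subspace_diff[OF sU(2), of "\<Sum>b\<in>A \<union> B. scale (c b) b" "\<Sum>b\<in>B. scale (c b) b"]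
      by auto
    then have cA: "c b = 0" if "b \<in> A" for b
      using quotient_basis_indep[OF A(2)] A(1) that by blast
    then have "(\<Sum>b\<in>B. scale (c b) b) \<in> U" using s eq by simp
    then have "c b = 0" if "b \<in> B" for b
      using quotient_basis_indep[OF B(2)] B(1) that by blast
    with cA b show "c b = 0" by auto
  next
    fix v assume "v \<in> V"
    then obtain c where c: "v - (\<Sum>b\<in>A. scale (c b) b) \<in> W"
      using quotient_basis_repr[OF A(2,1)] by blast
    obtain c' where c': "v - (\<Sum>b\<in>A. scale (c b) b) - (\<Sum>b\<in>B. scale (c' b) b) \<in> U"
      using quotient_basis_repr[OF B(2,1) c] by blast
    have "(\<Sum>b\<in>A \<union> B. scale (if b \<in> A then c b else c' b) b)
       = (\<Sum>b\<in>A. scale (c b) b) + (\<Sum>b\<in>B. scale (c' b) b)"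
      using A B disj by (subst sum.union_disjoint) (auto intro!: arg_cong2[of _ _ _ _ "(+)"] sum.cong)
    then show "\<exists>c. v - (\<Sum>b\<in>A \<union> B. scale (c b) b) \<in> U"
      using c' by (intro exI[of _ "\<lambda>b. if b \<in> A then c b else c' b"]) (simp add: algebra_simps)
  qed (use A B sU in auto)
qed

lemma qdim_add:
  assumes "subspace U" "subspace W" "U \<subseteq> W" "W \<subseteq> V" "fin_quotient V W" "fin_quotient W U"
  shows "qdim V U = qdim V W + qdim W U"
proof -
  obtain A B where AB: "finite A" "quotient_basis V W A" "finite B" "quotient_basis W U B"
    using assms unfolding fin_quotient_def by blast
  show ?thesis
    using quotient_basis_Un[OF assms(1-4) AB] AB assms
    by (simp add: qdim_eq[of _ "A \<union> B"] qdim_eq[of _ A] qdim_eq[of _ B] card_Un_disjoint)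
qed

lemma qdim_eq_0_iff:
  assumes "subspace W" "fin_quotient V W"
  shows "qdim V W = 0 \<longleftrightarrow> V \<subseteq> W"
proof
  obtain A where A: "finite A" "quotient_basis V W A" using assms unfolding fin_quotient_def by blast
  {
    assume "qdim V W = 0"
    then have "A = {}" using A assms by (simp add: qdim_eq)
    then show "V \<subseteq> W" using quotient_basis_repr[OF A(2,1)] by auto
  next
    assume "V \<subseteq> W"
    then have "quotient_basis V W {}" using assms by (intro quotient_basisI) auto
    then show "qdim V W = 0" using assms by (simp add: qdim_eq[of _ "{}"])
  }
qed

lemma qdim_same: "subspace V \<Longrightarrow> qdim V V = 0"
  by (rule qdim_eq[of _ "{}", simplified]) (auto intro: quotient_basisI)

lemma qdim_1_coord:
  assumes "subspace W" "fin_quotient V W" "qdim V W = 1"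
  obtains w where "w \<in> V" "w \<notin> W" "\<And>v. v \<in> V \<Longrightarrow> \<exists>c. v - scale c w \<in> W"
proof -
  obtain A where A: "finite A" "quotient_basis V W A" using assms unfolding fin_quotient_def by blast
  then have "card A = 1" using assms by (simp add: qdim_eq)
  then obtain w where w: "A = {w}" using card_1_singletonE by blast
  have "w \<in> V" using A w quotient_basis_subset by blast
  moreover have "w \<notin> W" using quotient_basis_indep[OF A(2), of "{w}" "\<lambda>_. 1" w] w by auto
  moreover have "\<exists>c. v - scale c w \<in> W" if "v \<in> V" for v
    using quotient_basis_repr[OF A(2,1) that] w by auto
  ultimately show ?thesis by (rule that)
qed

text \<open>The family is indexed because the vectors \<open>v i\<close> may coincide; a coincidence
  is itself a nontrivial relation.\<close>

lemma dependent_mod: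
  assumes "subspace W" "fin_quotient V W" "finite I" "\<And>i. i \<in> I \<Longrightarrow> v i \<in> V" "qdim V W < card I"
  shows "\<exists>c. (\<exists>i\<in>I. c i \<noteq> 0) \<and> (\<Sum>i\<in>I. scale (c i) (v i)) \<in> W"
proof (rule ccontr)
  assume "\<not> ?thesis"
  then have ind: "c i = 0" if "(\<Sum>i\<in>I. scale (c i) (v i)) \<in> W" "i \<in> I" for c i using that by blast
  have inj: "inj_on v I"
  proof (rule inj_onI, rule ccontr)
    fix x y assume xy: "x \<in> I" "y \<in> I" "v x = v y" "x \<noteq> y"
    let ?c = "\<lambda>i. if i = x then 1 else if i = y then - 1 else 0"
    have "(\<Sum>i\<in>I. scale (?c i) (v i)) = (\<Sum>i\<in>{x,y}. scale (?c i) (v i))"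
      using xy assms by (intro sum.mono_neutral_right) auto
    also have "\<dots> = 0" using xy by simp
    finally have "(\<Sum>i\<in>I. scale (?c i) (v i)) \<in> W" using assms(1) subspace_0 by simp
    from ind[OF this xy(1)] show False by simp
  qed
  obtain B where B: "finite B" "quotient_basis V W B" using assms unfolding fin_quotient_def by blast
  have "card (v ` I) \<le> card B"
  proof (rule quotient_basis_card_le[OF assms(1) B])
    fix c b assume s: "(\<Sum>b\<in>v ` I. scale (c b) b) \<in> W" "b \<in> v ` I"
    then have "(\<Sum>i\<in>I. scale (c (v i)) (v i)) \<in> W" by (simp add: sum.reindex[OF inj])
    then show "c b = 0" using s ind by auto
  qed (use assms in auto)
  then show False using assms B inj by (simp add: card_image qdim_eq)
qed

lemma qdim_ge_if_independent:
  assumes "subspace W" "fin_quotient V W" "finite I" "\<And>i. i \<in> I \<Longrightarrow> v i \<in> V"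
    and "\<And>c i. (\<Sum>i\<in>I. scale (c i) (v i)) \<in> W \<Longrightarrow> i \<in> I \<Longrightarrow> c i = 0"
  shows "card I \<le> qdim V W"
  using dependent_mod[of W V I v] assms by (meson not_le)

end

text \<open>The map \<phi> induces an isomorphism from \<open>V\<close> modulo the preimage of
  \<open>W'\<close> onto \<open>V'\<close> modulo \<open>W'\<close>. Source and target may have
  different types, so that forms can be compared with power series.\<close>

lemma quotient_basis_transport:
  fixes s1 :: "'a::field \<Rightarrow> 'b::ab_group_add \<Rightarrow> 'b" and s2 :: "'a \<Rightarrow> 'c::ab_group_add \<Rightarrow> 'c"
  assumes q1: "quotient_space s1" and q2: "quotient_space s2"
    and sV: "module.subspace s1 V" and sW: "module.subspace s2 W'"
    and add: "\<And>x y. x \<in> V \<Longrightarrow> y \<in> V \<Longrightarrow> \<phi> (x + y) = \<phi> x + \<phi> y"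
    and scl: "\<And>c x. x \<in> V \<Longrightarrow> \<phi> (s1 c x) = s2 c (\<phi> x)"
    and im: "\<And>x. x \<in> V \<Longrightarrow> \<phi> x \<in> V'"
    and sur: "\<And>y. y \<in> V' \<Longrightarrow> \<exists>x\<in>V. y - \<phi> x \<in> W'"
    and B: "finite B" "quotient_space.quotient_basis s1 V {x\<in>V. \<phi> x \<in> W'} B"
  shows "quotient_space.quotient_basis s2 V' W' (\<phi> ` B)" "card (\<phi> ` B) = card B"
proof -
  interpret q1: quotient_space s1 by fact
  interpret q2: quotient_space s2 by fact
  have BV: "B \<subseteq> V" using q1.quotient_basis_subset[OF B(2)] .
  have sumV: "(\<Sum>b\<in>A. s1 (c b) b) \<in> V" if "A \<subseteq> B" for A c
    using that BV sV by (intro q1.subspace_sum q1.subspace_scale) auto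
  have phisum: "\<phi> (\<Sum>b\<in>A. s1 (c b) b) = (\<Sum>b\<in>A. s2 (c b) (\<phi> b))" if "A \<subseteq> B" for A c
    using finite_subset[OF that B(1)] that
  proof (induction A rule: finite_induct)
    case empty
    have "\<phi> (0 + 0) = \<phi> 0 + \<phi> 0" using sV q1.subspace_0 by (intro add) auto
    then show ?case by simp
  next
    case (insert x F)
    then have "x \<in> V" using BV by auto
    moreover have "(\<Sum>b\<in>F. s1 (c b) b) \<in> V" using insert sumV by auto
    moreover have "s1 (c x) x \<in> V" using sV \<open>x \<in> V\<close> by (simp add: q1.subspace_scale)
    ultimately show ?case using insert by (simp add: add scl)
  qed
  have ind: "c b = 0" if "(\<Sum>b\<in>B. s2 (c b) (\<phi> b)) \<in> W'" "b \<in> B" for c b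
    using q1.quotient_basis_indep[OF B(2) B(1), of c b] that sumV[of B c] phisum[of B c] by auto
  have inj: "inj_on \<phi> B"
  proof (rule inj_onI, rule ccontr)
    fix x y assume xy: "x \<in> B" "y \<in> B" "\<phi> x = \<phi> y" "x \<noteq> y"
    let ?c = "\<lambda>i. if i = x then 1 else if i = y then - 1 else 0"
    have "(\<Sum>i\<in>B. s2 (?c i) (\<phi> i)) = (\<Sum>i\<in>{x,y}. s2 (?c i) (\<phi> i))"
      using xy B by (intro sum.mono_neutral_right) auto
    also have "\<dots> = 0" using xy by simp
    finally have "(\<Sum>i\<in>B. s2 (?c i) (\<phi> i)) \<in> W'" using sW q2.subspace_0 by simp
    from ind[OF this xy(1)] show False by simp
  qed
  then show "card (\<phi> ` B) = card B" by (rule card_image)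
  show "q2.quotient_basis V' W' (\<phi> ` B)"
  proof (rule q2.quotient_basisI)
    fix c b assume s: "(\<Sum>b\<in>\<phi> ` B. s2 (c b) b) \<in> W'" "b \<in> \<phi> ` B"
    then have "(\<Sum>i\<in>B. s2 (c (\<phi> i)) (\<phi> i)) \<in> W'" by (simp add: sum.reindex[OF inj])
    then show "c b = 0" using s ind[of "\<lambda>b. c (\<phi> b)"] by auto
  next
    fix v assume "v \<in> V'"
    then obtain x where x: "x \<in> V" "v - \<phi> x \<in> W'" using sur by blast
    obtain c where c: "x - (\<Sum>b\<in>B. s1 (c b) b) \<in> {x\<in>V. \<phi> x \<in> W'}"
      using q1.quotient_basis_repr[OF B(2,1) x(1)] by blast
    have "\<phi> (x - (\<Sum>b\<in>B. s1 (c b) b) + (\<Sum>b\<in>B. s1 (c b) b)) =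
       \<phi> (x - (\<Sum>b\<in>B. s1 (c b) b)) + \<phi> (\<Sum>b\<in>B. s1 (c b) b)"
      using c sumV by (intro add) auto
    then have "\<phi> x - (\<Sum>b\<in>B. s2 (c b) (\<phi> b)) \<in> W'" using c phisum[of B c] by auto
    then have "v - \<phi> x + (\<phi> x - (\<Sum>b\<in>B. s2 (c b) (\<phi> b))) \<in> W'"
      using x(2) sW q2.subspace_add by blast
    then have "v - (\<Sum>b\<in>B. s2 (c b) (\<phi> b)) \<in> W'" by simp
    moreover have "(\<Sum>b\<in>B. s2 (c b) (\<phi> b)) = (\<Sum>b\<in>\<phi> ` B. s2 (c (inv_into B \<phi> b)) b)"
      by (simp add: sum.reindex[OF inj] inv_into_f_f[OF inj])
    ultimately show "\<exists>c. v - (\<Sum>b\<in>\<phi> ` B. s2 (c b) b) \<in> W'"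
      by (intro exI[of _ "\<lambda>b. c (inv_into B \<phi> b)"]) simp
  qed (use B BV im sW in auto)
qed

lemma qdim_transport:
  fixes s1 :: "'a::field \<Rightarrow> 'b::ab_group_add \<Rightarrow> 'b" and s2 :: "'a \<Rightarrow> 'c::ab_group_add \<Rightarrow> 'c"
  assumes q1: "quotient_space s1" and q2: "quotient_space s2"
    and sV: "module.subspace s1 V" and sW: "module.subspace s2 W'"
    and add: "\<And>x y. x \<in> V \<Longrightarrow> y \<in> V \<Longrightarrow> \<phi> (x + y) = \<phi> x + \<phi> y"
    and scl: "\<And>c x. x \<in> V \<Longrightarrow> \<phi> (s1 c x) = s2 c (\<phi> x)"
    and im: "\<And>x. x \<in> V \<Longrightarrow> \<phi> x \<in> V'"
    and sur: "\<And>y. y \<in> V' \<Longrightarrow> \<exists>x\<in>V. y - \<phi> x \<in> W'"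
    and ker: "\<And>x. x \<in> V \<Longrightarrow> \<phi> x \<in> W' \<longleftrightarrow> x \<in> W" and WV: "W \<subseteq> V" and sW1: "module.subspace s1 W"
    and fin: "quotient_space.fin_quotient s1 V W"
  shows "quotient_space.fin_quotient s2 V' W'" "quotient_space.qdim s2 V' W' = quotient_space.qdim s1 V W"
    "quotient_space.quotient_dim s2 V' W' = enat (quotient_space.qdim s1 V W)"
proof -
  interpret q1: quotient_space s1 by fact
  interpret q2: quotient_space s2 by fact
  have W: "{x\<in>V. \<phi> x \<in> W'} = W" using ker WV by auto
  obtain B where B: "finite B" "q1.quotient_basis V W B"
    using fin unfolding q1.fin_quotient_def by blast
  have t: "q2.quotient_basis V' W' (\<phi> ` B)" "card (\<phi> ` B) = card B"
    using quotient_basis_transport[OF q1 q2 sV sW, of \<phi> V' B] add scl im sur B by (auto simp: W)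
  show "q2.fin_quotient V' W'" using t(1) B unfolding q2.fin_quotient_def by blast
  then show "q2.qdim V' W' = q1.qdim V W" "q2.quotient_dim V' W' = enat (q1.qdim V W)"
    using t q2.qdim_eq[OF sW, of "\<phi> ` B" V'] q1.qdim_eq[OF sW1 B] B q2.quotient_dim_qdim[OF sW] by auto
qed

context quotient_space
begin

text \<open>Modulo \<open>W\<close>, an element \<open>u\<close> is determined by the values of
  \<open>\<beta> u\<close> on a basis of \<open>V'\<close> modulo \<open>W'\<close>, so
  \<open>V/W\<close> embeds in the dual of \<open>V'/W'\<close>. Equality of dimensions will come
  from applying the bound in both directions.\<close>

lemma qdim_pairing_le:
  assumes sub: "subspace V" "subspace V'" "subspace W" "subspace W'" "W' \<subseteq> V'"
    and fin: "fin_quotient V W" "fin_quotient V' W'"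
    and add1: "\<And>u v w. u \<in> V \<Longrightarrow> v \<in> V \<Longrightarrow> w \<in> V' \<Longrightarrow> \<beta> (u + v) w = \<beta> u w + \<beta> v w"
    and scl1: "\<And>c u w. u \<in> V \<Longrightarrow> w \<in> V' \<Longrightarrow> \<beta> (scale c u) w = c * \<beta> u w"
    and add2: "\<And>u v w. u \<in> V \<Longrightarrow> v \<in> V' \<Longrightarrow> w \<in> V' \<Longrightarrow> \<beta> u (v + w) = \<beta> u v + \<beta> u w"
    and scl2: "\<And>c u w. u \<in> V \<Longrightarrow> w \<in> V' \<Longrightarrow> \<beta> u (scale c w) = c * \<beta> u w"
    and rad1: "\<And>u. u \<in> V \<Longrightarrow> (\<And>w. w \<in> V' \<Longrightarrow> \<beta> u w = 0) \<Longrightarrow> u \<in> W"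
    and rad2: "\<And>u w. u \<in> V \<Longrightarrow> w \<in> W' \<Longrightarrow> \<beta> u w = 0"
  shows "qdim V W \<le> qdim V' W'"
proof -
  obtain A where A: "finite A" "quotient_basis V W A" using fin unfolding fin_quotient_def by blast
  obtain B where B: "finite B" "quotient_basis V' W' B" using fin unfolding fin_quotient_def by blast
  note AV = quotient_basis_subset[OF A(2)] and BV = quotient_basis_subset[OF B(2)]
  \<comment> \<open>The functional \<open>\<beta> u\<close> is stored as the vector of
    \<open>V'\<close> with coordinates \<open>\<beta> u b\<close>, so that a linear dependency can
    be sought inside \<open>V'\<close> itself.\<close>
  define \<Phi> where "\<Phi> u = (\<Sum>b\<in>B. scale (\<beta> u b) b)" for u
  have sumL: "\<beta> (\<Sum>a\<in>A'. scale (c a) a) w = (\<Sum>a\<in>A'. c a * \<beta> a w) \<and> (\<Sum>a\<in>A'. scale (c a) a) \<in> V"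
    if "w \<in> V'" "A' \<subseteq> A" for A' c w
    using finite_subset[OF that(2) A(1)] that(2)
  proof (induction A' rule: finite_induct)
    case empty
    have "\<beta> (scale 0 0) w = 0 * \<beta> 0 w" using sub that by (intro scl1 subspace_0) auto
    then show ?case using sub subspace_0 by simp
  next
    case (insert x F)
    then show ?case using AV sub that by (auto simp: add1 scl1 subspace_scale subspace_add)
  qed
  have sumR: "\<beta> u (\<Sum>b\<in>B'. scale (c b) b) = (\<Sum>b\<in>B'. c b * \<beta> u b) \<and> (\<Sum>b\<in>B'. scale (c b) b) \<in> V'"
    if "u \<in> V" "B' \<subseteq> B" for B' c u
    using finite_subset[OF that(2) B(1)] that(2)
  proof (induction B' rule: finite_induct)
    case empty
    have "\<beta> u (scale 0 0) = 0 * \<beta> u 0" using sub that by (intro scl2 subspace_0) auto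
    then show ?case using sub subspace_0 by simp
  next
    case (insert x F)
    then show ?case using BV sub that by (auto simp: add2 scl2 subspace_scale subspace_add)
  qed
  have ker: "u \<in> W" if u: "u \<in> V" "\<Phi> u \<in> W'" for u
  proof (rule rad1[OF u(1)])
    have 0: "\<beta> u b = 0" if "b \<in> B" for b
      using quotient_basis_indep[OF B(2) B(1), of "\<beta> u"] u that unfolding \<Phi>_def by blast
    fix w assume w: "w \<in> V'"
    obtain c where c: "w - (\<Sum>b\<in>B. scale (c b) b) \<in> W'"
      using quotient_basis_repr[OF B(2,1) w] by blast
    have "\<beta> u (w - (\<Sum>b\<in>B. scale (c b) b) + (\<Sum>b\<in>B. scale (c b) b))
       = \<beta> u (w - (\<Sum>b\<in>B. scale (c b) b)) + \<beta> u (\<Sum>b\<in>B. scale (c b) b)"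
      using c sub u sumR[OF u(1), of B c] by (intro add2) auto
    also have "\<dots> = 0" using rad2[OF u(1) c] sumR[OF u(1), of B c] 0 by simp
    finally show "\<beta> u w = 0" by simp
  qed
  show ?thesis
  proof (rule ccontr)
    assume "\<not> ?thesis"
    then have lt: "qdim V' W' < card A" using qdim_eq[OF sub(3) A] by simp
    have "\<Phi> a \<in> V'" if "a \<in> A" for a
      unfolding \<Phi>_def using BV sub by (intro subspace_sum subspace_scale) auto
    from dependent_mod[where v = \<Phi>, OF sub(4) fin(2) A(1) this lt]
    obtain c where c: "\<exists>a\<in>A. c a \<noteq> 0" "(\<Sum>a\<in>A. scale (c a) (\<Phi> a)) \<in> W'" by auto
    have "(\<Sum>a\<in>A. scale (c a) (\<Phi> a)) = (\<Sum>a\<in>A. \<Sum>b\<in>B. scale (c a * \<beta> a b) b)"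
      unfolding \<Phi>_def by (simp add: scale_sum_right)
    also have "\<dots> = (\<Sum>b\<in>B. \<Sum>a\<in>A. scale (c a * \<beta> a b) b)" by (rule sum.swap)
    also have "\<dots> = \<Phi> (\<Sum>a\<in>A. scale (c a) a)"
      unfolding \<Phi>_def
    proof (rule sum.cong[OF refl])
      fix b assume "b \<in> B"
      then have "b \<in> V'" using BV by auto
      from sumL[OF this, of A c] show
        "(\<Sum>a\<in>A. scale (c a * \<beta> a b) b) = scale (\<beta> (\<Sum>a\<in>A. scale (c a) a) b) b"
        by (simp add: scale_sum_left)
    qed
    finally have "(\<Sum>a\<in>A. scale (c a) a) \<in> W"
      using c(2) AV sub by (intro ker) (auto intro!: subspace_sum subspace_scale)
    then show False using quotient_basis_indep[OF A(2) A(1)] c(1) by blast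
  qed
qed

end

subsection \<open>Homogeneous polynomials\<close>

abbreviation (input) "keys \<equiv> Poly_Mapping.keys"
abbreviation (input) "lookup \<equiv> Poly_Mapping.lookup"
abbreviation (input) "single \<equiv> Poly_Mapping.single"

lemma mdeg_superset: "finite A \<Longrightarrow> keys m \<subseteq> A \<Longrightarrow> mdeg m = (\<Sum>i\<in>A. lookup m i)"
  unfolding mdeg_def by (rule sum.mono_neutral_left) (auto simp: in_keys_iff)

lemma mdeg_add: "mdeg (a + b) = mdeg a + mdeg b"
proof -
  let ?A = "keys a \<union> keys b"
  have "keys (a + b) \<subseteq> ?A" by (rule Poly_Mapping.keys_add)
  then show ?thesis
    by (simp add: mdeg_superset[of ?A] lookup_add sum.distrib)
qed

lemma mdeg_zero [simp]: "mdeg 0 = 0"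
  by (simp add: mdeg_def)

lemma mdeg_single [simp]: "mdeg (single i k) = k"
  by (simp add: mdeg_superset[of "{i}"])

lemma mdeg_eq_0_iff: "mdeg m = 0 \<longleftrightarrow> m = 0"
proof
  assume "mdeg m = 0"
  then have "\<forall>i. lookup m i = 0" by (auto simp: mdeg_def in_keys_iff)
  then show "m = 0" by (intro poly_mapping_eqI) simp
qed simp

lemma keys_add_monom: "keys (a + b :: monom) = keys a \<union> keys b"
  by (auto simp: in_keys_iff lookup_add)

lemma poly_mapping_eq_sum_single:
  fixes p :: "'a \<Rightarrow>\<^sub>0 'b::comm_monoid_add"
  shows "p = (\<Sum>m\<in>keys p. single m (lookup p m))"
proof (rule poly_mapping_eqI)
  fix k
  have "lookup (\<Sum>m\<in>keys p. single m (lookup p m)) k = (\<Sum>m\<in>keys p. if m = k then lookup p m else 0)"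
    by (simp add: lookup_sum lookup_single when_def)
  also have "\<dots> = lookup p k" by (simp add: in_keys_iff)
  finally show "lookup p k = lookup (\<Sum>m\<in>keys p. single m (lookup p m)) k" by simp
qed

lemma monom_split_var:
  fixes m :: monom
  assumes "i \<in> keys m"
  shows "\<exists>m'. m = single i 1 + m'"
proof -
  have "lookup m i > 0" using assms by (simp add: in_keys_iff)
  then have "m = single i 1 + (m - single i 1)"
    by (intro poly_mapping_eqI) (auto simp: lookup_add lookup_minus lookup_single when_def)
  then show ?thesis ..
qed

lemma lookup_mpoly_scale [simp]: "lookup (mpoly_scale c p) m = c * lookup p m"
proof -
  have "mpoly_scale c p = Poly_Mapping.map ((*) c) p"
    by (simp add: mpoly_scale_def mult_map_scale_conv_mult)
  then show ?thesis by (simp add: Poly_Mapping.map.rep_eq when_def)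
qed

lemma mpoly_scale_mult_left: "mpoly_scale c (p * q) = mpoly_scale c p * q"
  by (simp add: mpoly_scale_def mult.assoc)

lemma mpoly_scale_mult_right: "mpoly_scale c (p * q) = p * mpoly_scale c q"
  by (simp add: mpoly_scale_def ac_simps)

lemma zero_in_polys [simp]: "0 \<in> polys n" by (simp add: polys_def)

lemma one_in_polys [simp]: "1 \<in> polys n"
  by (simp add: polys_def)

lemma polys_add: "p \<in> polys n \<Longrightarrow> q \<in> polys n \<Longrightarrow> p + q \<in> polys n"
  unfolding polys_def using Poly_Mapping.keys_add[of p q] by blast

lemma keys_mult_subset: "keys (p * q :: mpoly) \<subseteq> {a + b | a b. a \<in> keys p \<and> b \<in> keys q}"
  by (rule keys_mult)

lemma polys_mult: "p \<in> polys n \<Longrightarrow> q \<in> polys n \<Longrightarrow> p * q \<in> polys n"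
  unfolding polys_def using keys_mult_subset[of p q] keys_add_monom by (fastforce simp: subset_iff)

lemma homog_polys: "p \<in> homog n k \<Longrightarrow> p \<in> polys n"
  by (simp add: homog_def)

lemma homog_mdeg: "p \<in> homog n k \<Longrightarrow> m \<in> keys p \<Longrightarrow> int (mdeg m) = k"
  by (simp add: homog_def)

lemma homog_vars: "p \<in> homog n k \<Longrightarrow> m \<in> keys p \<Longrightarrow> keys m \<subseteq> {..n}"
  by (simp add: homog_def polys_def)

lemma homogI: "(\<And>m. m \<in> keys p \<Longrightarrow> keys m \<subseteq> {..n} \<and> int (mdeg m) = k) \<Longrightarrow> p \<in> homog n k"
  by (auto simp: homog_def polys_def)

lemma subspace_homog [simp, intro]: "mpoly.subspace (homog n k)"
proof (rule mpoly.subspaceI)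
  show "0 \<in> homog n k" by (simp add: homog_def)
next
  fix x y assume "x \<in> homog n k" "y \<in> homog n k"
  then show "x + y \<in> homog n k"
    using Poly_Mapping.keys_add[of x y] unfolding homog_def polys_def by blast
next
  fix c x assume "x \<in> homog n k"
  then show "mpoly_scale c x \<in> homog n k"
    by (auto simp: homog_def polys_def in_keys_iff)
qed

lemmas homog_0 [simp] = mpoly.subspace_0[OF subspace_homog]
lemmas homog_add = mpoly.subspace_add[OF subspace_homog]
lemmas homog_diff = mpoly.subspace_diff[OF subspace_homog]
lemmas homog_scale = mpoly.subspace_scale[OF subspace_homog]
lemmas homog_sum = mpoly.subspace_sum[OF subspace_homog]

lemma homog_neg_degree: "k < 0 \<Longrightarrow> homog n k = {0}"
  by (auto simp: homog_def polys_def in_keys_iff intro!: poly_mapping_eqI)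

lemma homog_mult:
  assumes "p \<in> homog n i" "q \<in> homog n j"
  shows "p * q \<in> homog n (i + j)"
proof (rule homogI)
  fix m assume "m \<in> keys (p * q)"
  then obtain a b where "m = a + b" "a \<in> keys p" "b \<in> keys q" using keys_mult_subset by blast
  then show "keys m \<subseteq> {..n} \<and> int (mdeg m) = i + j"
    using homog_mdeg[OF assms(1)] homog_mdeg[OF assms(2)] homog_vars[OF assms(1)] homog_vars[OF assms(2)]
    by (auto simp: keys_add_monom mdeg_add subset_iff)
qed

lemma homog_mult': "p \<in> homog n i \<Longrightarrow> q \<in> homog n j \<Longrightarrow> k = i + j \<Longrightarrow> p * q \<in> homog n k"
  using homog_mult by blast

lemma one_in_homog [simp]: "1 \<in> homog n 0"
  by (rule homogI) auto

lemma homog_power: "p \<in> homog n i \<Longrightarrow> p ^ t \<in> homog n (int t * i)"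
  by (induction t) (auto simp: algebra_simps dest: homog_mult)

lemma single_in_homog: "keys m \<subseteq> {..n} \<Longrightarrow> k = int (mdeg m) \<Longrightarrow> single m c \<in> homog n k"
  by (rule homogI) (auto split: if_splits)

lemma mpoly_var_in_homog [simp]: "i \<le> n \<Longrightarrow> mpoly_var i \<in> homog n 1"
  unfolding mpoly_var_def by (rule single_in_homog) auto

lemma homog_prod:
  "finite A \<Longrightarrow> (\<And>a. a \<in> A \<Longrightarrow> p a \<in> homog n (\<delta> a)) \<Longrightarrow> prod p A \<in> homog n (\<Sum>a\<in>A. \<delta> a)"
  by (induction A rule: finite_induct) (auto intro!: homog_mult)

lemma homog_monom_induct [consumes 1, case_names zero add monom]:
  assumes "h \<in> homog n k" "P 0" "\<And>p q. P p \<Longrightarrow> P q \<Longrightarrow> P (p + q)"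
    and "\<And>m c. keys m \<subseteq> {..n} \<Longrightarrow> int (mdeg m) = k \<Longrightarrow> P (single m c)"
  shows "P h"
proof -
  have "P (\<Sum>m\<in>A. single m (lookup h m))" if "A \<subseteq> keys h" for A
    using finite_subset[OF that finite_keys] that
    by (induction A rule: finite_induct)
      (auto intro!: assms dest: homog_vars[OF assms(1)] homog_mdeg[OF assms(1)])
  then show ?thesis using poly_mapping_eq_sum_single[of h] by (metis order_refl)
qed

lemma polys_monom_induct [consumes 1, case_names zero add monom]:
  assumes "h \<in> polys n" "P 0" "\<And>p q. P p \<Longrightarrow> P q \<Longrightarrow> P (p + q)"
    and "\<And>m c. keys m \<subseteq> {..n} \<Longrightarrow> m \<in> keys h \<Longrightarrow> P (single m c)"
  shows "P h"
proof -
  have "P (\<Sum>m\<in>A. single m (lookup h m))" if "A \<subseteq> keys h" for A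
    using finite_subset[OF that finite_keys] that assms(1)
    by (induction A rule: finite_induct) (auto intro!: assms(2,3,4) simp: polys_def)
  then show ?thesis using poly_mapping_eq_sum_single[of h] by (metis order_refl)
qed

lemma single_var_mult: "single (single i 1 + m) c = mpoly_var i * single m c"
  by (simp add: mpoly_var_def mult_single)

text \<open>Rests on the fact that a monomial of positive degree is divisible by a variable; hence
  the restriction to \<open>k \<ge> 0\<close>.\<close>

lemma homog_step_induct [consumes 1, case_names nonneg zero add var]:
  assumes "h \<in> homog n (k + 1)" "k \<ge> 0" "P 0" "\<And>p q. P p \<Longrightarrow> P q \<Longrightarrow> P (p + q)"
    and "\<And>j u. j \<le> n \<Longrightarrow> u \<in> homog n k \<Longrightarrow> P (mpoly_var j * u)"
  shows "P h"
  using assms(1)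
proof (induction rule: homog_monom_induct)
  case (monom m c)
  then have "m \<noteq> 0" using assms(2) by auto
  then obtain i where i: "i \<in> keys m" by (metis poly_mapping_eqI in_keys_iff lookup_zero)
  then obtain m' where m': "m = single i 1 + m'" using monom_split_var by blast
  have "single m' c \<in> homog n k"
    using monom m' by (intro single_in_homog) (auto simp: keys_add_monom mdeg_add)
  then show ?case using assms(5)[of i "single m' c"] i monom(1) unfolding m' single_var_mult by auto
qed (use assms in auto)

lemma homog_zero_degree: "h \<in> homog n 0 \<Longrightarrow> \<exists>c. h = single 0 c"
proof (induction rule: homog_monom_induct)
  case zero
  show ?case by (rule exI[of _ 0]) simp
next
  case (add p q)
  then show ?case by (metis single_add)
next
  case (monom m c)
  then show ?case by (auto simp: mdeg_eq_0_iff)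
qed

lemma homog_mult_induct [consumes 1, case_names nonneg1 nonneg2 zero add mult]:
  assumes "h \<in> homog n (i + j)" "i \<ge> 0" "j \<ge> 0" "P 0" "\<And>p q. P p \<Longrightarrow> P q \<Longrightarrow> P (p + q)"
    and "\<And>a b. a \<in> homog n i \<Longrightarrow> b \<in> homog n j \<Longrightarrow> P (a * b)"
  shows "P h"
proof -
  define s where "s = nat i"
  have i: "i = int s" using assms s_def by simp
  \<comment> \<open>\<open>P\<close> is quantified here because the induction hypothesis is applied
    to the predicate \<open>\<lambda>u. P (mpoly_var t * u)\<close>.\<close>
  have "\<And>P h. h \<in> homog n (int s + j) \<Longrightarrow> P 0 \<Longrightarrow> (\<And>p q. P p \<Longrightarrow> P q \<Longrightarrow> P (p + q)) \<Longrightarrow>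
    (\<And>a b. a \<in> homog n (int s) \<Longrightarrow> b \<in> homog n j \<Longrightarrow> P (a * b)) \<Longrightarrow> P h"
  proof (induction s)
    case 0
    from 0(4)[of 1 h] 0(1) show ?case by simp
  next
    case (Suc s)
    have "h \<in> homog n ((int s + j) + 1)" using Suc.prems by (simp add: algebra_simps)
    then show ?case
    proof (induction rule: homog_step_induct)
      case (var t u)
      from var(2) show ?case
      proof (rule Suc.IH)
        fix a b assume ab: "a \<in> homog n (int s)" "b \<in> homog n j"
        have "mpoly_var t * a \<in> homog n (int (Suc s))"
          using homog_mult[OF mpoly_var_in_homog[OF var(1)] ab(1)] by simp
        from Suc.prems(4)[OF this ab(2)] show "P (mpoly_var t * (a * b))" by (simp add: ac_simps)
      qed (use Suc.prems(2,3) in \<open>simp_all add: distrib_left\<close>)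
    next
      case (add p q)
      then show ?case by (rule Suc.prems(3))
    qed (use Suc.prems(2) assms(3) in simp_all)
  qed
  then show ?thesis using assms unfolding i by blast
qed

lemma homog_finite_dim: "\<exists>X. finite X \<and> homog n k \<subseteq> mpoly.span X"
proof (cases "k < 0")
  case True
  then show ?thesis by (intro exI[of _ "{}"]) (simp add: homog_neg_degree)
next
  case False
  then have "k = int (nat k)" by simp
  moreover have "\<exists>X. finite X \<and> homog n (int t) \<subseteq> mpoly.span X" for t
  proof (induction t)
    case 0
    have "homog n 0 \<subseteq> mpoly.span {1}"
    proof
      fix h assume "h \<in> homog n 0"
      then obtain c where "h = single 0 c" using homog_zero_degree by blast
      then have "h = mpoly_scale c 1" by (simp add: mpoly_scale_def)
      then show "h \<in> mpoly.span {1}" by (simp add: mpoly.span_base mpoly.span_scale)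
    qed
    then show ?case by (intro exI[of _ "{1}"]) auto
  next
    case (Suc t)
    then obtain X where X: "finite X" "homog n (int t) \<subseteq> mpoly.span X" by blast
    let ?Y = "(\<Union>j\<le>n. (*) (mpoly_var j) ` X)"
    have "h \<in> mpoly.span ?Y" if "h \<in> homog n (int t + 1)" for h
      using that
    proof (induction rule: homog_step_induct)
      case (var j u)
      then have "u \<in> mpoly.span X" using X by auto
      then show ?case
      proof (induction rule: mpoly.span_induct_alt)
        case (step c x y)
        have "mpoly_var j * (mpoly_scale c x + y) = mpoly_scale c (mpoly_var j * x) + mpoly_var j * y"
          by (simp add: distrib_left mpoly_scale_mult_right)
        moreover have "mpoly_var j * x \<in> ?Y" using step var by auto
        ultimately show ?case using step by (simp add: mpoly.span_add mpoly.span_base mpoly.span_scale)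
      qed (simp add: mpoly.span_zero)
    qed (auto simp: mpoly.span_zero mpoly.span_add)
    then show ?case using X by (intro exI[of _ ?Y]) (auto simp: add.commute)
  qed
  ultimately show ?thesis by metis
qed

lemma fin_quotient_homog:
  assumes "mpoly.subspace V" "mpoly.subspace W" "W \<subseteq> V" "V \<subseteq> homog n k"
  shows "mpoly.fin_quotient V W"
proof -
  obtain X where "finite X" "homog n k \<subseteq> mpoly.span X" using homog_finite_dim by blast
  then show ?thesis using assms by (intro mpoly.fin_quotient_if_spanned[of X]) auto
qed

subsection \<open>Substitution\<close>

definition monom_val :: "(nat \<Rightarrow> 'a::comm_ring_1) \<Rightarrow> monom \<Rightarrow> 'a" where
  "monom_val x m = (\<Prod>i\<in>keys m. x i ^ lookup m i)"

lemma monom_val_superset: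
  "finite A \<Longrightarrow> keys m \<subseteq> A \<Longrightarrow> monom_val x m = (\<Prod>i\<in>A. x i ^ lookup m i)"
  unfolding monom_val_def by (rule prod.mono_neutral_left) (auto simp: in_keys_iff)

lemma monom_val_add: "monom_val x (a + b) = monom_val x a * monom_val x b"
  by (simp add: monom_val_superset[of "keys a \<union> keys b"] keys_add_monom lookup_add power_add prod.distrib)

lemma monom_val_0 [simp]: "monom_val x 0 = 1"
  by (simp add: monom_val_def)

lemma monom_val_single [simp]: "monom_val x (single i k) = x i ^ k"
  by (simp add: monom_val_superset[of "{i}"])

text \<open>It has two instances: evaluation at a point, and expansion as a power series, with
  coefficients embedded by \<open>mfps_const\<close>.\<close>

locale coeff_hom =
  fixes \<phi> :: "complex \<Rightarrow> 'a::comm_ring_1"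
  assumes hom_add: "\<phi> (a + b) = \<phi> a + \<phi> b" and hom_mult: "\<phi> (a * b) = \<phi> a * \<phi> b"
    and hom_1: "\<phi> 1 = 1"
begin

lemma hom_0: "\<phi> 0 = 0"
  using hom_add[of 0 0] by simp

lemma subst_superset:
  "finite A \<Longrightarrow> keys p \<subseteq> A \<Longrightarrow> mpoly_subst \<phi> x p = (\<Sum>m\<in>A. \<phi> (lookup p m) * monom_val x m)"
  unfolding mpoly_subst_def monom_val_def by (rule sum.mono_neutral_left) (auto simp: in_keys_iff hom_0)

lemma subst_add: "mpoly_subst \<phi> x (p + q) = mpoly_subst \<phi> x p + mpoly_subst \<phi> x q"
proof -
  have "keys (p + q) \<subseteq> keys p \<union> keys q" by (rule Poly_Mapping.keys_add)
  then show ?thesis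
    by (simp add: subst_superset[of "keys p \<union> keys q"] lookup_add hom_add distrib_right sum.distrib)
qed

lemma subst_0 [simp]: "mpoly_subst \<phi> x 0 = 0"
  by (simp add: mpoly_subst_def)

lemma subst_single: "mpoly_subst \<phi> x (single m c) = \<phi> c * monom_val x m"
  by (simp add: subst_superset[of "{m}"])

lemma subst_1 [simp]: "mpoly_subst \<phi> x 1 = 1"
  using subst_single[of x 0 1] by (simp add: hom_1)

lemma subst_var [simp]: "mpoly_subst \<phi> x (mpoly_var i) = x i"
  by (simp add: mpoly_var_def subst_single hom_1)

lemma subst_sum: "mpoly_subst \<phi> x (sum p A) = (\<Sum>a\<in>A. mpoly_subst \<phi> x (p a))"
  by (induction A rule: infinite_finite_induct) (simp_all add: subst_add)

lemma subst_single_mult: "mpoly_subst \<phi> x (single m c * p) = \<phi> c * monom_val x m * mpoly_subst \<phi> x p"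
proof -
  have "single m c * p = (\<Sum>k\<in>keys p. single (m + k) (c * lookup p k))"
    by (subst (1) poly_mapping_eq_sum_single[of p]) (simp add: sum_distrib_left mult_single)
  then have "mpoly_subst \<phi> x (single m c * p) = (\<Sum>k\<in>keys p. \<phi> c * monom_val x m * (\<phi> (lookup p k) * monom_val x k))"
    by (simp add: subst_sum subst_single hom_mult monom_val_add ac_simps)
  also have "\<dots> = \<phi> c * monom_val x m * mpoly_subst \<phi> x p"
    by (simp add: subst_superset[of "keys p" p] sum_distrib_left)
  finally show ?thesis .
qed

lemma subst_mult: "mpoly_subst \<phi> x (p * q) = mpoly_subst \<phi> x p * mpoly_subst \<phi> x q"
proof -
  have "p * q = (\<Sum>k\<in>keys p. single k (lookup p k) * q)"
    by (subst (1) poly_mapping_eq_sum_single[of p]) (simp add: sum_distrib_right)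
  then have "mpoly_subst \<phi> x (p * q) = (\<Sum>k\<in>keys p. \<phi> (lookup p k) * monom_val x k * mpoly_subst \<phi> x q)"
    by (simp add: subst_sum subst_single_mult)
  also have "\<dots> = mpoly_subst \<phi> x p * mpoly_subst \<phi> x q"
    by (simp add: subst_superset[of "keys p" p] sum_distrib_right)
  finally show ?thesis .
qed

lemma subst_scale: "mpoly_subst \<phi> x (mpoly_scale c p) = \<phi> c * mpoly_subst \<phi> x p"
  by (simp add: mpoly_scale_def subst_single_mult)

lemma subst_power: "mpoly_subst \<phi> x (p ^ k) = mpoly_subst \<phi> x p ^ k"
  by (induction k) (simp_all add: subst_mult)

lemma subst_prod: "mpoly_subst \<phi> x (prod p A) = (\<Prod>a\<in>A. mpoly_subst \<phi> x (p a))"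
  by (induction A rule: infinite_finite_induct) (simp_all add: subst_mult)

lemma subst_diff: "mpoly_subst \<phi> x (p - q) = mpoly_subst \<phi> x p - mpoly_subst \<phi> x q"
  using subst_add[of x "p - q" q] by simp

end

interpretation eval: coeff_hom "\<lambda>c. c"
  by unfold_locales auto

lemma eval_homog:
  assumes "h \<in> homog n k" "\<And>i. i \<le> n \<Longrightarrow> y i = c * x i" "k \<ge> 0"
  shows "mpoly_eval h y = c ^ nat k * mpoly_eval h x"
  using assms(1)
proof (induction rule: homog_monom_induct)
  case (monom m a)
  have "monom_val y m = (\<Prod>i\<le>n. c ^ lookup m i * x i ^ lookup m i)"
    using monom by (simp add: monom_val_superset[of "{..n}"] assms(2) power_mult_distrib)
  also have "\<dots> = c ^ mdeg m * monom_val x m"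
    using monom by (simp add: monom_val_superset[of "{..n}"] mdeg_superset[of "{..n}"] prod.distrib power_sum)
  finally show ?case using monom by (simp add: eval.subst_single algebra_simps flip: monom(2))
next
  case (add p q)
  then show ?case unfolding eval.subst_add distrib_left by (rule arg_cong2)
next
  case zero
  show ?case by (simp add: eval.subst_0)
qed

subsection \<open>Graded ideals\<close>

text \<open>A graded ideal is represented by the family of its homogeneous components. The degrees are
  integers, so that \<open>S\<^bsub>k - \<beta>\<^esub>\<close> needs no case distinction. For \<open>b\<close> of degree \<open>\<beta>\<close>, the families
  \<open>adj n I b \<beta>\<close> and \<open>colon n I b \<beta>\<close> are \<open>I + (b)\<close> and \<open>I : b\<close>.\<close>

definition graded :: "nat \<Rightarrow> (int \<Rightarrow> mpoly set) \<Rightarrow> bool" where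
  "graded n I \<longleftrightarrow> (\<forall>k. mpoly.subspace (I k) \<and> I k \<subseteq> homog n k) \<and>
     (\<forall>i k a u. a \<in> homog n i \<longrightarrow> u \<in> I k \<longrightarrow> a * u \<in> I (i + k))"

definition adj :: "nat \<Rightarrow> (int \<Rightarrow> mpoly set) \<Rightarrow> mpoly \<Rightarrow> int \<Rightarrow> int \<Rightarrow> mpoly set" where
  "adj n I b \<beta> k = {u + v * b | u v. u \<in> I k \<and> v \<in> homog n (k - \<beta>)}"

definition colon :: "nat \<Rightarrow> (int \<Rightarrow> mpoly set) \<Rightarrow> mpoly \<Rightarrow> int \<Rightarrow> int \<Rightarrow> mpoly set" where
  "colon n I b \<beta> k = {u \<in> homog n k. u * b \<in> I (k + \<beta>)}"

text \<open>The Hilbert function of the quotient \<open>S/I\<close>, not of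
  \<open>I\<close>.\<close>

definition HF :: "nat \<Rightarrow> (int \<Rightarrow> mpoly set) \<Rightarrow> int \<Rightarrow> nat" where
  "HF n I k = mpoly.qdim (homog n k) (I k)"

lemma gradedD:
  assumes "graded n I"
  shows "mpoly.subspace (I k)" "u \<in> I k \<Longrightarrow> u \<in> homog n k"
    "a \<in> homog n i \<Longrightarrow> u \<in> I k \<Longrightarrow> a * u \<in> I (i + k)"
  using assms unfolding graded_def by blast+

lemma graded_mult: "graded n I \<Longrightarrow> a \<in> homog n i \<Longrightarrow> u \<in> I k \<Longrightarrow> m = i + k \<Longrightarrow> a * u \<in> I m"
  using gradedD(3) by blast

lemma graded_0: "graded n I \<Longrightarrow> 0 \<in> I k"
  using gradedD(1) mpoly.subspace_0 by blast

lemma graded_add: "graded n I \<Longrightarrow> u \<in> I k \<Longrightarrow> v \<in> I k \<Longrightarrow> u + v \<in> I k"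
  using gradedD(1) mpoly.subspace_add by blast

lemma graded_diff: "graded n I \<Longrightarrow> u \<in> I k \<Longrightarrow> v \<in> I k \<Longrightarrow> u - v \<in> I k"
  using gradedD(1) mpoly.subspace_diff by blast

lemma graded_scale: "graded n I \<Longrightarrow> u \<in> I k \<Longrightarrow> mpoly_scale c u \<in> I k"
  using gradedD(1) mpoly.subspace_scale by blast

lemma graded_scale_iff: "graded n I \<Longrightarrow> c \<noteq> 0 \<Longrightarrow> mpoly_scale c u \<in> I k \<longleftrightarrow> u \<in> I k"
  using graded_scale[of n I "mpoly_scale c u" k "inverse c"] graded_scale[of n I u k c] by auto

lemma graded_sum: "graded n I \<Longrightarrow> (\<And>a. a \<in> A \<Longrightarrow> u a \<in> I k) \<Longrightarrow> sum u A \<in> I k"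
  using gradedD(1) mpoly.subspace_sum by blast

lemma fin_graded: "graded n I \<Longrightarrow> mpoly.fin_quotient (homog n k) (I k)"
  using gradedD by (intro fin_quotient_homog) auto

lemma graded_adj:
  assumes I: "graded n I" and b: "b \<in> homog n \<beta>"
  shows "graded n (adj n I b \<beta>)"
  unfolding graded_def
proof (intro conjI allI impI)
  fix k
  have m: "mpoly.subspace {v * b | v. v \<in> homog n (k - \<beta>)}"
  proof (rule mpoly.subspaceI)
    show "0 \<in> {v * b |v. v \<in> homog n (k - \<beta>)}" by (auto intro!: exI[of _ 0])
  next
    fix x y assume "x \<in> {v * b |v. v \<in> homog n (k - \<beta>)}" "y \<in> {v * b |v. v \<in> homog n (k - \<beta>)}"
    then show "x + y \<in> {v * b |v. v \<in> homog n (k - \<beta>)}"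
      using homog_add by (auto simp: distrib_right[symmetric])
  next
    fix c x assume "x \<in> {v * b |v. v \<in> homog n (k - \<beta>)}"
    then show "mpoly_scale c x \<in> {v * b |v. v \<in> homog n (k - \<beta>)}"
      using homog_scale by (auto simp: mpoly_scale_mult_left)
  qed
  have "adj n I b \<beta> k = {x + y | x y. x \<in> I k \<and> y \<in> {v * b | v. v \<in> homog n (k - \<beta>)}}"
    by (auto simp: adj_def)
  then show "mpoly.subspace (adj n I b \<beta> k)"
    using mpoly.subspace_sums[OF gradedD(1)[OF I] m] by simp
  show "adj n I b \<beta> k \<subseteq> homog n k"
    using gradedD(2)[OF I] b by (auto simp: adj_def intro!: homog_add homog_mult')
next
  fix i k a u assume a: "a \<in> homog n i" and "u \<in> adj n I b \<beta> k"
  then obtain v w where u: "u = v + w * b" "v \<in> I k" "w \<in> homog n (k - \<beta>)" by (auto simp: adj_def)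
  then have "a * u = a * v + (a * w) * b" "a * v \<in> I (i + k)" "a * w \<in> homog n (i + k - \<beta>)"
    using a I by (auto simp: algebra_simps gradedD(3) intro!: homog_mult')
  then show "a * u \<in> adj n I b \<beta> (i + k)" unfolding adj_def by blast
qed

lemma adj_superset: "u \<in> I k \<Longrightarrow> u \<in> adj n I b \<beta> k"
  unfolding adj_def by (force intro: exI[of _ 0])

lemma adj_gen: "graded n I \<Longrightarrow> v \<in> homog n (k - \<beta>) \<Longrightarrow> v * b \<in> adj n I b \<beta> k"
  unfolding adj_def using graded_0[of n I k] by force

lemma adj_least:
  assumes "graded n K" "\<And>u. u \<in> I k \<Longrightarrow> u \<in> K k" "b \<in> K \<beta>" "u \<in> adj n I b \<beta> k"
  shows "u \<in> K k"
  using assms by (auto simp: adj_def intro!: graded_add graded_mult)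

lemma graded_colon:
  assumes I: "graded n I" and b: "b \<in> homog n \<beta>"
  shows "graded n (colon n I b \<beta>)"
  unfolding graded_def
proof (intro conjI allI impI)
  fix k
  show "mpoly.subspace (colon n I b \<beta> k)"
    by (rule mpoly.subspaceI)
      (auto simp: colon_def graded_0[OF I] homog_add homog_scale distrib_right graded_add[OF I]
        graded_scale[OF I] mpoly_scale_mult_left[symmetric])
  show "colon n I b \<beta> k \<subseteq> homog n k" by (auto simp: colon_def)
next
  fix i k a u assume "a \<in> homog n i" "u \<in> colon n I b \<beta> k"
  then show "a * u \<in> colon n I b \<beta> (i + k)"
    using graded_mult[OF I, of a i "u * b" "k + \<beta>" "i + k + \<beta>"]
    by (auto simp: colon_def homog_mult mult.assoc)
qed

lemma colon_superset:
  "graded n I \<Longrightarrow> b \<in> homog n \<beta> \<Longrightarrow> u \<in> I k \<Longrightarrow> u \<in> colon n I b \<beta> k"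
  using graded_mult[of n I b \<beta> u k "k + \<beta>"] by (auto simp: colon_def gradedD(2) mult.commute)

text \<open>Counts along \<open>I \<subseteq> I : b \<subseteq> S\<close>. The second summand
  measures the failure of \<open>b\<close> to be a nonzerodivisor in degree
  \<open>k\<close>.\<close>

lemma HF_colon:
  assumes "graded n I" "b \<in> homog n \<beta>"
  shows "HF n I k = mpoly.qdim (homog n k) (colon n I b \<beta> k) + mpoly.qdim (colon n I b \<beta> k) (I k)"
  unfolding HF_def
  using assms colon_superset[OF assms] gradedD(1,2)[OF graded_colon[OF assms]] gradedD(1)[OF assms(1)]
  by (intro mpoly.qdim_add) (auto intro!: fin_quotient_homog[of _ _ n k])

lemma colon_subset_if_qdim_0:
  assumes "graded n I" "b \<in> homog n \<beta>" "mpoly.qdim (colon n I b \<beta> k) (I k) = 0"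
  shows "colon n I b \<beta> k \<subseteq> I k"
proof -
  have "mpoly.fin_quotient (colon n I b \<beta> k) (I k)"
    using assms(1,2) gradedD(1,2)[OF graded_colon[OF assms(1,2)]] colon_superset[OF assms(1,2)] gradedD(1)[OF assms(1)]
    by (intro fin_quotient_homog[of _ _ n k]) auto
  then show ?thesis using mpoly.qdim_eq_0_iff[OF gradedD(1)[OF assms(1)]] assms(3) by blast
qed

lemma quotient_space_mpoly: "quotient_space mpoly_scale" ..

text \<open>Multiplication by \<open>b\<close> identifies \<open>S/(I : b)\<close>, shifted by
  \<beta>, with the kernel of \<open>S/I \<rightarrow> S/(I + (b))\<close>.\<close>

lemma HF_adj:
  assumes I: "graded n I" and b: "b \<in> homog n \<beta>"
  shows "HF n I k = HF n (adj n I b \<beta>) k + mpoly.qdim (homog n (k - \<beta>)) (colon n I b \<beta> (k - \<beta>))"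
proof -
  note A = graded_adj[OF I b] and C = graded_colon[OF I b]
  have "mpoly.qdim (homog n k) (I k) =
      mpoly.qdim (homog n k) (adj n I b \<beta> k) + mpoly.qdim (adj n I b \<beta> k) (I k)"
    using I A adj_superset[of _ I k n b \<beta>]
    by (intro mpoly.qdim_add)
      (auto simp: gradedD(1) gradedD(2)[OF A] intro!: fin_graded fin_quotient_homog[of _ _ n k])
  moreover have "mpoly.qdim (adj n I b \<beta> k) (I k) = mpoly.qdim (homog n (k - \<beta>)) (colon n I b \<beta> (k - \<beta>))"
  proof (rule qdim_transport(2)[OF quotient_space_mpoly quotient_space_mpoly, where \<phi> = "\<lambda>v. v * b"])
    fix y assume "y \<in> adj n I b \<beta> k"
    then obtain u v where "y = u + v * b" "u \<in> I k" "v \<in> homog n (k - \<beta>)" by (auto simp: adj_def)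
    then show "\<exists>x\<in>homog n (k - \<beta>). y - x * b \<in> I k" by (intro bexI[of _ v]) auto
  next
    show "mpoly.subspace (colon n I b \<beta> (k - \<beta>))" by (rule gradedD(1)[OF C])
    show "mpoly.fin_quotient (homog n (k - \<beta>)) (colon n I b \<beta> (k - \<beta>))" by (rule fin_graded[OF C])
    show "mpoly.subspace (I k)" by (rule gradedD(1)[OF I])
  qed (use I in \<open>auto simp: distrib_right mpoly_scale_mult_left adj_gen colon_def\<close>)
  ultimately show ?thesis by (simp add: HF_def)
qed

lemma qdim_colon_le: "graded n I \<Longrightarrow> b \<in> homog n \<beta> \<Longrightarrow> mpoly.qdim (homog n k) (colon n I b \<beta> k) \<le> HF n I k"
  using HF_colon[of n I b \<beta> k] by simp

lemma HF_0_iff: "graded n I \<Longrightarrow> HF n I k = 0 \<longleftrightarrow> homog n k \<subseteq> I k"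
  unfolding HF_def by (intro mpoly.qdim_eq_0_iff gradedD fin_graded)

lemma graded_full_above:
  assumes "graded n I" "homog n t \<subseteq> I t" "0 \<le> t" "t \<le> k"
  shows "homog n k \<subseteq> I k"
proof
  fix h assume "h \<in> homog n k"
  then have "h \<in> homog n ((k - t) + t)" by simp
  then show "h \<in> I k"
    by (induction rule: homog_mult_induct)
      (use assms in \<open>auto simp: graded_0 graded_add intro!: graded_mult\<close>)
qed

definition zero_of :: "nat \<Rightarrow> (int \<Rightarrow> mpoly set) \<Rightarrow> (nat \<Rightarrow> complex) \<Rightarrow> bool" where
  "zero_of n I c \<longleftrightarrow> c \<in> homog_coords n \<and> (\<forall>k. \<forall>u\<in>I k. mpoly_eval u c = 0)"

subsection \<open>The Nullstellensatz\<close>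

text \<open>No power of \<open>h\<close> lies in the saturation of \<open>I\<close>; for \<open>h = 1\<close>, the ideal \<open>I\<close> contains no power
  of the irrelevant ideal.\<close>

definition avoids :: "nat \<Rightarrow> mpoly \<Rightarrow> int \<Rightarrow> (int \<Rightarrow> mpoly set) \<Rightarrow> bool" where
  "avoids n h \<rho> I \<longleftrightarrow> (\<forall>i t. \<exists>v\<in>homog n (int t). h ^ i * v \<notin> I (int i * \<rho> + int t))"

lemma homog_basis: "\<exists>B. finite B \<and> B \<subseteq> homog n k \<and> homog n k \<subseteq> mpoly.span B"
proof -
  obtain X where X: "finite X" "homog n k \<subseteq> mpoly.span X" using homog_finite_dim by blast
  obtain B where B: "B \<subseteq> homog n k" "mpoly.independent B" "homog n k \<subseteq> mpoly.span B"
    using mpoly.maximal_independent_subset by blast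
  then have "finite B" using mpoly.independent_span_bound[OF X(1) B(2)] X by auto
  with B show ?thesis by blast
qed

text \<open>Zorn's lemma. The union of a chain still avoids \<open>h\<close>: as
  \<open>homog n (int t)\<close> is spanned by finitely many forms, a violation would already occur
  in one member of the chain.\<close>

lemma maximal_avoiding:
  assumes J: "graded n J" and av: "avoids n h \<rho> J"
  obtains P where "graded n P" "\<And>k. J k \<subseteq> P k" "avoids n h \<rho> P"
    "\<And>u a. u \<in> homog n a \<Longrightarrow> u \<notin> P a \<Longrightarrow> \<not> avoids n h \<rho> (adj n P u a)"
proof -
  \<comment> \<open>A family of components is encoded as a set of pairs, so that set inclusion
    orders the families componentwise.\<close>
  define A where "A = {X :: (int \<times> mpoly) set. graded n (\<lambda>k. X `` {k}) \<and> (\<forall>k. J k \<subseteq> X `` {k}) \<and>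
    avoids n h \<rho> (\<lambda>k. X `` {k})}"
  have "{(k, u). u \<in> J k} \<in> A" using J av by (simp add: A_def Image_def)
  then have "A \<noteq> {}" by blast
  moreover have "\<Union>C \<in> A" if ne: "C \<noteq> {}" and ch: "subset.chain A C" for C
  proof -
    have CA: "X \<in> A" if "X \<in> C" for X using ch that by (auto simp: subset_chain_def)
    have gr: "graded n (\<lambda>k. X `` {k})" if "X \<in> C" for X using CA[OF that] by (simp add: A_def)
    have "graded n (\<lambda>k. \<Union>C `` {k})"
      unfolding graded_def
    proof (intro conjI allI impI)
      fix k
      show "mpoly.subspace (\<Union>C `` {k})"
      proof (rule mpoly.subspaceI)
        show "0 \<in> \<Union>C `` {k}" using ne graded_0[OF gr] by fastforce
      next
        fix x y assume "x \<in> \<Union>C `` {k}" "y \<in> \<Union>C `` {k}"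
        then obtain X Y where XY: "X \<in> C" "Y \<in> C" "x \<in> X `` {k}" "y \<in> Y `` {k}" by auto
        have "X \<subseteq> Y \<or> Y \<subseteq> X" using ch XY unfolding subset_chain_def by blast
        then obtain Z where "Z \<in> C" "x \<in> Z `` {k}" "y \<in> Z `` {k}" using XY by blast
        then show "x + y \<in> \<Union>C `` {k}" using graded_add[OF gr, of Z x k y] by auto
      next
        fix c x assume "x \<in> \<Union>C `` {k}"
        then obtain X where "X \<in> C" "x \<in> X `` {k}" by auto
        then show "mpoly_scale c x \<in> \<Union>C `` {k}" using graded_scale[OF gr, of X x k c] by auto
      qed
      show "\<Union>C `` {k} \<subseteq> homog n k" using gradedD(2)[OF gr] by auto
    next
      fix i k a u assume "a \<in> homog n i" "u \<in> \<Union>C `` {k}"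
      then obtain X where "X \<in> C" "u \<in> X `` {k}" by auto
      then show "a * u \<in> \<Union>C `` {i + k}" using gradedD(3)[OF gr, of X a i u k] \<open>a \<in> _\<close> by auto
    qed
    moreover have "J k \<subseteq> \<Union>C `` {k}" for k using ne CA by (fastforce simp: A_def)
    moreover have "avoids n h \<rho> (\<lambda>k. \<Union>C `` {k})"
      unfolding avoids_def
    proof (intro allI, rule ccontr)
      fix i t assume "\<not> (\<exists>v\<in>homog n (int t). h ^ i * v \<notin> \<Union>C `` {int i * \<rho> + int t})"
      then have all: "(int i * \<rho> + int t, h ^ i * v) \<in> \<Union>C" if "v \<in> homog n (int t)" for v using that by blast
      obtain B where B: "finite B" "B \<subseteq> homog n (int t)" "homog n (int t) \<subseteq> mpoly.span B"
        using homog_basis[of n "int t"] by auto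
      obtain X where X: "X \<in> C" "(\<lambda>v. (int i * \<rho> + int t, h ^ i * v)) ` B \<subseteq> X"
        by (rule finite_subset_Union_chain[of "(\<lambda>v. (int i * \<rho> + int t, h ^ i * v)) ` B" C A])
          (use all B ne ch in auto)
      let ?I = "\<lambda>k. X `` {k}"
      have "mpoly.subspace {v. h ^ i * v \<in> ?I (int i * \<rho> + int t)}"
        by (rule mpoly.subspaceI)
          (use graded_0[OF gr[OF X(1)]] graded_add[OF gr[OF X(1)]] graded_scale[OF gr[OF X(1)]]
            in \<open>auto simp: distrib_left mpoly_scale_mult_right[symmetric]\<close>)
      then have "mpoly.span B \<subseteq> {v. h ^ i * v \<in> ?I (int i * \<rho> + int t)}"
        using X(2) by (intro mpoly.span_minimal) auto
      then have "\<not> avoids n h \<rho> ?I" using B unfolding avoids_def by blast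
      then show False using CA[OF X(1)] by (simp add: A_def)
    qed
    ultimately show ?thesis by (simp add: A_def)
  qed
  ultimately obtain M where M: "M \<in> A" "\<And>X. X \<in> A \<Longrightarrow> M \<subseteq> X \<Longrightarrow> X = M"
    using subset_Zorn_nonempty[of A] by blast
  define P where "P k = M `` {k}" for k
  have P: "graded n P" "\<And>k. J k \<subseteq> P k" "avoids n h \<rho> P"
    using M(1) by (auto simp: A_def P_def[abs_def])
  show ?thesis
  proof (rule that[OF P])
    fix u a assume u: "u \<in> homog n a" "u \<notin> P a"
    show "\<not> avoids n h \<rho> (adj n P u a)"
    proof
      assume av: "avoids n h \<rho> (adj n P u a)"
      have sup: "P k \<subseteq> adj n P u a k" for k using adj_superset by blast
      let ?X = "{(k, w). w \<in> adj n P u a k}"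
      have "(\<lambda>k. ?X `` {k}) = adj n P u a" by (auto simp: Image_def)
      then have "?X \<in> A" using graded_adj[OF P(1) u(1)] av P(2) sup unfolding A_def by fastforce
      moreover have "M \<subseteq> ?X" using sup by (auto simp: P_def)
      ultimately have "?X = M" by (rule M(2))
      moreover have "1 * u \<in> adj n P u a a" by (rule adj_gen[OF P(1)]) simp
      ultimately show False using u(2) by (auto simp: P_def)
    qed
  qed
qed

text \<open>If neither \<open>u\<close> nor \<open>v\<close> is in \<open>P\<close>, maximality puts
  some \<open>h ^ i\<close> times all forms of degree \<open>t\<close> into \<open>P + (u)\<close>,
  and likewise with \<open>i'\<close>, \<open>t'\<close> for \<open>v\<close>. Multiplying puts
  \<open>h ^ (i + i')\<close> times all forms of degree \<open>t + t'\<close> into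
  \<open>P + (u v)\<close>, which is \<open>P\<close>.\<close>

lemma maximal_avoiding_prime:
  assumes P: "graded n P" and av: "avoids n h \<rho> P"
    and maxi: "\<And>u a. u \<in> homog n a \<Longrightarrow> u \<notin> P a \<Longrightarrow> \<not> avoids n h \<rho> (adj n P u a)"
    and u: "u \<in> homog n a" and v: "v \<in> homog n b" and uv: "u * v \<in> P (a + b)"
  shows "u \<in> P a \<or> v \<in> P b"
proof (rule ccontr)
  assume "\<not> ?thesis"
  then obtain i t i' t' where
    1: "\<And>w. w \<in> homog n (int t) \<Longrightarrow> h ^ i * w \<in> adj n P u a (int i * \<rho> + int t)" and
    2: "\<And>w. w \<in> homog n (int t') \<Longrightarrow> h ^ i' * w \<in> adj n P v b (int i' * \<rho> + int t')"
    using maxi[OF u] maxi[OF v] unfolding avoids_def by blast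
  have "h ^ (i + i') * w \<in> P (int (i + i') * \<rho> + int (t + t'))" if "w \<in> homog n (int (t + t'))" for w
  proof -
    have "w \<in> homog n (int t + int t')" using that by simp
    then show ?thesis
    proof (induction rule: homog_mult_induct)
      case (mult x y)
      obtain p c where pc: "h ^ i * x = p + c * u" "p \<in> P (int i * \<rho> + int t)" "c \<in> homog n (int i * \<rho> + int t - a)"
        using 1[OF mult(1)] by (auto simp: adj_def)
      obtain q d where qd: "h ^ i' * y = q + d * v" "q \<in> P (int i' * \<rho> + int t')" "d \<in> homog n (int i' * \<rho> + int t' - b)"
        using 2[OF mult(2)] by (auto simp: adj_def)
      have "h ^ (i + i') * (x * y) = (h ^ i * x) * (h ^ i' * y)" by (simp add: power_add ac_simps)
      also have "\<dots> = (q + d * v) * p + (c * u) * q + (c * d) * (u * v)"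
        unfolding pc qd by (simp add: algebra_simps)
      also have "\<dots> \<in> P (int (i + i') * \<rho> + int (t + t'))"
      proof (intro graded_add[OF P])
        have "d * v \<in> homog n (int i' * \<rho> + int t')" using qd(3) v by (rule homog_mult') simp
        then have "q + d * v \<in> homog n (int i' * \<rho> + int t')" using gradedD(2)[OF P qd(2)] by (intro homog_add)
        then show "(q + d * v) * p \<in> P (int (i + i') * \<rho> + int (t + t'))"
          using pc(2) by (rule graded_mult[OF P]) (simp add: algebra_simps)
        have "c * u \<in> homog n (int i * \<rho> + int t)" using pc(3) u by (rule homog_mult') simp
        then show "(c * u) * q \<in> P (int (i + i') * \<rho> + int (t + t'))"
          using qd(2) by (rule graded_mult[OF P]) (simp add: algebra_simps)
        show "(c * d) * (u * v) \<in> P (int (i + i') * \<rho> + int (t + t'))"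
          by (rule graded_mult[OF P homog_mult[OF pc(3) qd(3)] uv]) (simp add: algebra_simps)
      qed
      finally show ?case .
    qed (auto simp: graded_0[OF P] distrib_left graded_add[OF P])
  qed
  then show False using av unfolding avoids_def by blast
qed

text \<open>The homogenization of \<open>p\<close> to degree \<open>N\<close>, with \<open>x\<close>
  and \<open>y\<close> substituted for the variables; \<open>N\<close> may exceed
  \<open>degree p\<close>.\<close>

definition binary_form :: "mpoly \<Rightarrow> mpoly \<Rightarrow> nat \<Rightarrow> complex poly \<Rightarrow> mpoly" where
  "binary_form x y N p = (\<Sum>i\<le>N. mpoly_scale (poly.coeff p i) (x ^ i * y ^ (N - i)))"

lemma binary_form_factor:
  assumes "degree q \<le> N"
  shows "binary_form x y (Suc N) ([:- r, 1:] * q) = (x - mpoly_scale r y) * binary_form x y N q"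
proof -
  have *: "poly.coeff ([:- r, 1:] * q) i = (if i = 0 then 0 else poly.coeff q (i - 1)) - r * poly.coeff q i" for i
    by (cases i) (auto simp: coeff_pCons)
  have "binary_form x y (Suc N) ([:- r, 1:] * q) =
     (\<Sum>i\<le>Suc N. mpoly_scale (if i = 0 then 0 else poly.coeff q (i - 1)) (x ^ i * y ^ (Suc N - i)))
   - (\<Sum>i\<le>Suc N. mpoly_scale (r * poly.coeff q i) (x ^ i * y ^ (Suc N - i)))"
    unfolding binary_form_def * by (simp only: mpoly.scale_left_diff_distrib sum_subtractf)
  also have "(\<Sum>i\<le>Suc N. mpoly_scale (if i = 0 then 0 else poly.coeff q (i - 1)) (x ^ i * y ^ (Suc N - i)))
     = (\<Sum>i\<le>N. mpoly_scale (poly.coeff q i) (x ^ Suc i * y ^ (N - i)))"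
    by (subst sum.atMost_Suc_shift) simp
  also have "\<dots> = x * binary_form x y N q"
    by (simp add: binary_form_def sum_distrib_left mpoly_scale_mult_right mult.assoc)
  also have "(\<Sum>i\<le>Suc N. mpoly_scale (r * poly.coeff q i) (x ^ i * y ^ (Suc N - i)))
     = (\<Sum>i\<le>N. mpoly_scale (r * poly.coeff q i) (x ^ i * y ^ (Suc N - i)))"
    using assms by (simp add: coeff_eq_0)
  also have "\<dots> = (\<Sum>i\<le>N. mpoly_scale r y * mpoly_scale (poly.coeff q i) (x ^ i * y ^ (N - i)))"
  proof (intro sum.cong refl)
    fix i assume "i \<in> {..N}"
    then have "Suc N - i = Suc (N - i)" by simp
    then show "mpoly_scale (r * poly.coeff q i) (x ^ i * y ^ (Suc N - i)) =
        mpoly_scale r y * mpoly_scale (poly.coeff q i) (x ^ i * y ^ (N - i))"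
      by (simp add: mpoly_scale_mult_left[symmetric] mpoly_scale_mult_right[symmetric] ac_simps)
  qed
  also have "\<dots> = mpoly_scale r y * binary_form x y N q"
    by (simp add: binary_form_def sum_distrib_left)
  finally show ?thesis by (simp add: left_diff_distrib)
qed

lemma homog_binary_form:
  "x \<in> homog n 1 \<Longrightarrow> y \<in> homog n 1 \<Longrightarrow> binary_form x y N p \<in> homog n (int N)"
  unfolding binary_form_def
  by (intro homog_sum homog_scale homog_mult'[OF homog_power[of x n 1] homog_power[of y n 1]]) auto

text \<open>The form splits into linear factors over the complex numbers and \<open>P\<close> is
  prime, so some factor lies in \<open>P\<close>. Factors \<open>y\<close>, which occur when
  \<open>degree p < N\<close>, are excluded since \<open>y\<close> is not in
  \<open>P\<close>.\<close>

lemma binary_form_linear_factor: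
  assumes P: "graded n P" and one: "1 \<notin> P 0"
    and prime: "\<And>u v a b. u \<in> homog n a \<Longrightarrow> v \<in> homog n b \<Longrightarrow> u * v \<in> P (a + b) \<Longrightarrow> u \<in> P a \<or> v \<in> P b"
    and xy: "x \<in> homog n 1" "y \<in> homog n 1" "y \<notin> P 1"
    and p: "degree p \<le> N" "p \<noteq> 0" "binary_form x y N p \<in> P (int N)"
  shows "\<exists>r. x - mpoly_scale r y \<in> P 1"
  using p
proof (induction N arbitrary: p)
  case 0
  then have "mpoly_scale (poly.coeff p 0) 1 \<in> P 0" "poly.coeff p 0 \<noteq> 0"
    using leading_coeff_0_iff[of p] by (auto simp: binary_form_def)
  then show ?case using one graded_scale_iff[OF P] by blast
next
  case (Suc N)
  show ?case
  proof (cases "degree p = 0")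
    case True
    then obtain c where c: "p = [:c:]" using degree_eq_zeroE by blast
    have pow: "y ^ k \<notin> P (int k)" for k
    proof (induction k)
      case (Suc k)
      then show ?case using prime[OF xy(2) homog_power[OF xy(2)], of k] xy(3) by auto
    qed (use one in simp)
    have "binary_form x y (Suc N) p = (\<Sum>i\<le>Suc N. if i = 0 then mpoly_scale c (y ^ Suc N) else 0)"
      unfolding binary_form_def c by (intro sum.cong refl) (auto simp: coeff_pCons split: nat.splits)
    then have "mpoly_scale c (y ^ Suc N) \<in> P (int (Suc N))" using Suc.prems by simp
    moreover have "c \<noteq> 0" using c Suc.prems by simp
    ultimately show ?thesis using graded_scale_iff[OF P] pow by blast
  next
    case False
    then obtain r where "poly p r = 0"
      using fundamental_theorem_of_algebra[of p] by (auto simp: constant_degree)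
    then obtain q where q: "p = [:- r, 1:] * q" by (metis poly_eq_0_iff_dvd dvdE)
    then have "q \<noteq> 0" using Suc.prems by auto
    then have dq: "degree q \<le> N" using Suc.prems unfolding q by (subst (asm) degree_mult_eq) auto
    have "(x - mpoly_scale r y) * binary_form x y N q \<in> P (1 + int N)"
      using Suc.prems(3) unfolding q binary_form_factor[OF dq] by simp
    then have "x - mpoly_scale r y \<in> P 1 \<or> binary_form x y N q \<in> P (int N)"
      using xy by (intro prime homog_diff homog_scale homog_binary_form)
    then show ?thesis using Suc.IH[OF dq \<open>q \<noteq> 0\<close>] by blast
  qed
qed

text \<open>In degree \<open>k\<close> every form is a multiple of \<open>l\<close> modulo
  \<open>I\<close>, so multiplication by \<open>l\<close> is onto there.\<close>

lemma HF_decreasing: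
  assumes I: "graded n I" and l: "l \<in> homog n 1" and full: "homog n k \<subseteq> adj n I l 1 k"
  shows "HF n I k \<le> HF n I (k - 1)"
  using HF_adj[OF I l, of k] HF_0_iff[OF graded_adj[OF I l], of k] full qdim_colon_le[OF I l, of "k - 1"]
  by simp

text \<open>An ideal \<open>P\<close> maximal among those avoiding \<open>h\<close> is prime. As \<open>P + (l)\<close> contains a power of the
  irrelevant ideal, the Hilbert function of \<open>P\<close> is bounded; so for every variable \<open>x\<^sub>j\<close> some binary
  form in \<open>x\<^sub>j\<close> and \<open>l\<close> lies in \<open>P\<close>, and one of its linear factors \<open>x\<^sub>j - c\<^sub>j l\<close> does.\<close>

theorem nullstellensatz:
  assumes J: "graded n J" and h: "h \<in> homog n \<rho>" and \<rho>: "\<rho> \<ge> 0" and av: "avoids n h \<rho> J"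
    and alt: "h = 1 \<and> \<rho> = 0 \<or> (\<exists>l t. l \<in> homog n 1 \<and> homog n (int t) \<subseteq> adj n J l 1 (int t))"
  shows "\<exists>c. zero_of n J c \<and> mpoly_eval h c \<noteq> 0"
proof -
  obtain P where P: "graded n P" and JP: "\<And>k. J k \<subseteq> P k" and avP: "avoids n h \<rho> P"
    and maxi: "\<And>u a. u \<in> homog n a \<Longrightarrow> u \<notin> P a \<Longrightarrow> \<not> avoids n h \<rho> (adj n P u a)"
    using maximal_avoiding[OF J av] by blast
  have prime: "u \<in> P a \<or> v \<in> P b"
    if "u \<in> homog n a" "v \<in> homog n b" "u * v \<in> P (a + b)" for u v a b
    using maximal_avoiding_prime[OF P avP _ that] maxi by blast
  have notfull: "\<not> homog n (int t) \<subseteq> P (int t)" for t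
  proof -
    obtain v where "v \<in> homog n (int t)" "h ^ 0 * v \<notin> P (int 0 * \<rho> + int t)"
      using avP unfolding avoids_def by blast
    then show ?thesis by auto
  qed
  have one: "1 \<notin> P 0"
  proof
    assume "1 \<in> P 0"
    then have "homog n (int 0) \<subseteq> P (int 0)" using graded_mult[OF P _ \<open>1 \<in> P 0\<close>, of _ 0 0] by auto
    then show False using notfull by blast
  qed
  \<comment> \<open>For \<open>h = 1\<close>, \<open>l\<close> is a variable outside
    \<open>P\<close>, and maximality makes \<open>P + (l)\<close> full in some degree. Otherwise it
    is the given form, which cannot lie in \<open>P\<close> because \<open>P\<close> itself is never
    full.\<close>
  have "\<exists>l t. l \<in> homog n 1 \<and> l \<notin> P 1 \<and> homog n (int t) \<subseteq> adj n P l 1 (int t)"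
    using alt
  proof
    assume h1: "h = 1 \<and> \<rho> = 0"
    have "\<exists>j\<le>n. mpoly_var j \<notin> P 1"
    proof (rule ccontr)
      assume "\<not> ?thesis"
      then have var: "mpoly_var j \<in> P 1" if "j \<le> n" for j using that by blast
      have "h \<in> P 1" if "h \<in> homog n (0 + 1)" for h
        using that by (induction rule: homog_step_induct)
          (use var graded_mult[OF P, of _ 0 _ 1 1] in \<open>auto simp: graded_0[OF P] graded_add[OF P] mult.commute\<close>)
      then show False using notfull[of 1] by auto
    qed
    then obtain j where j: "j \<le> n" "mpoly_var j \<notin> P 1" by blast
    then have "\<not> avoids n h \<rho> (adj n P (mpoly_var j) 1)" by (intro maxi) auto
    then obtain t where "homog n (int t) \<subseteq> adj n P (mpoly_var j) 1 (int t)"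
      using h1 unfolding avoids_def by auto
    then show ?thesis using j mpoly_var_in_homog by blast
  next
    assume "\<exists>l t. l \<in> homog n 1 \<and> homog n (int t) \<subseteq> adj n J l 1 (int t)"
    then obtain l t where lt: "l \<in> homog n 1" "homog n (int t) \<subseteq> adj n J l 1 (int t)" by blast
    have full: "homog n (int t) \<subseteq> adj n P l 1 (int t)" using lt(2) JP unfolding adj_def by blast
    moreover have "l \<notin> P 1"
    proof
      assume "l \<in> P 1"
      then have "adj n P l 1 (int t) \<subseteq> P (int t)" using adj_least[OF P, of P] by blast
      then show False using full notfull by blast
    qed
    ultimately show ?thesis using lt by blast
  qed
  then obtain l t where l: "l \<in> homog n 1" "l \<notin> P 1" and full: "homog n (int t) \<subseteq> adj n P l 1 (int t)" by blast
  have lpow: "l ^ k \<notin> P (int k)" for k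
  proof (induction k)
    case (Suc k)
    then show ?case using prime[OF l(1) homog_power[OF l(1)], of k] l(2) by auto
  qed (use one in simp)
  have bd: "HF n P (int (t + k)) \<le> HF n P (int t)" for k
  proof (induction k)
    case (Suc k)
    have "homog n (int (t + Suc k)) \<subseteq> adj n P l 1 (int (t + Suc k))"
      by (rule graded_full_above[OF graded_adj[OF P l(1)] full]) auto
    from HF_decreasing[OF P l(1) this] Suc show ?case by (simp add: algebra_simps)
  qed simp
  \<comment> \<open>From degree \<open>t\<close> on the Hilbert function of \<open>P\<close> is at
    most \<open>HF n P (int t)\<close>, so in this degree the \<open>N + 1\<close> products
    \<open>x_j ^ i * l ^ (N - i)\<close> are dependent modulo \<open>P\<close>.\<close>
  define N where "N = t + HF n P (int t)"
  have HN: "HF n P (int N) < card {..N}" using bd[of "HF n P (int t)"] by (simp add: N_def)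
  have "\<exists>r. mpoly_var j - mpoly_scale r l \<in> P 1" if j: "j \<le> n" for j
  proof -
    let ?x = "mpoly_var j"
    have "\<exists>c. (\<exists>i\<in>{..N}. c i \<noteq> 0) \<and> (\<Sum>i\<in>{..N}. mpoly_scale (c i) (?x ^ i * l ^ (N - i))) \<in> P (int N)"
    proof (rule mpoly.dependent_mod[OF gradedD(1)[OF P] fin_graded[OF P]])
      fix i assume "i \<in> {..N}"
      then show "?x ^ i * l ^ (N - i) \<in> homog n (int N)"
        using j by (intro homog_mult'[OF homog_power[of ?x n 1] homog_power[OF l(1)]]) auto
    qed (use HN in \<open>auto simp: HF_def\<close>)
    then obtain c where c: "\<exists>i\<in>{..N}. c i \<noteq> 0"
      "(\<Sum>i\<in>{..N}. mpoly_scale (c i) (?x ^ i * l ^ (N - i))) \<in> P (int N)" by blast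
    define p where "p = (\<Sum>i\<le>N. Polynomial.monom (c i) i)"
    have cp: "poly.coeff p i = (if i \<le> N then c i else 0)" for i
      by (simp add: p_def coeff_sum)
    show ?thesis
    proof (rule binary_form_linear_factor[OF P one prime])
      show "degree p \<le> N" by (rule degree_le) (simp add: cp)
      show "p \<noteq> 0" using c(1) cp by (metis atMost_iff coeff_0)
      show "binary_form ?x l N p \<in> P (int N)" using c(2) by (simp add: binary_form_def cp)
    qed (use l j in auto)
  qed
  then obtain r where r: "\<And>j. j \<le> n \<Longrightarrow> mpoly_var j - mpoly_scale (r j) l \<in> P 1" by metis
  \<comment> \<open>Modulo \<open>P\<close> each \<open>x_j\<close> is \<open>r j\<close> times
    \<open>l\<close>. These ratios are the coordinates of the point, and a form \<open>u\<close> of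
    degree \<open>k\<close> is congruent to \<open>l ^ k\<close> times its value at
    \<open>c\<close>.\<close>
  define c where "c j = (if j \<le> n then r j else 0)" for j
  have cong: "u - mpoly_scale (mpoly_eval u c) (l ^ k) \<in> P (int k)" if "u \<in> homog n (int k)" for u k
    using that
  proof (induction k arbitrary: u)
    case 0
    then obtain a where "u = single 0 a" using homog_zero_degree by auto
    then show ?case by (simp add: eval.subst_single mpoly_scale_def graded_0[OF P])
  next
    case (Suc k)
    then have "u \<in> homog n (int k + 1)" by (simp add: algebra_simps)
    then show ?case
    proof (induction rule: homog_step_induct)
      case (add p q)
      have *: "p + q - mpoly_scale (mpoly_eval (p + q) c) (l ^ Suc k) =
        (p - mpoly_scale (mpoly_eval p c) (l ^ Suc k)) + (q - mpoly_scale (mpoly_eval q c) (l ^ Suc k))"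
        by (simp add: eval.subst_add mpoly.scale_left_distrib del: power_Suc)
      show ?case unfolding * by (rule graded_add[OF P add.IH])
    next
      case (var j w)
      let ?a = "mpoly_eval w c"
      have "mpoly_var j * w - mpoly_scale (mpoly_eval (mpoly_var j * w) c) (l ^ Suc k)
        = mpoly_var j * (w - mpoly_scale ?a (l ^ k)) + mpoly_scale ?a (l ^ k) * (mpoly_var j - mpoly_scale (r j) l)"
      proof -
        have *: "mpoly_scale (mpoly_eval (mpoly_var j * w) c) (l ^ Suc k) = mpoly_scale ?a (l ^ k) * mpoly_scale (r j) l"
          using var(1) by (simp add: eval.subst_mult eval.subst_var c_def
            mpoly_scale_mult_left[symmetric] mpoly_scale_mult_right[symmetric] mult.commute)
        show ?thesis unfolding * by (simp add: right_diff_distrib left_diff_distrib mult.commute)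
      qed
      moreover have "mpoly_var j * (w - mpoly_scale ?a (l ^ k)) \<in> P (int (Suc k))"
        using Suc.IH[OF var(2)] var(1) by (intro graded_mult[OF P mpoly_var_in_homog]) auto
      moreover have "mpoly_scale ?a (l ^ k) * (mpoly_var j - mpoly_scale (r j) l) \<in> P (int (Suc k))"
        by (rule graded_mult[OF P homog_scale[OF homog_power[OF l(1), of k]] r[OF var(1)]]) simp
      ultimately show ?case using graded_add[OF P] by simp
    qed (simp_all add: graded_0[OF P] eval.subst_0)
  qed
  have zero: "mpoly_eval u c = 0" if u: "u \<in> P k" for u k
  proof (cases "k < 0")
    case True
    then show ?thesis using gradedD(2)[OF P u] homog_neg_degree by (simp add: eval.subst_0)
  next
    case False
    then have k: "k = int (nat k)" by simp
    then have "u - mpoly_scale (mpoly_eval u c) (l ^ nat k) \<in> P k"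
      using cong[of u "nat k"] gradedD(2)[OF P u] by simp
    then have "mpoly_scale (mpoly_eval u c) (l ^ nat k) \<in> P k"
      using graded_diff[OF P u] by fastforce
    then show ?thesis using graded_scale_iff[OF P] lpow[of "nat k"] k by metis
  qed
  \<comment> \<open>Applied to \<open>l\<close> itself, the congruence gives \<open>l\<close> the
    value 1 at \<open>c\<close>, so \<open>c\<close> is not the zero vector.\<close>
  have "l - mpoly_scale (mpoly_eval l c) l \<in> P 1" using cong[of l 1] l by simp
  then have "mpoly_scale (1 - mpoly_eval l c) l \<in> P 1" by (simp add: mpoly.scale_left_diff_distrib)
  then have lc: "mpoly_eval l c = 1" using graded_scale_iff[OF P] l(2) by (metis eq_iff_diff_eq_0)
  have "\<exists>i\<le>n. c i \<noteq> 0"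
  proof (rule ccontr)
    assume "\<not> ?thesis"
    then have "c i = 0 * 0" if "i \<le> n" for i using that by auto
    then have "mpoly_eval l c = 0" using eval_homog[OF l(1), of c 0 "\<lambda>_. 0"] by simp
    then show False using lc by simp
  qed
  then have "zero_of n J c" using zero JP by (auto simp: zero_of_def homog_coords_def c_def)
  \<comment> \<open>If \<open>h\<close> vanished at \<open>c\<close>, the congruence would put
    \<open>h\<close> into \<open>P\<close>, against avoidance with exponent 1 and degree 0.\<close>
  moreover have "mpoly_eval h c \<noteq> 0"
  proof
    assume h0: "mpoly_eval h c = 0"
    have "h \<in> P \<rho>" using cong[of h "nat \<rho>"] h \<rho> h0 by simp
    moreover obtain v where "v \<in> homog n (int 0)" "h ^ 1 * v \<notin> P (int 1 * \<rho> + int 0)"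
      using avP unfolding avoids_def by blast
    ultimately show False using graded_mult[OF P, of v 0 h \<rho> \<rho>] by (auto simp: mult.commute)
  qed
  ultimately show ?thesis by blast
qed

subsection \<open>Regular sequences\<close>

definition gen :: "nat \<Rightarrow> (nat \<Rightarrow> mpoly) \<Rightarrow> (nat \<Rightarrow> int) \<Rightarrow> nat set \<Rightarrow> int \<Rightarrow> mpoly set" where
  "gen n q \<delta> K k = {\<Sum>i\<in>K. v i * q i | v. \<forall>i\<in>K. v i \<in> homog n (k - \<delta> i)}"

lemma gen_empty [simp]: "gen n q \<delta> {} = (\<lambda>k. {0})"
  by (auto simp: gen_def)

lemma gen_insert:
  assumes "finite K" "j \<notin> K"
  shows "gen n q \<delta> (insert j K) = adj n (gen n q \<delta> K) (q j) (\<delta> j)"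
proof (rule ext, rule equalityI)
  fix k
  show "gen n q \<delta> (insert j K) k \<subseteq> adj n (gen n q \<delta> K) (q j) (\<delta> j) k"
  proof
    fix x assume "x \<in> gen n q \<delta> (insert j K) k"
    then obtain v where v: "x = (\<Sum>i\<in>insert j K. v i * q i)" "\<forall>i\<in>insert j K. v i \<in> homog n (k - \<delta> i)"
      by (auto simp: gen_def)
    then have "x = (\<Sum>i\<in>K. v i * q i) + v j * q j" using assms by (simp add: add.commute)
    moreover have "(\<Sum>i\<in>K. v i * q i) \<in> gen n q \<delta> K k" using v unfolding gen_def by blast
    ultimately show "x \<in> adj n (gen n q \<delta> K) (q j) (\<delta> j) k" using v(2) unfolding adj_def by blast
  qed
  show "adj n (gen n q \<delta> K) (q j) (\<delta> j) k \<subseteq> gen n q \<delta> (insert j K) k"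
  proof
    fix x assume "x \<in> adj n (gen n q \<delta> K) (q j) (\<delta> j) k"
    then obtain v w where x: "x = (\<Sum>i\<in>K. v i * q i) + w * q j" "\<forall>i\<in>K. v i \<in> homog n (k - \<delta> i)"
      "w \<in> homog n (k - \<delta> j)" by (auto simp: adj_def gen_def)
    have "(\<Sum>i\<in>K. (v(j := w)) i * q i) = (\<Sum>i\<in>K. v i * q i)" using assms by (intro sum.cong) auto
    then have "x = (\<Sum>i\<in>insert j K. (v(j := w)) i * q i)" using assms x by (simp add: add.commute)
    moreover have "\<forall>i\<in>insert j K. (v(j := w)) i \<in> homog n (k - \<delta> i)" using x by auto
    ultimately show "x \<in> gen n q \<delta> (insert j K) k" unfolding gen_def by blast
  qed
qed

lemma gen_cong: "(\<And>i. i \<in> K \<Longrightarrow> q i = q' i \<and> \<delta> i = \<delta>' i) \<Longrightarrow> gen n q \<delta> K = gen n q' \<delta>' K"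
  unfolding gen_def by (auto simp: fun_eq_iff cong: sum.cong)

lemma graded_zero: "graded n (\<lambda>k. {0})"
  by (auto simp: graded_def mpoly.subspace_0 intro: mpoly.subspace_single_0)

lemma graded_gen: "finite K \<Longrightarrow> (\<And>i. i \<in> K \<Longrightarrow> q i \<in> homog n (\<delta> i)) \<Longrightarrow> graded n (gen n q \<delta> K)"
  by (induction K rule: finite_induct) (simp_all add: graded_zero gen_insert graded_adj)

lemma gen_mem:
  assumes "finite K" "i \<in> K"
  shows "q i \<in> gen n q \<delta> K (\<delta> i)"
proof -
  have "(\<Sum>j\<in>K. (if j = i then 1 else 0) * q j) = (\<Sum>j\<in>K. if j = i then q j else 0)"
    by (intro sum.cong) auto
  also have "\<dots> = q i" using assms by simp
  finally show ?thesis
    unfolding gen_def by (intro CollectI exI[of _ "\<lambda>j. if j = i then 1 else 0"]) auto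
qed

lemma gen_least:
  assumes "graded n I" "\<And>i. i \<in> K \<Longrightarrow> q i \<in> I (\<delta> i)" "u \<in> gen n q \<delta> K k"
  shows "u \<in> I k"
proof -
  obtain v where v: "u = (\<Sum>i\<in>K. v i * q i)" "\<And>i. i \<in> K \<Longrightarrow> v i \<in> homog n (k - \<delta> i)"
    using assms(3) by (auto simp: gen_def)
  show ?thesis
    unfolding v(1) by (rule graded_sum[OF assms(1)], rule graded_mult[OF assms(1) v(2) assms(2)]) auto
qed

text \<open>Each member is a nonzerodivisor modulo any set of the others, not just modulo its
  predecessors: the exchange argument replaces members at arbitrary positions.\<close>

definition regular :: "nat \<Rightarrow> (nat \<Rightarrow> mpoly) \<Rightarrow> (nat \<Rightarrow> int) \<Rightarrow> bool" where
  "regular n q \<delta> \<longleftrightarrow> (\<forall>K i k. K \<subseteq> {..n} \<longrightarrow> i \<in> {..n} - K \<longrightarrow>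
     colon n (gen n q \<delta> K) (q i) (\<delta> i) k \<subseteq> gen n q \<delta> K k)"

definition artinian :: "nat \<Rightarrow> (int \<Rightarrow> mpoly set) \<Rightarrow> bool" where
  "artinian n I \<longleftrightarrow> (\<exists>t. homog n (int t) \<subseteq> I (int t))"

text \<open>The preimage in \<open>S\<close> of the degree \<open>k\<close> part of the socle of
  \<open>S/I\<close>, that is, of the elements killed by all variables.\<close>

definition soc :: "nat \<Rightarrow> (int \<Rightarrow> mpoly set) \<Rightarrow> int \<Rightarrow> mpoly set" where
  "soc n I k = {u \<in> homog n k. \<forall>j\<le>n. mpoly_var j * u \<in> I (k + 1)}"

text \<open>Zero-dimensional complete intersections. The last condition, that the quotient ring is
  Gorenstein, is a consequence of the others; it is included because the same exchange argument
  proves it along with regularity.\<close>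

definition CI :: "nat \<Rightarrow> (nat \<Rightarrow> mpoly) \<Rightarrow> (nat \<Rightarrow> int) \<Rightarrow> bool" where
  "CI n q \<delta> \<longleftrightarrow> (\<forall>i\<le>n. \<delta> i \<ge> 1 \<and> q i \<in> homog n (\<delta> i)) \<and> regular n q \<delta> \<and>
     artinian n (gen n q \<delta> {..n}) \<and>
     (\<forall>k. mpoly.qdim (soc n (gen n q \<delta> {..n}) k) (gen n q \<delta> {..n} k)
        = (if k = (\<Sum>i\<le>n. \<delta> i - 1) then 1 else 0))"

lemma artinian_above:
  assumes "graded n I" "artinian n I"
  obtains t :: nat where "\<And>k. k \<ge> int t \<Longrightarrow> homog n k \<subseteq> I k"
proof -
  obtain t where "homog n (int t) \<subseteq> I (int t)" using assms(2) by (auto simp: artinian_def)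
  then show ?thesis using graded_full_above[OF assms(1)] by (intro that[of t]) auto
qed

lemma colonD: "colon n I b \<beta> k \<subseteq> I k \<Longrightarrow> u \<in> homog n k \<Longrightarrow> u * b \<in> I (k + \<beta>) \<Longrightarrow> u \<in> I k"
  by (auto simp: colon_def)

section \<open>Nonzerodivisors under exchange\<close>

lemma nonzerodivisor_power:
  assumes I: "graded n I" and a: "a \<in> homog n \<alpha>" and nzd: "\<And>k. colon n I a \<alpha> k \<subseteq> I k"
    and u: "u \<in> homog n k" "a ^ N * u \<in> I (int N * \<alpha> + k)"
  shows "u \<in> I k"
  using u(2)
proof (induction N)
  case (Suc N)
  have "a ^ N * u \<in> homog n (int N * \<alpha> + k)" by (intro homog_mult homog_power a u(1))
  moreover have "a ^ N * u * a \<in> I (int N * \<alpha> + k + \<alpha>)" using Suc.prems by (simp add: algebra_simps)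
  ultimately have "a ^ N * u \<in> I (int N * \<alpha> + k)" by (rule colonD[OF nzd])
  then show ?case by (rule Suc.IH)
qed simp

text \<open>Modulo \<open>I\<close> and in high degrees, multiplication by \<open>a\<close> is bijective and multiplication by \<open>b\<close>
  is surjective. Since \<open>\<beta>\<close> steps of degree \<open>\<alpha>\<close> lead as far as \<open>\<alpha>\<close> steps of degree \<open>\<beta>\<close>, the latter
  does not decrease the dimension either.\<close>

lemma nonzerodivisor_if_artinian:
  assumes I: "graded n I" and a: "a \<in> homog n \<alpha>" "\<alpha> \<ge> 1" and b: "b \<in> homog n \<beta>" "\<beta> \<ge> 1"
    and nzd: "\<And>k. colon n I a \<alpha> k \<subseteq> I k"
    and art: "artinian n (adj n I a \<alpha>)" "artinian n (adj n I b \<beta>)"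
  shows "colon n I b \<beta> k \<subseteq> I k"
proof -
  obtain t where t: "\<And>k. k \<ge> int t \<Longrightarrow> homog n k \<subseteq> adj n I a \<alpha> k"
    using artinian_above[OF graded_adj[OF I a(1)] art(1)] by blast
  obtain t' where t': "\<And>k. k \<ge> int t' \<Longrightarrow> homog n k \<subseteq> adj n I b \<beta> k"
    using artinian_above[OF graded_adj[OF I b(1)] art(2)] by blast
  define M where "M = int (max t t')"
  have colon_eq: "colon n I a \<alpha> k = I k" for k
    using nzd colon_superset[OF I a(1)] by blast
  have A: "HF n I (k + \<alpha>) = HF n I k" if "k \<ge> M" for k
  proof -
    have "homog n (k + \<alpha>) \<subseteq> adj n I a \<alpha> (k + \<alpha>)" using that a(2) by (intro t) (auto simp: M_def)
    then have "HF n (adj n I a \<alpha>) (k + \<alpha>) = 0" using HF_0_iff[OF graded_adj[OF I a(1)]] by blast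
    then show ?thesis using HF_adj[OF I a(1), of "k + \<alpha>"] by (simp add: colon_eq HF_def)
  qed
  have B: "HF n I (k + \<beta>) = mpoly.qdim (homog n k) (colon n I b \<beta> k)" if "k \<ge> M" for k
  proof -
    have "homog n (k + \<beta>) \<subseteq> adj n I b \<beta> (k + \<beta>)" using that b(2) by (intro t') (auto simp: M_def)
    then have "HF n (adj n I b \<beta>) (k + \<beta>) = 0" using HF_0_iff[OF graded_adj[OF I b(1)]] by blast
    then show ?thesis using HF_adj[OF I b(1), of "k + \<beta>"] by simp
  qed
  have Ble: "HF n I (k + \<beta>) \<le> HF n I k" if "k \<ge> M" for k
    using B[OF that] qdim_colon_le[OF I b(1), of k] by simp
  have Ai: "HF n I (k + int i * \<alpha>) = HF n I k" if "k \<ge> M" for k i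
  proof (induction i)
    case (Suc i)
    have "M \<le> k + int i * \<alpha>" using that a(2) by (simp add: add_increasing2)
    from A[OF this] Suc show ?case by (simp add: algebra_simps)
  qed simp
  have Bi: "HF n I (k + int i * \<beta>) \<le> HF n I k" if "k \<ge> M" for k i
  proof (induction i)
    case (Suc i)
    have "M \<le> k + int i * \<beta>" using that b(2) by (simp add: add_increasing2)
    from Ble[OF this] Suc show ?case by (simp add: algebra_simps)
  qed simp
  have high: "colon n I b \<beta> k \<subseteq> I k" if k: "k \<ge> M" for k
  proof -
    \<comment> \<open>The two ways of reaching \<open>k + \<alpha> * \<beta>\<close> squeeze
      \<open>HF n I (k + \<beta>)\<close> between two equal values.\<close>
    have "HF n I k = HF n I (k + int (nat \<beta>) * \<alpha>)" using Ai[OF k, of "nat \<beta>"] b(2) by simp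
    also have "k + int (nat \<beta>) * \<alpha> = (k + \<beta>) + int (nat (\<alpha> - 1)) * \<beta>"
      using a(2) b(2) by (simp add: algebra_simps)
    also have "HF n I \<dots> \<le> HF n I (k + \<beta>)" using k b(2) by (intro Bi) auto
    finally have "HF n I k = HF n I (k + \<beta>)" using Ble[OF k] by simp
    then have "mpoly.qdim (colon n I b \<beta> k) (I k) = 0"
      using B[OF k] HF_colon[OF I b(1), of k] by simp
    then show ?thesis by (rule colon_subset_if_qdim_0[OF I b(1)])
  qed
  show ?thesis
  proof
    fix u assume u: "u \<in> colon n I b \<beta> k"
    show "u \<in> I k"
    proof (cases "k < 0")
      case True
      then show ?thesis using u graded_0[OF I] by (simp add: colon_def homog_neg_degree)
    next
      case False
      have uk: "u \<in> homog n k" using u by (simp add: colon_def)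
      \<comment> \<open>Low degrees are reduced to high ones: multiplication by this power of
        \<open>a\<close> is injective modulo \<open>I\<close> and raises the degree to at least
        \<open>M\<close>.\<close>
      have "a ^ nat M * u \<in> colon n I b \<beta> (int (nat M) * \<alpha> + k)"
        using gradedD(3)[OF graded_colon[OF I b(1)] homog_power[OF a(1), of "nat M"] u] .
      moreover have "int (nat M) * \<alpha> + k \<ge> M"
      proof -
        have "M * 1 \<le> M * \<alpha>" using a(2) by (intro mult_left_mono) (auto simp: M_def)
        then show ?thesis using False by (simp add: M_def)
      qed
      ultimately have "a ^ nat M * u \<in> I (int (nat M) * \<alpha> + k)" using high by blast
      then show ?thesis by (rule nonzerodivisor_power[OF I a(1) nzd uk])
    qed
  qed
qed

text \<open>From \<open>u b\<close> in \<open>I\<close> one gets \<open>u = p + w c\<close> with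
  \<open>p\<close> in \<open>I\<close>; cancelling \<open>c\<close> in \<open>w b c\<close> leaves
  \<open>w b\<close> in \<open>I\<close>, and \<open>w\<close> has smaller degree than
  \<open>u\<close>. The descent ends because forms of negative degree vanish.\<close>

lemma nonzerodivisor_descend:
  assumes I: "graded n I" and c: "c \<in> homog n \<gamma>" "\<gamma> \<ge> 1" and b: "b \<in> homog n \<beta>"
    and nc: "\<And>k. colon n I c \<gamma> k \<subseteq> I k"
    and nb: "\<And>k. colon n (adj n I c \<gamma>) b \<beta> k \<subseteq> adj n I c \<gamma> k"
  shows "colon n I b \<beta> k \<subseteq> I k"
proof
  fix u assume "u \<in> colon n I b \<beta> k"
  then show "u \<in> I k"
  proof (induction "nat (k + 1)" arbitrary: u k rule: less_induct)
    case less
    then have u: "u \<in> homog n k" "u * b \<in> I (k + \<beta>)" by (auto simp: colon_def)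
    show ?case
    proof (cases "k < 0")
      case True
      then show ?thesis using u graded_0[OF I] by (simp add: homog_neg_degree)
    next
      case False
      have "u \<in> adj n I c \<gamma> k" by (rule colonD[OF nb u(1) adj_superset[where I = I, OF u(2)]])
      then obtain p w where pw: "u = p + w * c" "p \<in> I k" "w \<in> homog n (k - \<gamma>)" by (auto simp: adj_def)
      have "b * p \<in> I (k + \<beta>)" using b pw(2) by (rule graded_mult[OF I]) simp
      then have "u * b - b * p \<in> I (k + \<beta>)" by (rule graded_diff[OF I u(2)])
      moreover have "u * b - b * p = w * b * c" by (simp add: pw(1) algebra_simps)
      ultimately have wbc: "w * b * c \<in> I (k - \<gamma> + \<beta> + \<gamma>)" by (simp add: algebra_simps)
      have "w * b \<in> I (k - \<gamma> + \<beta>)" by (rule colonD[OF nc homog_mult[OF pw(3) b] wbc])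
      then have "w \<in> colon n I b \<beta> (k - \<gamma>)" using pw(3) by (simp add: colon_def)
      then have "w \<in> I (k - \<gamma>)" using False c(2) by (intro less.hyps) auto
      then have "c * w \<in> I k" by (rule graded_mult[OF I c(1)]) simp
      then show ?thesis using graded_add[OF I pw(2)] pw(1) by (simp add: mult.commute)
    qed
  qed
qed

text \<open>If \<open>u a = v b\<close> modulo \<open>I\<close>, then \<open>v\<close> lies in
  \<open>I + (a)\<close>, say \<open>v = w a\<close> modulo \<open>I\<close>, and cancelling
  \<open>a\<close> gives \<open>u = w b\<close> modulo \<open>I\<close>.\<close>

lemma nonzerodivisor_swap:
  assumes I: "graded n I" and a: "a \<in> homog n \<alpha>" and b: "b \<in> homog n \<beta>"
    and na: "\<And>k. colon n I a \<alpha> k \<subseteq> I k"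
    and nb: "\<And>k. colon n (adj n I a \<alpha>) b \<beta> k \<subseteq> adj n I a \<alpha> k"
  shows "colon n (adj n I b \<beta>) a \<alpha> k \<subseteq> adj n I b \<beta> k"
proof
  fix u assume "u \<in> colon n (adj n I b \<beta>) a \<alpha> k"
  then obtain p v where u: "u \<in> homog n k" "u * a = p + v * b" "p \<in> I (k + \<alpha>)" "v \<in> homog n (k + \<alpha> - \<beta>)"
    by (auto simp: colon_def adj_def)
  have "u * a \<in> adj n I a \<alpha> (k + \<alpha>)" using u(1) by (intro adj_gen[OF I]) simp
  then have "u * a - p \<in> adj n I a \<alpha> (k + \<alpha>)"
    by (rule graded_diff[OF graded_adj[OF I a] _ adj_superset[where I = I, OF u(3)]])
  then have "v * b \<in> adj n I a \<alpha> (k + \<alpha> - \<beta> + \<beta>)" by (simp add: u(2))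
  then have "v \<in> adj n I a \<alpha> (k + \<alpha> - \<beta>)" by (rule colonD[OF nb u(4)])
  then obtain p' w where v: "v = p' + w * a" "p' \<in> I (k + \<alpha> - \<beta>)" "w \<in> homog n (k - \<beta>)"
    by (auto simp: adj_def algebra_simps)
  have "(u - w * b) * a = p + b * p'" using u(2) v(1) by (simp add: algebra_simps)
  moreover have "b * p' \<in> I (k + \<alpha>)" by (rule graded_mult[OF I b v(2)]) simp
  ultimately have z: "(u - w * b) * a \<in> I (k + \<alpha>)" using graded_add[OF I u(3)] by simp
  have "u - w * b \<in> homog n k" using u(1) homog_mult'[OF v(3) b, of k] by (intro homog_diff) auto
  then have "u - w * b \<in> I k" using z by (rule colonD[OF na])
  then show "u \<in> adj n I b \<beta> k"
    unfolding adj_def using v(3) by (intro CollectI exI[of _ "u - w * b"] exI[of _ w]) simp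
qed

section \<open>Socles under exchange\<close>

lemma soc_mult:
  assumes I: "graded n I" and u: "u \<in> soc n I k" and b: "b \<in> homog n \<beta>" "\<beta> \<ge> 1"
  shows "b * u \<in> I (k + \<beta>)"
proof -
  have "b \<in> homog n ((\<beta> - 1) + 1)" using b by simp
  then show ?thesis
  proof (induction rule: homog_step_induct)
    case (var j w)
    have "w * (mpoly_var j * u) \<in> I (k + \<beta>)"
      using u var(1) by (intro graded_mult[OF I var(2), of _ "k + 1"]) (auto simp: soc_def)
    then show ?case by (simp add: ac_simps)
  qed (use b in \<open>auto simp: graded_0[OF I] graded_add[OF I] distrib_right\<close>)
qed

lemma subspace_soc:
  assumes I: "graded n I"
  shows "mpoly.subspace (soc n I k)"
  by (rule mpoly.subspaceI)
    (auto simp: soc_def graded_0[OF I] homog_add homog_scale distrib_left graded_add[OF I]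
      mpoly_scale_mult_right[symmetric] graded_scale[OF I])

lemma soc_superset: "graded n I \<Longrightarrow> u \<in> I k \<Longrightarrow> u \<in> soc n I k"
  by (auto simp: soc_def gradedD(2) intro!: graded_mult)

lemma fin_soc: "graded n I \<Longrightarrow> mpoly.fin_quotient (soc n I k) (I k)"
  by (intro fin_quotient_homog[of _ _ n k] subspace_soc gradedD(1))
    (auto simp: soc_superset, auto simp: soc_def)

text \<open>If \<open>u\<close> represents a socle element modulo \<open>I + (a)\<close>, then \<open>b u = a v\<close> modulo \<open>I\<close> for a unique
  socle element \<open>v\<close> modulo \<open>I + (b)\<close>.\<close>

lemma qdim_soc_le:
  assumes I: "graded n I" and a: "a \<in> homog n \<alpha>" and b: "b \<in> homog n \<beta>" "\<beta> \<ge> 1"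
    and na: "\<And>k. colon n I a \<alpha> k \<subseteq> I k" and nb: "\<And>k. colon n I b \<beta> k \<subseteq> I k"
  shows "mpoly.qdim (soc n (adj n I a \<alpha>) k) (adj n I a \<alpha> k)
    \<le> mpoly.qdim (soc n (adj n I b \<beta>) (k + \<beta> - \<alpha>)) (adj n I b \<beta> (k + \<beta> - \<alpha>))"
proof -
  note Ia = graded_adj[OF I a] and Ib = graded_adj[OF I b(1)]
  let ?k = "k + \<beta> - \<alpha>"
  obtain A where A: "finite A" "mpoly.quotient_basis (soc n (adj n I a \<alpha>) k) (adj n I a \<alpha> k) A"
    using fin_soc[OF Ia] unfolding mpoly.fin_quotient_def by blast
  note Asub = mpoly.quotient_basis_subset[OF A(2)]
  \<comment> \<open>Having positive degree, \<open>b\<close> kills the socle of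
    \<open>S/(I + (a))\<close>.\<close>
  have "\<exists>v p. b * u = p + v * a \<and> p \<in> I (k + \<beta>) \<and> v \<in> homog n ?k" if "u \<in> A" for u
  proof -
    have "b * u \<in> adj n I a \<alpha> (k + \<beta>)" using that Asub b by (intro soc_mult[OF Ia]) auto
    then show ?thesis by (auto simp: adj_def)
  qed
  then obtain v p where vp: "\<And>u. u \<in> A \<Longrightarrow> b * u = p u + v u * a \<and> p u \<in> I (k + \<beta>) \<and> v u \<in> homog n ?k"
    by metis
  have vsoc: "v u \<in> soc n (adj n I b \<beta>) ?k" if u: "u \<in> A" for u
    unfolding soc_def
  proof (intro CollectI conjI allI impI)
    show "v u \<in> homog n ?k" using vp[OF u] by blast
    fix t assume t: "t \<le> n"
    have "mpoly_var t * u \<in> adj n I a \<alpha> (k + 1)" using u Asub t by (auto simp: soc_def)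
    then obtain p' w where w: "mpoly_var t * u = p' + w * a" "p' \<in> I (k + 1)" "w \<in> homog n (k + 1 - \<alpha>)"
      by (auto simp: adj_def)
    \<comment> \<open>Cancelling \<open>a\<close> in this identity shows that the variable sends
      \<open>v u\<close> into \<open>I + (b)\<close>.\<close>
    have "(mpoly_var t * v u - w * b) * a = b * p' - mpoly_var t * p u"
    proof -
      have "mpoly_var t * v u * a = mpoly_var t * (b * u - p u)" using vp[OF u] by (simp add: algebra_simps)
      also have "\<dots> = b * (p' + w * a) - mpoly_var t * p u" unfolding w(1)[symmetric] by (simp add: algebra_simps)
      finally show ?thesis by (simp add: algebra_simps)
    qed
    also have "\<dots> \<in> I (?k + 1 + \<alpha>)"
    proof (rule graded_diff[OF I])
      show "b * p' \<in> I (?k + 1 + \<alpha>)" by (rule graded_mult[OF I b(1) w(2)]) simp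
      have "p u \<in> I (k + \<beta>)" using vp[OF u] by blast
      then show "mpoly_var t * p u \<in> I (?k + 1 + \<alpha>)"
        by (rule graded_mult[OF I mpoly_var_in_homog[OF t]]) simp
    qed
    finally have z: "(mpoly_var t * v u - w * b) * a \<in> I (?k + 1 + \<alpha>)" .
    have "mpoly_var t * v u - w * b \<in> homog n (?k + 1)"
    proof (rule homog_diff)
      have "v u \<in> homog n ?k" using vp[OF u] by blast
      then show "mpoly_var t * v u \<in> homog n (?k + 1)"
        by (rule homog_mult'[OF mpoly_var_in_homog[OF t]]) simp
      show "w * b \<in> homog n (?k + 1)" by (rule homog_mult'[OF w(3) b(1)]) simp
    qed
    then have "mpoly_var t * v u - w * b \<in> I (?k + 1)" using z by (rule colonD[OF na])
    moreover have "w * b \<in> adj n I b \<beta> (?k + 1)" using w(3) by (intro adj_gen[OF I]) (simp add: algebra_simps)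
    ultimately have "mpoly_var t * v u - w * b + w * b \<in> adj n I b \<beta> (?k + 1)"
      by (intro graded_add[OF Ib]) (rule adj_superset)
    then show "mpoly_var t * v u \<in> adj n I b \<beta> (?k + 1)" by simp
  qed
  have "card A \<le> mpoly.qdim (soc n (adj n I b \<beta>) ?k) (adj n I b \<beta> ?k)"
  proof (rule mpoly.qdim_ge_if_independent[OF gradedD(1)[OF Ib] fin_soc[OF Ib] A(1) vsoc])
    fix c u assume s: "(\<Sum>u\<in>A. mpoly_scale (c u) (v u)) \<in> adj n I b \<beta> ?k" and u: "u \<in> A"
    let ?v = "\<Sum>u\<in>A. mpoly_scale (c u) (v u)" and ?u = "\<Sum>u\<in>A. mpoly_scale (c u) u"
      and ?p = "\<Sum>u\<in>A. mpoly_scale (c u) (p u)"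
    obtain p' w where w: "?v = p' + w * b" "p' \<in> I ?k" "w \<in> homog n (k - \<alpha>)"
      using s by (auto simp: adj_def algebra_simps)
    \<comment> \<open>When the combination of the \<open>v u\<close> vanishes modulo
      \<open>I + (b)\<close>, cancelling \<open>b\<close> makes the same combination of the
      \<open>u\<close> vanish modulo \<open>I + (a)\<close>.\<close>
    have "b * ?u = (\<Sum>u\<in>A. mpoly_scale (c u) (b * u))"
      by (simp add: sum_distrib_left mpoly_scale_mult_right)
    also have "\<dots> = (\<Sum>u\<in>A. mpoly_scale (c u) (p u) + mpoly_scale (c u) (v u) * a)"
      using vp by (intro sum.cong refl) (simp add: mpoly.scale_right_distrib mpoly_scale_mult_left)
    also have "\<dots> = ?p + ?v * a" by (simp add: sum.distrib sum_distrib_right)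
    finally have "(?u - w * a) * b = ?p + a * p'" unfolding w(1) by (simp add: algebra_simps)
    also have "\<dots> \<in> I (k + \<beta>)"
    proof (rule graded_add[OF I])
      show "?p \<in> I (k + \<beta>)" using vp by (intro graded_sum[OF I] graded_scale[OF I]) auto
      show "a * p' \<in> I (k + \<beta>)" by (rule graded_mult[OF I a w(2)]) simp
    qed
    finally have z: "(?u - w * a) * b \<in> I (k + \<beta>)" .
    have "?u \<in> homog n k" using Asub by (intro homog_sum homog_scale) (auto simp: soc_def)
    then have "?u - w * a \<in> homog n k" using homog_mult'[OF w(3) a, of k] by (intro homog_diff) auto
    then have "?u - w * a \<in> I k" using z by (rule colonD[OF nb])
    then have "?u - w * a + w * a \<in> adj n I a \<alpha> k"
      using w(3) by (intro graded_add[OF Ia] adj_superset adj_gen[OF I])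
    then have "?u \<in> adj n I a \<alpha> k" by simp
    then show "c u = 0" using mpoly.quotient_basis_indep[OF A(2) A(1) order_refl _ u] by blast
  qed
  then show ?thesis using mpoly.qdim_eq[OF gradedD(1)[OF Ia] A] by simp
qed

lemma CID:
  assumes "CI n q \<delta>"
  shows "i \<le> n \<Longrightarrow> \<delta> i \<ge> 1" "i \<le> n \<Longrightarrow> q i \<in> homog n (\<delta> i)"
    "K \<subseteq> {..n} \<Longrightarrow> i \<le> n \<Longrightarrow> i \<notin> K \<Longrightarrow> colon n (gen n q \<delta> K) (q i) (\<delta> i) k \<subseteq> gen n q \<delta> K k"
    "artinian n (gen n q \<delta> {..n})"
    "mpoly.qdim (soc n (gen n q \<delta> {..n}) k) (gen n q \<delta> {..n} k) = (if k = (\<Sum>i\<le>n. \<delta> i - 1) then 1 else 0)"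
    "K \<subseteq> {..n} \<Longrightarrow> graded n (gen n q \<delta> K)"
proof -
  show "K \<subseteq> {..n} \<Longrightarrow> graded n (gen n q \<delta> K)"
    using assms finite_subset[of K "{..n}"] unfolding CI_def by (intro graded_gen) auto
qed (use assms in \<open>auto simp: CI_def regular_def\<close>)

text \<open>Finite-dimensionality directly shows only that \<open>b\<close> is a nonzerodivisor
  modulo all the other members. This descends to smaller sets of members, and
  \<open>nonzerodivisor_swap\<close> yields the statement for old members modulo sets containing
  \<open>b\<close>. Comparing socles in both directions shifts the socle degree by
  \<open>\<beta> - \<delta> j\<close>.\<close>

theorem CI_exchange:
  assumes CI: "CI n q \<delta>" and j: "j \<le> n" and b: "b \<in> homog n \<beta>" "\<beta> \<ge> 1"
    and art: "artinian n (gen n (q(j := b)) (\<delta>(j := \<beta>)) {..n})"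
  shows "CI n (q(j := b)) (\<delta>(j := \<beta>))"
proof -
  let ?q = "q(j := b)" and ?d = "\<delta>(j := \<beta>)"
  note gr = CID(6)[OF CI]
  have same: "gen n ?q ?d K = gen n q \<delta> K" if "j \<notin> K" for K
    using that by (intro gen_cong) auto
  have ins: "gen n ?q ?d (insert j K) = adj n (gen n q \<delta> K) b \<beta>" if "j \<notin> K" "K \<subseteq> {..n}" for K
    using that finite_subset[OF that(2)] by (subst gen_insert) (auto simp: same)
  have insq: "gen n q \<delta> (insert i K) = adj n (gen n q \<delta> K) (q i) (\<delta> i)" if "i \<notin> K" "K \<subseteq> {..n}" for K i
    using that finite_subset[OF that(2)] by (subst gen_insert) auto
  define L where "L = {..n} - {j}"
  have L: "insert j L = {..n}" "j \<notin> L" "L \<subseteq> {..n}" using j by (auto simp: L_def)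
  have full: "gen n q \<delta> {..n} = adj n (gen n q \<delta> L) (q j) (\<delta> j)"
    "gen n ?q ?d {..n} = adj n (gen n q \<delta> L) b \<beta>"
    using insq[OF L(2,3)] ins[OF L(2,3)] by (simp_all add: L(1))
  have nb: "colon n (gen n q \<delta> K) b \<beta> k \<subseteq> gen n q \<delta> K k" if "K \<subseteq> L" for K k
    using that
  proof (induction "card (L - K)" arbitrary: K k)
    case 0
    then have "K = L" using finite_subset[OF L(3)] by auto
    then show ?case
      using nonzerodivisor_if_artinian[OF gr[OF L(3)] CID(2)[OF CI j] CID(1)[OF CI j] b CID(3)[OF CI L(3) j L(2)]]
        CID(4)[OF CI] art full by simp
  next
    case (Suc m)
    then obtain c where c: "c \<in> L" "c \<notin> K" by (metis Diff_iff card.empty all_not_in_conv nat.distinct(1))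
    have cn: "c \<le> n" using c L by auto
    have Kn: "K \<subseteq> {..n}" using Suc.prems L by auto
    have "finite (L - K)" using finite_subset[OF L(3)] by auto
    moreover have "L - insert c K = (L - K) - {c}" by auto
    ultimately have "m = card (L - insert c K)" using Suc.hyps(2) c by simp
    then have "colon n (gen n q \<delta> (insert c K)) b \<beta> k \<subseteq> gen n q \<delta> (insert c K) k" for k
      using Suc.prems c by (intro Suc.hyps(1)) auto
    then show ?case
      using nonzerodivisor_descend[OF gr[OF Kn] CID(2)[OF CI cn] CID(1)[OF CI cn] b(1) CID(3)[OF CI Kn cn c(2)]]
      unfolding insq[OF c(2) Kn] by blast
  qed
  have "regular n ?q ?d"
    unfolding regular_def
  proof (intro allI impI)
    fix K i k assume K: "K \<subseteq> {..n}" and i: "i \<in> {..n} - K"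
    show "colon n (gen n ?q ?d K) (?q i) (?d i) k \<subseteq> gen n ?q ?d K k"
    proof (cases "j \<in> K")
      case False
      then show ?thesis
        using nb[of K k] CID(3)[OF CI K, of i k] i K by (cases "i = j") (auto simp: same L_def)
    next
      case True
      define K' where "K' = K - {j}"
      have K': "insert j K' = K" "j \<notin> K'" "K' \<subseteq> {..n}" "i \<notin> K'" "i \<le> n" "i \<noteq> j" "insert i K' \<subseteq> L"
        using True K i by (auto simp: K'_def L_def)
      have "colon n (adj n (gen n q \<delta> K') b \<beta>) (q i) (\<delta> i) k \<subseteq> adj n (gen n q \<delta> K') b \<beta> k"
        using nonzerodivisor_swap[OF gr[OF K'(3)] CID(2)[OF CI K'(5)] b(1) CID(3)[OF CI K'(3,5,4)]]
          nb[OF K'(7)] unfolding insq[OF K'(4,3)] by blast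
      then show ?thesis using ins[OF K'(2,3)] K' by simp
    qed
  qed
  moreover have "mpoly.qdim (soc n (gen n ?q ?d {..n}) k) (gen n ?q ?d {..n} k)
      = (if k = (\<Sum>i\<le>n. ?d i - 1) then 1 else 0)" for k
  proof -
    have s: "(\<Sum>i\<le>n. ?d i - 1) = (\<Sum>i\<le>n. \<delta> i - 1) + \<beta> - \<delta> j"
    proof -
      have "(\<Sum>i\<le>n. ?d i - 1) = (\<Sum>i\<in>insert j L. ?d i - 1)" by (simp add: L(1))
      also have "\<dots> = \<beta> - 1 + (\<Sum>i\<in>L. ?d i - 1)" using L(2) by (subst sum.insert) (auto simp: L_def)
      also have "(\<Sum>i\<in>L. ?d i - 1) = (\<Sum>i\<in>L. \<delta> i - 1)" using L(2) by (intro sum.cong) auto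
      finally have 1: "(\<Sum>i\<le>n. ?d i - 1) = \<beta> - 1 + (\<Sum>i\<in>L. \<delta> i - 1)" .
      have "(\<Sum>i\<le>n. \<delta> i - 1) = (\<Sum>i\<in>insert j L. \<delta> i - 1)" by (simp add: L(1))
      also have "\<dots> = \<delta> j - 1 + (\<Sum>i\<in>L. \<delta> i - 1)" using L(2) by (subst sum.insert) (auto simp: L_def)
      finally show ?thesis using 1 by simp
    qed
    let ?I = "gen n q \<delta> L" and ?k = "k + \<delta> j - \<beta>"
    note I = gr[OF L(3)] and na = CID(3)[OF CI L(3) j L(2)] and nb = nb[OF order_refl]
    have "mpoly.qdim (soc n (adj n ?I b \<beta>) k) (adj n ?I b \<beta> k)
       \<le> mpoly.qdim (soc n (adj n ?I (q j) (\<delta> j)) ?k) (adj n ?I (q j) (\<delta> j) ?k)"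
      by (rule qdim_soc_le[OF I b(1) CID(2,1)[OF CI j] nb na])
    moreover have "mpoly.qdim (soc n (adj n ?I (q j) (\<delta> j)) ?k) (adj n ?I (q j) (\<delta> j) ?k)
       \<le> mpoly.qdim (soc n (adj n ?I b \<beta>) (?k + \<beta> - \<delta> j)) (adj n ?I b \<beta> (?k + \<beta> - \<delta> j))"
      by (rule qdim_soc_le[OF I CID(2)[OF CI j] b na nb])
    ultimately have "mpoly.qdim (soc n (adj n ?I b \<beta>) k) (adj n ?I b \<beta> k)
       = mpoly.qdim (soc n (adj n ?I (q j) (\<delta> j)) ?k) (adj n ?I (q j) (\<delta> j) ?k)" by simp
    then show ?thesis using CID(5)[OF CI, of ?k] unfolding full s by auto
  qed
  ultimately show ?thesis using art CID(1,2)[OF CI] b unfolding CI_def by auto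
qed

subsection \<open>The variables\<close>

lemma lookup_var_mult: "lookup (mpoly_var i * p) (single i 1 + m) = lookup p m"
proof -
  have "mpoly_var i * p = (\<Sum>k\<in>keys p. single (single i 1 + k) (lookup p k))"
    by (subst (1) poly_mapping_eq_sum_single[of p]) (simp add: sum_distrib_left single_var_mult[symmetric])
  then have "lookup (mpoly_var i * p) (single i 1 + m) = (\<Sum>k\<in>keys p. if k = m then lookup p k else 0)"
    by (simp add: lookup_sum lookup_single when_def)
  also have "\<dots> = lookup p m" by (simp add: in_keys_iff)
  finally show ?thesis .
qed

text \<open>An ideal generated by variables is spanned by monomials, so membership, and with it the
  nonzerodivisor property, can be tested on each monomial.\<close>

lemma gen_vars:
  assumes K: "K \<subseteq> {..n}"
  shows "gen n mpoly_var (\<lambda>_. 1) K k = {h \<in> homog n k. \<forall>m\<in>keys h. keys m \<inter> K \<noteq> {}}"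
proof -
  define M where "M k = {h \<in> homog n k. \<forall>m\<in>keys h. keys m \<inter> K \<noteq> {}}" for k
  have fin: "finite K" using K finite_subset by blast
  have gM: "graded n M"
    unfolding graded_def
  proof (intro conjI allI impI)
    fix k
    show "mpoly.subspace (M k)"
    proof (rule mpoly.subspaceI)
      fix x y assume "x \<in> M k" "y \<in> M k"
      then show "x + y \<in> M k"
        using Poly_Mapping.keys_add[of x y] homog_add by (auto simp: M_def)
    qed (auto simp: M_def homog_scale in_keys_iff)
    show "M k \<subseteq> homog n k" by (auto simp: M_def)
  next
    fix i k a u assume au: "a \<in> homog n i" "u \<in> M k"
    have "keys m \<inter> K \<noteq> {}" if m: "m \<in> keys (a * u)" for m
    proof -
      obtain x y where "m = x + y" "y \<in> keys u" using m keys_mult_subset by blast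
      then show ?thesis using au by (auto simp: M_def keys_add_monom)
    qed
    then show "a * u \<in> M (i + k)" using au by (auto simp: M_def homog_mult)
  qed
  have gg: "graded n (gen n mpoly_var (\<lambda>_. 1) K)"
    using K by (intro graded_gen fin) auto
  have "gen n mpoly_var (\<lambda>_. 1) K k \<subseteq> M k"
  proof
    fix u assume "u \<in> gen n mpoly_var (\<lambda>_. 1) K k"
    then show "u \<in> M k"
      by (rule gen_least[OF gM, rotated]) (use K in \<open>auto simp: M_def, auto simp: mpoly_var_def\<close>)
  qed
  moreover have "h \<in> gen n mpoly_var (\<lambda>_. 1) K k" if h: "h \<in> M k" for h
  proof -
    have "single m (lookup h m) \<in> gen n mpoly_var (\<lambda>_. 1) K k" if m: "m \<in> keys h" for m
    proof -
      obtain i where i: "i \<in> keys m" "i \<in> K" using h m by (auto simp: M_def)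
      obtain m' where m': "m = single i 1 + m'" using monom_split_var[OF i(1)] by blast
      have h': "h \<in> homog n k" using h by (simp add: M_def)
      have "keys m' \<subseteq> {..n}" "k - 1 = int (mdeg m')"
        using homog_vars[OF h' m] homog_mdeg[OF h' m] m' by (auto simp: keys_add_monom mdeg_add)
      then have "single m' (lookup h m) \<in> homog n (k - 1)" by (intro single_in_homog)
      then have "single m' (lookup h m) * mpoly_var i \<in> gen n mpoly_var (\<lambda>_. 1) K k"
        by (rule graded_mult[OF gg _ gen_mem[OF fin i(2)]]) simp
      then show ?thesis unfolding m' single_var_mult by (simp add: mult.commute)
    qed
    then have "(\<Sum>m\<in>keys h. single m (lookup h m)) \<in> gen n mpoly_var (\<lambda>_. 1) K k"
      by (intro graded_sum[OF gg])
    then show ?thesis using poly_mapping_eq_sum_single[of h] by simp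
  qed
  ultimately show ?thesis by (auto simp: M_def)
qed

text \<open>The starting point of all exchanges. The quotient is the field in degree 0, in agreement
  with the socle degree \<open>\<Sum>i\<le>n. 1 - 1\<close>.\<close>

lemma CI_vars: "CI n mpoly_var (\<lambda>_. 1)"
  unfolding CI_def
proof (intro conjI allI impI)
  let ?Q = "gen n mpoly_var (\<lambda>_. 1) {..n}"
  show "regular n mpoly_var (\<lambda>_. 1)"
    unfolding regular_def
  proof (intro allI impI subsetI)
    fix K i k u assume K: "K \<subseteq> {..n}" and i: "i \<in> {..n} - K"
      and u: "u \<in> colon n (gen n mpoly_var (\<lambda>_. 1) K) (mpoly_var i) 1 k"
    have "keys m \<inter> K \<noteq> {}" if "m \<in> keys u" for m
    proof -
      have "single i 1 + m \<in> keys (u * mpoly_var i)"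
        using that lookup_var_mult[of i u m] by (simp add: in_keys_iff mult.commute)
      then have "keys (single i 1 + m) \<inter> K \<noteq> {}" using u K unfolding colon_def gen_vars[OF K] by blast
      then show ?thesis using i by (auto simp: keys_add_monom)
    qed
    then show "u \<in> gen n mpoly_var (\<lambda>_. 1) K k" using u K by (simp add: gen_vars colon_def)
  qed
  have full: "?Q k = homog n k" if "k \<ge> 1" for k
  proof -
    have "keys m \<inter> {..n} \<noteq> {}" if h: "h \<in> homog n k" "m \<in> keys h" for h m
    proof -
      have "m \<noteq> 0" using homog_mdeg[OF h] \<open>k \<ge> 1\<close> by auto
      then obtain i where "i \<in> keys m" by (metis poly_mapping_eqI in_keys_iff lookup_zero)
      then show ?thesis using homog_vars[OF h] by blast
    qed
    then show ?thesis by (auto simp: gen_vars)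
  qed
  have low: "?Q k = {0}" if "k \<le> 0" for k
  proof -
    have "h = 0" if h: "h \<in> homog n k" "\<forall>m\<in>keys h. keys m \<inter> {..n} \<noteq> {}" for h
    proof (rule ccontr)
      assume "h \<noteq> 0"
      then obtain m where m: "m \<in> keys h" by (metis poly_mapping_eqI in_keys_iff lookup_zero)
      then have "mdeg m = 0" using homog_mdeg[OF h(1) m] \<open>k \<le> 0\<close> by simp
      then have "m = 0" by (simp only: mdeg_eq_0_iff)
      then show False using m h by auto
    qed
    then show ?thesis by (auto simp: gen_vars)
  qed
  show "artinian n ?Q" unfolding artinian_def using full[of 1] by (intro exI[of _ 1]) auto
  fix k
  have "mpoly.qdim (soc n ?Q k) (?Q k) = (if k = 0 then 1 else 0)"
  proof -
    consider "k < 0" | "k = 0" | "k \<ge> 1" by linarith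
    then show ?thesis
    proof cases
      case 1
      then have "soc n ?Q k = {0}" using graded_0[OF CID(6)] homog_neg_degree[of k n]
        by (auto simp: soc_def full low)
      then show ?thesis using 1 mpoly.qdim_same[of "{0}"] by (simp add: low mpoly.subspace_single_0)
    next
      case 2
      have s: "soc n ?Q 0 = homog n 0"
        using homog_mult[OF mpoly_var_in_homog, of _ n _ 0] by (auto simp: soc_def full)
      have "mpoly.quotient_basis (homog n 0) {0} {1}"
      proof (rule mpoly.quotient_basisI)
        fix v assume "v \<in> homog n 0"
        then obtain c where "v = single 0 c" using homog_zero_degree by blast
        then show "\<exists>c. v - (\<Sum>b\<in>{1}. mpoly_scale (c b) b) \<in> {0}"
          by (intro exI[of _ "\<lambda>_. c"]) (simp add: mpoly_scale_def)
      qed (auto simp: mpoly.subspace_single_0)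
      then have "mpoly.qdim (homog n 0) {0} = 1"
        using mpoly.qdim_eq[of "{0}" "{1}"] by (simp add: mpoly.subspace_single_0)
      then show ?thesis using 2 s by (simp add: low)
    next
      case 3
      then have "soc n ?Q k = homog n k"
        using homog_mult[OF mpoly_var_in_homog, of _ n _ k] by (auto simp: soc_def full add.commute)
      then show ?thesis using 3 by (simp add: full mpoly.qdim_same)
    qed
  qed
  then show "mpoly.qdim (soc n ?Q k) (?Q k) = (if k = (\<Sum>i\<le>n. 1 - 1) then 1 else 0)" by simp
qed auto

subsection \<open>Hilbert functions and duality of complete intersections\<close>

lemma HF_regular:
  assumes CI: "CI n q \<delta>" and K: "K \<subseteq> {..n}" "i \<le> n" "i \<notin> K"
  shows "HF n (gen n q \<delta> K) k = HF n (gen n q \<delta> (insert i K)) k + HF n (gen n q \<delta> K) (k - \<delta> i)"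
proof -
  have "colon n (gen n q \<delta> K) (q i) (\<delta> i) (k - \<delta> i) = gen n q \<delta> K (k - \<delta> i)"
    using CID(3)[OF CI K] colon_superset[OF CID(6)[OF CI K(1)] CID(2)[OF CI K(2)]] by blast
  moreover have "finite K" using K finite_subset by blast
  ultimately show ?thesis
    using HF_adj[OF CID(6)[OF CI K(1)] CID(2)[OF CI K(2)], of k] K
    by (simp add: gen_insert HF_def)
qed

text \<open>The recursion \<open>HF_regular\<close> involves only the degrees and ends at the
  Hilbert function of \<open>S\<close>. This is how forms obtained from \<open>f\<close> are
  compared with forms obtained from \<open>fs\<close>.\<close>

lemma HF_CI_cong:
  assumes CI: "CI n q \<delta>" "CI n q' \<delta>'" and K: "K \<subseteq> {..n}" "\<And>i. i \<in> K \<Longrightarrow> \<delta> i = \<delta>' i"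
  shows "HF n (gen n q \<delta> K) k = HF n (gen n q' \<delta>' K) k"
proof -
  have "finite K" using K finite_subset by blast
  then show ?thesis
    using K
  proof (induction K arbitrary: k rule: finite_induct)
    case (insert i K)
    then have "K \<subseteq> {..n}" "i \<le> n" "i \<notin> K" by auto
    note * = HF_regular[OF CI(1) this, of k] HF_regular[OF CI(2) this, of k]
    then show ?case using insert.IH[of k] insert.IH[of "k - \<delta> i"] insert.prems by auto
  qed simp
qed

text \<open>As long as \<open>v\<close> is outside the socle, some variable keeps it nonzero in the
  quotient. Its degree cannot grow forever, and the socle lives in a single degree.\<close>

lemma CI_perfect_pairing:
  assumes CI: "CI n q \<delta>" and v: "v \<in> homog n k" "v \<notin> gen n q \<delta> {..n} k"
  shows "\<exists>w\<in>homog n ((\<Sum>i\<le>n. \<delta> i - 1) - k). v * w \<notin> gen n q \<delta> {..n} (\<Sum>i\<le>n. \<delta> i - 1)"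
proof -
  let ?Q = "gen n q \<delta> {..n}" and ?s = "\<Sum>i\<le>n. \<delta> i - 1"
  note Q = CID(6)[OF CI order_refl]
  obtain t where t: "\<And>k. k \<ge> int t \<Longrightarrow> homog n k \<subseteq> ?Q k"
    using artinian_above[OF Q CID(4)[OF CI]] by blast
  show ?thesis
    using v
  proof (induction "nat (int t - k)" arbitrary: v k rule: less_induct)
    case less
    then have kt: "k < int t" using t[of k] by force
    show ?case
    proof (cases "\<exists>j\<le>n. mpoly_var j * v \<notin> ?Q (k + 1)")
      case True
      then obtain j where j: "j \<le> n" "mpoly_var j * v \<notin> ?Q (k + 1)" by blast
      have "mpoly_var j * v \<in> homog n (k + 1)"
        by (rule homog_mult'[OF mpoly_var_in_homog[OF j(1)] less.prems(1)]) simp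
      then obtain w where w: "w \<in> homog n (?s - (k + 1))" "mpoly_var j * v * w \<notin> ?Q ?s"
        using less.hyps[of "k + 1" "mpoly_var j * v"] j kt by auto
      have "mpoly_var j * w \<in> homog n (?s - k)" by (rule homog_mult'[OF mpoly_var_in_homog[OF j(1)] w(1)]) simp
      then show ?thesis using w(2) by (intro bexI[of _ "mpoly_var j * w"]) (auto simp: ac_simps)
    next
      case False
      then have "v \<in> soc n ?Q k" using less.prems by (auto simp: soc_def)
      then have "mpoly.qdim (soc n ?Q k) (?Q k) \<noteq> 0"
        using mpoly.qdim_eq_0_iff[OF gradedD(1)[OF Q] fin_soc[OF Q]] less.prems by blast
      then have "k = ?s" using CID(5)[OF CI, of k] by (auto split: if_splits)
      then show ?thesis using less.prems by (intro bexI[of _ 1]) auto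
    qed
  qed
qed

text \<open>Both sides are ranks of multiplication by \<open>g\<close> on \<open>S/Q\<close>. For a
  coordinate \<phi> on the one-dimensional degree \<open>s\<close> part, the form
  \<open>\<phi> (u * w * g)\<close> on degrees \<open>k\<close> and \<open>k'\<close> has radical
  \<open>Q : g\<close> on either side.\<close>

lemma CI_dual_rank_le:
  assumes CI: "CI n q \<delta>" and g: "g \<in> homog n e" and s: "s = (\<Sum>i\<le>n. \<delta> i - 1)"
    and k': "k' = s - e - k"
  defines "Q \<equiv> gen n q \<delta> {..n}"
  shows "mpoly.qdim (homog n k) (colon n Q g e k) \<le> mpoly.qdim (homog n k') (colon n Q g e k')"
proof -
  note Q = CID(6)[OF CI order_refl, folded Q_def]
  note pairing = CI_perfect_pairing[OF CI, folded Q_def s]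
  \<comment> \<open>The quotient vanishes in degree \<open>s + 1\<close>, so its whole degree
    \<open>s\<close> part is socle, hence one-dimensional.\<close>
  have "u \<in> Q (s + 1)" if u: "u \<in> homog n (s + 1)" for u
  proof (rule ccontr)
    assume "u \<notin> Q (s + 1)"
    then obtain w where "w \<in> homog n (s - (s + 1))" "u * w \<notin> Q s" using pairing[OF u] by blast
    then show False using homog_neg_degree[of "s - (s + 1)" n] graded_0[OF Q] by auto
  qed
  then have "soc n Q s = homog n s"
    using homog_mult'[OF mpoly_var_in_homog, of _ n _ s "s + 1"] by (auto simp: soc_def)
  then have "mpoly.qdim (homog n s) (Q s) = 1" using CID(5)[OF CI, of s] s by (simp add: Q_def)
  then obtain w0 where w0: "w0 \<in> homog n s" "w0 \<notin> Q s"
    "\<And>v. v \<in> homog n s \<Longrightarrow> \<exists>c. v - mpoly_scale c w0 \<in> Q s"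
    using mpoly.qdim_1_coord[OF gradedD(1)[OF Q] fin_graded[OF Q], of s] by blast
  \<comment> \<open>The coordinate with respect to \<open>w0\<close>; the value chosen is unique by
    \<open>\<phi>_eq\<close>, which gives linearity.\<close>
  define \<phi> where "\<phi> v = (SOME c. v - mpoly_scale c w0 \<in> Q s)" for v
  have \<phi>: "v - mpoly_scale (\<phi> v) w0 \<in> Q s" if "v \<in> homog n s" for v
    unfolding \<phi>_def using w0(3)[OF that] by (rule someI_ex)
  have \<phi>_eq: "\<phi> v = c" if v: "v \<in> homog n s" "v - mpoly_scale c w0 \<in> Q s" for v c
  proof (rule ccontr)
    assume ne: "\<phi> v \<noteq> c"
    have "(v - mpoly_scale c w0) - (v - mpoly_scale (\<phi> v) w0) \<in> Q s"
      by (rule graded_diff[OF Q v(2) \<phi>[OF v(1)]])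
    then have "mpoly_scale (\<phi> v - c) w0 \<in> Q s" by (simp add: mpoly.scale_left_diff_distrib)
    then show False using graded_scale_iff[OF Q] ne w0(2) by simp
  qed
  have \<phi>_add: "\<phi> (u + v) = \<phi> u + \<phi> v" if "u \<in> homog n s" "v \<in> homog n s" for u v
    using graded_add[OF Q \<phi>[OF that(1)] \<phi>[OF that(2)]] that
    by (intro \<phi>_eq homog_add) (simp_all add: mpoly.scale_left_distrib algebra_simps)
  have \<phi>_scale: "\<phi> (mpoly_scale c u) = c * \<phi> u" if "u \<in> homog n s" for c u
    using graded_scale[OF Q \<phi>[OF that], of c] that
    by (intro \<phi>_eq homog_scale) (simp_all add: mpoly.scale_right_diff_distrib)
  have \<phi>_0: "\<phi> u = 0 \<longleftrightarrow> u \<in> Q s" if "u \<in> homog n s" for u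
    using \<phi>[OF that] \<phi>_eq[OF that, of 0] by auto
  have prod: "u * w * g \<in> homog n s" if "u \<in> homog n k" "w \<in> homog n k'" for u w
    using homog_mult[OF homog_mult[OF that] g] k' by (simp add: algebra_simps)
  note C = graded_colon[OF Q g]
  show ?thesis
  proof (rule mpoly.qdim_pairing_le[where \<beta> = "\<lambda>u w. \<phi> (u * w * g)"])
    show "mpoly.fin_quotient (homog n k) (colon n Q g e k)"
      "mpoly.fin_quotient (homog n k') (colon n Q g e k')"
      by (rule fin_graded[OF C])+
    show "mpoly.subspace (colon n Q g e k)" "mpoly.subspace (colon n Q g e k')"
      by (rule gradedD(1)[OF C])+
    show "colon n Q g e k' \<subseteq> homog n k'" by (auto simp: colon_def)
    show "\<phi> ((u + v) * w * g) = \<phi> (u * w * g) + \<phi> (v * w * g)"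
      if "u \<in> homog n k" "v \<in> homog n k" "w \<in> homog n k'" for u v w
      using \<phi>_add[OF prod[OF that(1,3)] prod[OF that(2,3)]] by (simp add: distrib_right)
    show "\<phi> (u * (v + w) * g) = \<phi> (u * v * g) + \<phi> (u * w * g)"
      if "u \<in> homog n k" "v \<in> homog n k'" "w \<in> homog n k'" for u v w
      using \<phi>_add[OF prod[OF that(1,2)] prod[OF that(1,3)]] by (simp add: distrib_right distrib_left)
    show "\<phi> (mpoly_scale c u * w * g) = c * \<phi> (u * w * g)"
      if "u \<in> homog n k" "w \<in> homog n k'" for c u w
      using \<phi>_scale[OF prod[OF that], of c] by (simp add: mpoly_scale_mult_left)
    show "\<phi> (u * mpoly_scale c w * g) = c * \<phi> (u * w * g)"
      if "u \<in> homog n k" "w \<in> homog n k'" for c u w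
      using \<phi>_scale[OF prod[OF that], of c]
      by (simp add: mpoly_scale_mult_left mpoly_scale_mult_right[symmetric])
    show "\<phi> (u * w * g) = 0" if u: "u \<in> homog n k" and w: "w \<in> colon n Q g e k'" for u w
    proof -
      have wg: "w * g \<in> Q (k' + e)" and wk: "w \<in> homog n k'" using w by (auto simp: colon_def)
      have "u * (w * g) \<in> Q s" by (rule graded_mult[OF Q u wg]) (simp add: k')
      then show ?thesis using \<phi>_0[OF prod[OF u wk]] by (simp add: mult.assoc)
    qed
    show "u \<in> colon n Q g e k" if u: "u \<in> homog n k" and z: "\<And>w. w \<in> homog n k' \<Longrightarrow> \<phi> (u * w * g) = 0" for u
    proof (rule ccontr)
      assume "u \<notin> colon n Q g e k"
      then have ug: "u * g \<in> homog n (k + e)" "u * g \<notin> Q (k + e)" using u g by (auto simp: colon_def homog_mult)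
      obtain w where w: "w \<in> homog n (s - (k + e))" "u * g * w \<notin> Q s" using pairing[OF ug] by blast
      then have wk: "w \<in> homog n k'" by (simp add: k' algebra_simps)
      have "u * w * g \<in> Q s" using z[OF wk] \<phi>_0[OF prod[OF u wk]] by simp
      then show False using w(2) by (simp add: ac_simps)
    qed
  qed auto
qed

lemma CI_dual_rank:
  assumes "CI n q \<delta>" "g \<in> homog n e" "k' = (\<Sum>i\<le>n. \<delta> i - 1) - e - k"
  shows "mpoly.qdim (homog n k) (colon n (gen n q \<delta> {..n}) g e k)
    = mpoly.qdim (homog n k') (colon n (gen n q \<delta> {..n}) g e k')"
  using CI_dual_rank_le[OF assms(1,2) refl assms(3)] CI_dual_rank_le[OF assms(1,2) refl, of k k'] assms(3)
  by simp

text \<open>The case \<open>g = 1\<close> of the duality of ranks, where \<open>Q : g\<close> is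
  \<open>Q\<close>.\<close>

lemma CI_HF_symmetric:
  assumes CI: "CI n q \<delta>"
  shows "HF n (gen n q \<delta> {..n}) k = HF n (gen n q \<delta> {..n}) ((\<Sum>i\<le>n. \<delta> i - 1) - k)"
proof -
  have "colon n (gen n q \<delta> {..n}) 1 0 = gen n q \<delta> {..n}"
    using gradedD(2)[OF CID(6)[OF CI order_refl]] by (auto simp: colon_def fun_eq_iff)
  then show ?thesis using CI_dual_rank[OF CI one_in_homog refl, of k] by (simp add: HF_def)
qed

subsection \<open>Generic linear combinations\<close>

lemma proj_point_scale:
  assumes "c \<noteq> 0" "\<And>i. p i = c * q i"
  shows "proj_point p = proj_point q"
proof -
  have "(\<exists>d. x = (\<lambda>i. d * p i) \<and> d \<noteq> 0) = (\<exists>d. x = (\<lambda>i. d * q i) \<and> d \<noteq> 0)" for x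
  proof
    assume "\<exists>d. x = (\<lambda>i. d * p i) \<and> d \<noteq> 0"
    then obtain d where "x = (\<lambda>i. d * p i)" "d \<noteq> 0" by blast
    then show "\<exists>d. x = (\<lambda>i. d * q i) \<and> d \<noteq> 0"
      using assms by (intro exI[of _ "d * c"]) (auto simp: fun_eq_iff)
  next
    assume "\<exists>d. x = (\<lambda>i. d * q i) \<and> d \<noteq> 0"
    then obtain d where "x = (\<lambda>i. d * q i)" "d \<noteq> 0" by blast
    then show "\<exists>d. x = (\<lambda>i. d * p i) \<and> d \<noteq> 0"
      using assms by (intro exI[of _ "d / c"]) (auto simp: fun_eq_iff)
  qed
  then show ?thesis by (simp add: proj_point_def)
qed

lemma proj_point_self: "p \<in> proj_point p"
  by (auto simp: proj_point_def intro!: exI[of _ 1])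

lemma proj_point_eqD:
  assumes "proj_point p = proj_point q"
  obtains c where "c \<noteq> 0" "\<And>i. p i = c * q i"
proof -
  have "p \<in> proj_point q" using assms proj_point_self by blast
  then show ?thesis using that by (auto simp: proj_point_def)
qed

text \<open>Nonproportional vectors have a nonzero 2 by 2 minor involving a column \<open>a\<close>
  with \<open>q a \<noteq> 0\<close>; it is the value at \<open>p\<close> of
  \<open>q_a x_b - q_b x_a\<close>, which vanishes at \<open>q\<close>.\<close>

lemma separating_linear_form:
  assumes p: "p \<in> homog_coords n" and q: "q \<in> homog_coords n" and ne: "proj_point p \<noteq> proj_point q"
  obtains l where "l \<in> homog n 1" "mpoly_eval l q = 0" "mpoly_eval l p \<noteq> 0"
proof -
  obtain a where a: "a \<le> n" "q a \<noteq> 0" using q by (auto simp: homog_coords_def)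
  have "\<exists>b\<le>n. q a * p b \<noteq> q b * p a"
  proof (rule ccontr)
    assume "\<not> ?thesis"
    then have eq: "p b = p a / q a * q b" for b
    proof (cases "b \<le> n")
      case False
      then show ?thesis using p q by (simp add: homog_coords_def)
    qed (use a in \<open>auto simp: field_simps\<close>)
    have pa: "p a \<noteq> 0"
    proof
      assume "p a = 0"
      then have "p b = 0" for b using eq[of b] by simp
      then show False using p by (auto simp: homog_coords_def)
    qed
    have "proj_point p = proj_point q"
      by (rule proj_point_scale[OF _ eq]) (use pa a in simp)
    then show False using ne by simp
  qed
  then obtain b where b: "b \<le> n" "q a * p b \<noteq> q b * p a" by blast
  let ?l = "mpoly_scale (q a) (mpoly_var b) - mpoly_scale (q b) (mpoly_var a)"
  show ?thesis
  proof (rule that[of ?l])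
    show "?l \<in> homog n 1" using a b by (intro homog_diff homog_scale) auto
  qed (use b in \<open>auto simp: eval.subst_diff eval.subst_scale eval.subst_var\<close>)
qed

text \<open>Interpolation: for \<open>C + 1\<close> distinct zeros, products of \<open>C\<close>
  separating linear forms give forms of degree \<open>C\<close> that vanish at all of them but one.
  These are independent modulo \<open>I\<close>, against the bound.\<close>

lemma finite_zeros:
  assumes I: "graded n I" and bd: "\<And>k. HF n I k \<le> C"
  shows "finite (proj_point ` {c. zero_of n I c})"
proof (rule ccontr)
  assume "infinite (proj_point ` {c. zero_of n I c})"
  then obtain X where X: "X \<subseteq> proj_point ` {c. zero_of n I c}" "finite X" "card X = Suc C"
    using infinite_arbitrarily_large by blast
  obtain Y where Y: "Y \<subseteq> {c. zero_of n I c}" "inj_on proj_point Y" "X = proj_point ` Y"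
    using X(1) by (meson subset_image_inj)
  have cY: "card Y = Suc C" and fY: "finite Y"
    using X Y card_image[OF Y(2)] finite_image_iff[OF Y(2)] by auto
  have "\<exists>l. l \<in> homog n 1 \<and> mpoly_eval l q = 0 \<and> mpoly_eval l p \<noteq> 0"
    if "p \<in> Y" "q \<in> Y" "q \<noteq> p" for p q
  proof -
    have "proj_point p \<noteq> proj_point q" using that Y(2) by (metis inj_onD)
    moreover have "p \<in> homog_coords n" "q \<in> homog_coords n" using that Y(1) by (auto simp: zero_of_def)
    ultimately show ?thesis using separating_linear_form[of p n q] by blast
  qed
  then obtain l where l: "\<And>p q. p \<in> Y \<Longrightarrow> q \<in> Y \<Longrightarrow> q \<noteq> p \<Longrightarrow>
    l p q \<in> homog n 1 \<and> mpoly_eval (l p q) q = 0 \<and> mpoly_eval (l p q) p \<noteq> 0" by metis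
  define s where "s p = (\<Prod>q\<in>Y - {p}. l p q)" for p
  have s1: "s p \<in> homog n (int C)" if "p \<in> Y" for p
  proof -
    have "s p \<in> homog n (\<Sum>q\<in>Y - {p}. 1)" unfolding s_def using l that fY by (intro homog_prod) auto
    moreover have "card (Y - {p}) = C" using cY fY that by simp
    ultimately show ?thesis by simp
  qed
  have s2: "mpoly_eval (s p) q = 0" if "p \<in> Y" "q \<in> Y" "q \<noteq> p" for p q
    unfolding s_def eval.subst_prod using l that fY by (intro prod_zero) auto
  have s3: "mpoly_eval (s p) p \<noteq> 0" if "p \<in> Y" for p
    unfolding s_def eval.subst_prod using l that fY by auto
  have "card Y \<le> mpoly.qdim (homog n (int C)) (I (int C))"
  proof (rule mpoly.qdim_ge_if_independent[OF gradedD(1)[OF I] fin_graded[OF I] fY s1])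
    fix c p assume z: "(\<Sum>p\<in>Y. mpoly_scale (c p) (s p)) \<in> I (int C)" and p: "p \<in> Y"
    have "mpoly_eval (\<Sum>p\<in>Y. mpoly_scale (c p) (s p)) p = (\<Sum>q\<in>Y. if q = p then c p * mpoly_eval (s p) p else 0)"
      unfolding eval.subst_sum by (intro sum.cong refl) (use s2 p in \<open>auto simp: eval.subst_scale\<close>)
    also have "\<dots> = c p * mpoly_eval (s p) p" using p fY by simp
    finally have "c p * mpoly_eval (s p) p = 0" using z p Y(1) by (auto simp: zero_of_def)
    then show "c p = 0" using s3[OF p] by simp
  qed
  then show False using bd[of "int C"] cY by (simp add: HF_def)
qed

text \<open>Beyond degree \<open>t\<close> multiplication by \<open>a\<close> is onto, so values
  there are dominated by values in lower degrees, and only the degrees from 0 to \<open>t\<close>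
  matter.\<close>

lemma HF_bounded:
  assumes I: "graded n I" and a: "a \<in> homog n \<alpha>" "\<alpha> \<ge> 1" and art: "artinian n (adj n I a \<alpha>)"
  obtains C where "\<And>k. HF n I k \<le> C"
proof -
  obtain t where t: "\<And>k. k \<ge> int t \<Longrightarrow> homog n k \<subseteq> adj n I a \<alpha> k"
    using artinian_above[OF graded_adj[OF I a(1)] art] by blast
  define C where "C = Max ((\<lambda>k. HF n I k) ` {0..int t})"
  have "HF n I k \<le> C" for k
  proof (induction "nat (k + 1)" arbitrary: k rule: less_induct)
    case less
    consider "k < 0" | "0 \<le> k" "k \<le> int t" | "k > int t" by linarith
    then show ?case
    proof cases
      case 1
      then have "HF n I k = 0" using HF_0_iff[OF I, of k] graded_0[OF I] homog_neg_degree by simp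
      then show ?thesis by simp
    next
      case 2
      then show ?thesis unfolding C_def by (intro Max_ge) auto
    next
      case 3
      then have "HF n (adj n I a \<alpha>) k = 0" using HF_0_iff[OF graded_adj[OF I a(1)]] t[of k] by simp
      then have "HF n I k \<le> HF n I (k - \<alpha>)" using HF_adj[OF I a(1), of k] qdim_colon_le[OF I a(1)] by simp
      also have "\<dots> \<le> C" using 3 a(2) by (intro less.hyps) auto
      finally show ?thesis .
    qed
  qed
  then show ?thesis by (rule that)
qed

text \<open>The coefficients run along the curve \<open>(1, t, ..., t ^ n)\<close>: at a point where
  some \<open>G i\<close> is nonzero, the value is a nonzero polynomial in the single parameter
  \<open>t\<close>.\<close>

definition power_comb :: "nat \<Rightarrow> (nat \<Rightarrow> mpoly) \<Rightarrow> complex \<Rightarrow> mpoly" where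
  "power_comb n G t = (\<Sum>i\<le>n. mpoly_scale (t ^ i) (G i))"

lemma power_comb_homog: "(\<And>i. i \<le> n \<Longrightarrow> G i \<in> homog n e) \<Longrightarrow> power_comb n G t \<in> homog n e"
  unfolding power_comb_def by (intro homog_sum homog_scale) auto

text \<open>Finitely many points exclude finitely many parameters. The condition
  \<open>t \<noteq> 0\<close> is imposed so that a replaced \<open>G j\<close> can later be
  recovered from the combination.\<close>

lemma generic_power_comb:
  assumes fin: "finite (proj_point ` Z)" and G: "\<And>i. i \<le> n \<Longrightarrow> G i \<in> homog n e" "e \<ge> 0"
    and nz: "\<And>p. p \<in> Z \<Longrightarrow> \<exists>i\<le>n. mpoly_eval (G i) p \<noteq> 0"
  obtains t where "t \<noteq> 0" "\<And>p. p \<in> Z \<Longrightarrow> mpoly_eval (power_comb n G t) p \<noteq> 0"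
proof -
  obtain Y where Y: "Y \<subseteq> Z" "finite Y" "proj_point ` Z = proj_point ` Y"
    using finite_subset_image[OF fin, of proj_point Z] by blast
  define P where "P p = (\<Sum>i\<le>n. Polynomial.monom (mpoly_eval (G i) p) i)" for p
  have cP: "poly.coeff (P p) i = (if i \<le> n then mpoly_eval (G i) p else 0)" for p i
    by (simp add: P_def coeff_sum)
  have ev: "poly (P p) t = mpoly_eval (power_comb n G t) p" for p t
    by (simp add: P_def power_comb_def poly_sum poly_monom eval.subst_sum eval.subst_scale mult.commute)
  have "P p \<noteq> 0" if "p \<in> Y" for p using nz[of p] that Y(1) cP[of p] by (metis coeff_0 subsetD)
  then have "finite (\<Union>p\<in>Y. {t. poly (P p) t = 0})" using Y(2) by (intro finite_UN_I poly_roots_finite)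
  then have "finite (insert 0 (\<Union>p\<in>Y. {t. poly (P p) t = 0}))" by simp
  then obtain t where t: "t \<notin> insert 0 (\<Union>p\<in>Y. {t. poly (P p) t = 0})"
    using ex_new_if_finite[OF infinite_UNIV_char_0] by blast
  show ?thesis
  proof (rule that)
    show "t \<noteq> 0" using t by simp
    fix p assume "p \<in> Z"
    then obtain y where y: "y \<in> Y" "proj_point p = proj_point y" using Y(3) by (metis (no_types, lifting) imageE imageI)
    obtain c where c: "c \<noteq> 0" "\<And>i. p i = c * y i" using proj_point_eqD[OF y(2)] by blast
    have "mpoly_eval (power_comb n G t) p = c ^ nat e * mpoly_eval (power_comb n G t) y"
      using c by (intro eval_homog[OF power_comb_homog[OF G(1)]] G(2)) auto
    then show "mpoly_eval (power_comb n G t) p \<noteq> 0" using c t y(1) by (auto simp flip: ev)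
  qed
qed

lemma zero_of_gen:
  assumes "finite K" "zero_of n (gen n q \<delta> K) c" "i \<in> K"
  shows "mpoly_eval (q i) c = 0"
  using assms gen_mem[of K i q n \<delta>] by (auto simp: zero_of_def)

lemma gen_eval_zero:
  assumes "u \<in> gen n q \<delta> K k" "\<And>i. i \<in> K \<Longrightarrow> mpoly_eval (q i) c = 0"
  shows "mpoly_eval u c = 0"
  using assms by (auto simp: gen_def eval.subst_sum eval.subst_mult)

text \<open>The Nullstellensatz for \<open>h = 1\<close>: avoiding 1 means that no degree is
  full.\<close>

lemma artinian_if_no_zeros:
  assumes I: "graded n I" and no: "\<And>c. \<not> zero_of n I c"
  shows "artinian n I"
proof (rule ccontr)
  assume "\<not> artinian n I"
  then have "avoids n 1 0 I" by (auto simp: artinian_def avoids_def)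
  then show False using nullstellensatz[OF I one_in_homog] no by auto
qed

text \<open>The members other than \<open>q j\<close> have finitely many common zeros, since one
  more form makes the quotient finite-dimensional. A generic combination of the \<open>G i\<close>
  misses them all, so the new sequence has no common zero.\<close>

lemma CI_step:
  assumes CI: "CI n q \<delta>" and j: "j \<le> n" and G: "\<And>i. i \<le> n \<Longrightarrow> G i \<in> homog n e" "e \<ge> 1"
    and nz: "\<And>p. p \<in> homog_coords n \<Longrightarrow> (\<And>i. i \<le> n \<Longrightarrow> i \<noteq> j \<Longrightarrow> mpoly_eval (q i) p = 0) \<Longrightarrow>
      \<exists>i\<le>n. mpoly_eval (G i) p \<noteq> 0"
  obtains t where "t \<noteq> 0" "CI n (q(j := power_comb n G t)) (\<delta>(j := e))"
proof -
  define L where "L = {..n} - {j}"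
  have L: "insert j L = {..n}" "j \<notin> L" "L \<subseteq> {..n}" "finite L" using j by (auto simp: L_def)
  note I = CID(6)[OF CI L(3)]
  have "artinian n (adj n (gen n q \<delta> L) (q j) (\<delta> j))"
    using CID(4)[OF CI] gen_insert[OF L(4,2), of n q \<delta>] by (simp add: L(1))
  then obtain C where "\<And>k. HF n (gen n q \<delta> L) k \<le> C"
    using HF_bounded[OF I CID(2)[OF CI j] CID(1)[OF CI j]] by blast
  then have fin: "finite (proj_point ` {c. zero_of n (gen n q \<delta> L) c})" by (rule finite_zeros[OF I])
  obtain t where t: "t \<noteq> 0" "\<And>p. p \<in> {c. zero_of n (gen n q \<delta> L) c} \<Longrightarrow> mpoly_eval (power_comb n G t) p \<noteq> 0"
  proof (rule generic_power_comb[OF fin G(1)])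
    fix p assume "p \<in> {c. zero_of n (gen n q \<delta> L) c}"
    then have p: "zero_of n (gen n q \<delta> L) p" by simp
    show "\<exists>i\<le>n. mpoly_eval (G i) p \<noteq> 0"
    proof (rule nz)
      show "p \<in> homog_coords n" using p by (simp add: zero_of_def)
      show "mpoly_eval (q i) p = 0" if "i \<le> n" "i \<noteq> j" for i
        using that by (intro zero_of_gen[OF L(4) p]) (auto simp: L_def)
    qed
  qed (use G in auto)
  let ?b = "power_comb n G t"
  have b: "?b \<in> homog n e" by (rule power_comb_homog[OF G(1)])
  have full: "gen n (q(j := ?b)) (\<delta>(j := e)) {..n} = adj n (gen n q \<delta> L) ?b e"
  proof -
    have "gen n (q(j := ?b)) (\<delta>(j := e)) L = gen n q \<delta> L" using L(2) by (intro gen_cong) auto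
    then show ?thesis using gen_insert[OF L(4,2), of n "q(j := ?b)" "\<delta>(j := e)"] by (simp add: L(1))
  qed
  have "artinian n (adj n (gen n q \<delta> L) ?b e)"
  proof (rule artinian_if_no_zeros[OF graded_adj[OF I b]])
    fix c show "\<not> zero_of n (adj n (gen n q \<delta> L) ?b e) c"
    proof
      assume z: "zero_of n (adj n (gen n q \<delta> L) ?b e) c"
      then have "zero_of n (gen n q \<delta> L) c"
        using adj_superset[of _ "gen n q \<delta> L" _ n ?b e] unfolding zero_of_def by blast
      then have "mpoly_eval ?b c \<noteq> 0" using t(2) by simp
      moreover have "1 * ?b \<in> adj n (gen n q \<delta> L) ?b e e" by (rule adj_gen[OF I]) simp
      ultimately show False using z by (auto simp: zero_of_def)
    qed
  qed
  then have "CI n (q(j := ?b)) (\<delta>(j := e))"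
    by (intro CI_exchange[OF CI j b G(2)]) (simp add: full)
  with t(1) show ?thesis by (rule that)
qed

text \<open>The replaced generator is recovered because its coefficient \<open>t ^ j\<close> is
  nonzero.\<close>

lemma gen_power_comb:
  assumes G: "\<And>i. i \<le> n \<Longrightarrow> G i \<in> homog n e" and j: "j \<le> n" and t: "t \<noteq> 0"
  shows "gen n (G(j := power_comb n G t)) (\<lambda>_. e) {..n} = gen n G (\<lambda>_. e) {..n}"
proof -
  let ?b = "power_comb n G t"
  let ?G = "G(j := ?b)"
  have G': "?G i \<in> homog n e" if "i \<le> n" for i using G that power_comb_homog[OF G] by auto
  note g = graded_gen[of "{..n}" G n "\<lambda>_. e"] and g' = graded_gen[of "{..n}" ?G n "\<lambda>_. e"]
  have I: "graded n (gen n G (\<lambda>_. e) {..n})" using G by (intro g) auto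
  have I': "graded n (gen n ?G (\<lambda>_. e) {..n})" using G' by (intro g') auto
  have mem: "G i \<in> gen n G (\<lambda>_. e) {..n} e" if "i \<le> n" for i using gen_mem[of "{..n}" i G n "\<lambda>_. e"] that by simp
  have mem': "?G i \<in> gen n ?G (\<lambda>_. e) {..n} e" if "i \<le> n" for i using gen_mem[of "{..n}" i ?G n "\<lambda>_. e"] that by simp
  have "?b \<in> gen n G (\<lambda>_. e) {..n} e"
    unfolding power_comb_def using mem by (intro graded_sum[OF I] graded_scale[OF I]) auto
  then have 1: "?G i \<in> gen n G (\<lambda>_. e) {..n} e" if "i \<le> n" for i using mem that by auto
  have other: "G i \<in> gen n ?G (\<lambda>_. e) {..n} e" if "i \<le> n" "i \<noteq> j" for i using mem'[of i] that by simp
  have "?b = mpoly_scale (t ^ j) (G j) + (\<Sum>i\<in>{..n} - {j}. mpoly_scale (t ^ i) (G i))"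
    unfolding power_comb_def using j by (subst sum.remove[of _ j]) auto
  moreover have "?b \<in> gen n ?G (\<lambda>_. e) {..n} e" using mem'[OF j] by simp
  moreover have "(\<Sum>i\<in>{..n} - {j}. mpoly_scale (t ^ i) (G i)) \<in> gen n ?G (\<lambda>_. e) {..n} e"
    using other by (intro graded_sum[OF I'] graded_scale[OF I']) auto
  ultimately have "mpoly_scale (t ^ j) (G j) \<in> gen n ?G (\<lambda>_. e) {..n} e"
    using graded_diff[OF I', of ?b e "\<Sum>i\<in>{..n} - {j}. mpoly_scale (t ^ i) (G i)"] by simp
  then have "G j \<in> gen n ?G (\<lambda>_. e) {..n} e" using graded_scale_iff[OF I'] t by simp
  then have 2: "G i \<in> gen n ?G (\<lambda>_. e) {..n} e" if "i \<le> n" for i using other that by (cases "i = j") auto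
  show ?thesis
  proof (rule ext, rule equalityI; rule subsetI)
    fix k u assume "u \<in> gen n ?G (\<lambda>_. e) {..n} k"
    then show "u \<in> gen n G (\<lambda>_. e) {..n} k" by (rule gen_least[OF I, rotated]) (use 1 in auto)
  next
    fix k u assume "u \<in> gen n G (\<lambda>_. e) {..n} k"
    then show "u \<in> gen n ?G (\<lambda>_. e) {..n} k" by (rule gen_least[OF I', rotated]) (use 2 in auto)
  qed
qed

text \<open>Each step replaces one generator by a combination of the current ones, so the ideal
  generated by all of \<open>G\<close> stays that of \<open>F\<close>. Used with
  \<open>m = n\<close>, where the last member is a linear form to be kept, and with
  \<open>m = n + 1\<close> for forms without common zeros.\<close>

lemma CI_path:
  assumes CI: "CI n q \<delta>" and m: "m \<le> Suc n" and F: "\<And>i. i \<le> n \<Longrightarrow> F i \<in> homog n e" "e \<ge> 1"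
    and nz: "\<And>p. p \<in> homog_coords n \<Longrightarrow> (\<And>i. m \<le> i \<Longrightarrow> i \<le> n \<Longrightarrow> mpoly_eval (q i) p = 0) \<Longrightarrow>
      \<exists>i\<le>n. mpoly_eval (F i) p \<noteq> 0"
  obtains G where "\<And>i. i \<le> n \<Longrightarrow> G i \<in> homog n e" "gen n G (\<lambda>_. e) {..n} = gen n F (\<lambda>_. e) {..n}"
    "CI n (\<lambda>i. if i < m then G i else q i) (\<lambda>i. if i < m then e else \<delta> i)"
proof -
  have "\<exists>G. (\<forall>i\<le>n. G i \<in> homog n e) \<and> gen n G (\<lambda>_. e) {..n} = gen n F (\<lambda>_. e) {..n} \<and>
    CI n (\<lambda>i. if i < j then G i else q i) (\<lambda>i. if i < j then e else \<delta> i)" if "j \<le> m" for j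
    using that
  proof (induction j)
    case 0
    then show ?case using F CI by (intro exI[of _ F]) auto
  next
    case (Suc j)
    then obtain G where G: "\<And>i. i \<le> n \<Longrightarrow> G i \<in> homog n e" "gen n G (\<lambda>_. e) {..n} = gen n F (\<lambda>_. e) {..n}"
      and CI': "CI n (\<lambda>i. if i < j then G i else q i) (\<lambda>i. if i < j then e else \<delta> i)" by auto
    have j: "j \<le> n" using Suc.prems m by simp
    obtain t where t: "t \<noteq> 0" "CI n ((\<lambda>i. if i < j then G i else q i)(j := power_comb n G t))
       ((\<lambda>i. if i < j then e else \<delta> i)(j := e))"
    proof (rule CI_step[OF CI' j G(1) F(2)])
      fix p assume p: "p \<in> homog_coords n"
        and z: "\<And>i. i \<le> n \<Longrightarrow> i \<noteq> j \<Longrightarrow> mpoly_eval (if i < j then G i else q i) p = 0"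
      have "mpoly_eval (q i) p = 0" if "m \<le> i" "i \<le> n" for i
        using z[of i] that Suc.prems by auto
      then obtain i where i: "i \<le> n" "mpoly_eval (F i) p \<noteq> 0" using nz[OF p] by blast
      show "\<exists>i\<le>n. mpoly_eval (G i) p \<noteq> 0"
      proof (rule ccontr)
        assume no: "\<not> ?thesis"
        have "F i \<in> gen n G (\<lambda>_. e) {..n} e"
          using gen_mem[of "{..n}" i F n "\<lambda>_. e"] i G(2) by simp
        then have "mpoly_eval (F i) p = 0" by (rule gen_eval_zero) (use no in auto)
        then show False using i by simp
      qed
    qed auto
    let ?G = "G(j := power_comb n G t)"
    have "(\<lambda>i. if i < Suc j then ?G i else q i) = (\<lambda>i. if i < j then G i else q i)(j := power_comb n G t)"
      "(\<lambda>i. if i < Suc j then e else \<delta> i) = (\<lambda>i. if i < j then e else \<delta> i)(j := e)"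
      by (auto simp: fun_eq_iff)
    moreover have "gen n ?G (\<lambda>_. e) {..n} = gen n F (\<lambda>_. e) {..n}"
      using gen_power_comb[OF G(1) j t(1)] G(2) by simp
    moreover have "\<forall>i\<le>n. ?G i \<in> homog n e" using G(1) power_comb_homog[OF G(1)] by auto
    ultimately show ?case using t(2) by (intro exI[of _ ?G] conjI) (simp_all only:)
  qed
  from this[OF order_refl] show ?thesis using that by blast
qed

subsection \<open>Stabilization and saturation\<close>

lemma artinian_no_zero:
  assumes "artinian n I"
  shows "\<not> zero_of n I c"
proof
  assume z: "zero_of n I c"
  then obtain i where i: "i \<le> n" "c i \<noteq> 0" by (auto simp: zero_of_def homog_coords_def)
  obtain t where "homog n (int t) \<subseteq> I (int t)" using assms by (auto simp: artinian_def)
  then have "mpoly_var i ^ t \<in> I (int t)" using homog_power[OF mpoly_var_in_homog[OF i(1)], of t] by auto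
  then have "mpoly_eval (mpoly_var i ^ t) c = 0" using z by (auto simp: zero_of_def)
  then show False using i by (simp add: eval.subst_power eval.subst_var)
qed

text \<open>Multiplication by \<open>l\<close> is eventually onto, so the Hilbert function decreases
  to its minimum; where it is constant, these surjections are bijective.\<close>

lemma eventually_stable:
  assumes I: "graded n I" and l: "l \<in> homog n 1" and art: "artinian n (adj n I l 1)"
  obtains K \<tau> where "K \<ge> 0" "\<And>k. k \<ge> K \<Longrightarrow> HF n I k = \<tau>" "\<And>k. k \<ge> K \<Longrightarrow> colon n I l 1 k \<subseteq> I k"
proof -
  obtain t where t: "\<And>k. k \<ge> int t \<Longrightarrow> homog n k \<subseteq> adj n I l 1 k"
    using artinian_above[OF graded_adj[OF I l] art] by blast
  have dec: "HF n I (k + 1) \<le> HF n I k" if "k \<ge> int t" for k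
    using HF_decreasing[OF I l t[of "k + 1"]] that by simp
  have dec': "HF n I (k + int i) \<le> HF n I k" if "k \<ge> int t" for k i
  proof (induction i)
    case (Suc i)
    then show ?case using dec[of "k + int i"] that by (simp add: algebra_simps)
  qed simp
  obtain K where K: "K \<ge> int t" "\<And>k. k \<ge> int t \<Longrightarrow> HF n I K \<le> HF n I k"
    using ex_has_least_nat[of "\<lambda>k. k \<ge> int t" "int t" "HF n I"] by auto
  have st: "HF n I k = HF n I K" if "k \<ge> K" for k
    using dec'[of K "nat (k - K)"] K that by (intro antisym) auto
  show ?thesis
  proof (rule that[OF _ st])
    fix k assume k: "K \<le> k"
    have "HF n (adj n I l 1) (k + 1) = 0" using HF_0_iff[OF graded_adj[OF I l]] t[of "k + 1"] k K(1) by simp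
    then have "HF n I (k + 1) = mpoly.qdim (homog n k) (colon n I l 1 k)" using HF_adj[OF I l, of "k + 1"] by simp
    then have "mpoly.qdim (colon n I l 1 k) (I k) = 0"
      using HF_colon[OF I l, of k] st[of k] st[of "k + 1"] k by simp
    then show "colon n I l 1 k \<subseteq> I k" by (rule colon_subset_if_qdim_0[OF I l])
  qed (use K in auto)
qed

lemma stable_descend:
  assumes I: "graded n I" and l: "l \<in> homog n 1" and st: "\<And>k. k \<ge> K \<Longrightarrow> colon n I l 1 k \<subseteq> I k"
    and u: "u \<in> homog n k" "k \<ge> K" "l ^ N * u \<in> I (int N + k)"
  shows "u \<in> I k"
  using u(3)
proof (induction N)
  case (Suc N)
  have 1: "l ^ N * u \<in> homog n (int N + k)" using homog_mult[OF homog_power[OF l, of N] u(1)] by simp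
  have "l ^ N * u * l \<in> I (int N + k + 1)" using Suc.prems by (simp add: algebra_simps)
  then have "l ^ N * u \<in> I (int N + k)" using u(2) by (intro colonD[OF st 1]) auto
  then show ?case by (rule Suc.IH)
qed simp

text \<open>The degree \<open>k\<close> component of the saturation, tested on all forms of degree
  \<open>r\<close> instead of on powers of the irrelevant ideal; \<open>r\<close> may depend on
  \<open>h\<close>.\<close>

definition satd :: "nat \<Rightarrow> (int \<Rightarrow> mpoly set) \<Rightarrow> int \<Rightarrow> mpoly set" where
  "satd n I k = {h \<in> homog n k. \<exists>r. \<forall>v\<in>homog n (int r). v * h \<in> I (k + int r)}"

text \<open>One exponent \<open>r\<close> serves all \<open>h\<close> in all degrees: in nonnegative
  degree \<open>l ^ r * h\<close> reaches the range where \<open>l\<close> is injective modulo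
  \<open>I\<close>, so a further factor \<open>l ^ r'\<close> can be removed. Conversely,
  \<open>I + (l ^ r)\<close> contains all forms of some degree.\<close>

lemma satd_eq_colon:
  assumes I: "graded n I" and l: "l \<in> homog n 1" and K: "K \<ge> 0"
    and st: "\<And>k. k \<ge> K \<Longrightarrow> colon n I l 1 k \<subseteq> I k"
    and r: "int r \<ge> K" and art: "artinian n (adj n I (l ^ r) (int r))"
  shows "satd n I k = colon n I (l ^ r) (int r) k"
proof
  have lr: "l ^ i \<in> homog n (int i)" for i using homog_power[OF l, of i] by simp
  show "satd n I k \<subseteq> colon n I (l ^ r) (int r) k"
  proof
    fix h assume h: "h \<in> satd n I k"
    then have hk: "h \<in> homog n k" by (simp add: satd_def)
    obtain r' where r': "\<And>v. v \<in> homog n (int r') \<Longrightarrow> v * h \<in> I (k + int r')" using h by (auto simp: satd_def)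
    have lh: "l ^ r' * h \<in> I (k + int r')" by (rule r'[OF lr])
    have "l ^ r * h \<in> I (int r + k)"
    proof (cases "k < 0")
      case True
      then show ?thesis using hk graded_0[OF I] by (simp add: homog_neg_degree)
    next
      case False
      have "l ^ r' * (l ^ r * h) = l ^ r * (l ^ r' * h)" by (simp add: ac_simps)
      also have "\<dots> \<in> I (int r' + (int r + k))" by (rule graded_mult[OF I lr lh]) simp
      finally have 1: "l ^ r' * (l ^ r * h) \<in> I (int r' + (int r + k))" .
      show ?thesis
        by (rule stable_descend[OF I l st homog_mult[OF lr[of r] hk] _ 1]) (use False r in auto)
    qed
    then show "h \<in> colon n I (l ^ r) (int r) k" using hk by (simp add: colon_def ac_simps)
  qed
  show "colon n I (l ^ r) (int r) k \<subseteq> satd n I k"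
  proof
    fix h assume "h \<in> colon n I (l ^ r) (int r) k"
    then have h: "h \<in> homog n k" "h * l ^ r \<in> I (k + int r)" by (auto simp: colon_def)
    obtain t where t: "homog n (int t) \<subseteq> adj n I (l ^ r) (int r) (int t)" using art by (auto simp: artinian_def)
    have "v * h \<in> I (k + int t)" if "v \<in> homog n (int t)" for v
    proof -
      have v: "v \<in> adj n I (l ^ r) (int r) (int t)" using t that by blast
      obtain p w where pw: "v = p + w * l ^ r" "p \<in> I (int t)" "w \<in> homog n (int t - int r)"
        using v by (auto simp: adj_def)
      have "h * p \<in> I (k + int t)" by (rule graded_mult[OF I h(1) pw(2)]) simp
      moreover have "w * (h * l ^ r) \<in> I (k + int t)" by (rule graded_mult[OF I pw(3) h(2)]) simp
      ultimately have "h * p + w * (h * l ^ r) \<in> I (k + int t)" by (rule graded_add[OF I])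
      then show ?thesis by (simp add: pw(1) algebra_simps)
    qed
    then show "h \<in> satd n I k" using h(1) by (auto simp: satd_def)
  qed
qed

lemma adj_commute: "adj n (adj n I a \<alpha>) b \<beta> = adj n (adj n I b \<beta>) a \<alpha>"
proof -
  have "adj n (adj n I a \<alpha>) b \<beta> k \<subseteq> adj n (adj n I b \<beta>) a \<alpha> k" for I a \<alpha> b \<beta> k
  proof
    fix x assume "x \<in> adj n (adj n I a \<alpha>) b \<beta> k"
    then obtain u v w where "x = (u + v * a) + w * b" "u \<in> I k" "v \<in> homog n (k - \<alpha>)" "w \<in> homog n (k - \<beta>)"
      by (auto simp: adj_def)
    moreover have "(u + v * a) + w * b = (u + w * b) + v * a" by (simp add: algebra_simps)
    ultimately show "x \<in> adj n (adj n I b \<beta>) a \<alpha> k" unfolding adj_def by blast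
  qed
  then show ?thesis by (intro ext equalityI)
qed

lemma CI_cong:
  assumes CI: "CI n q \<delta>" and eq: "\<And>i. i \<le> n \<Longrightarrow> q i = q' i \<and> \<delta> i = \<delta>' i"
  shows "CI n q' \<delta>'"
proof -
  have g: "gen n q' \<delta>' K = gen n q \<delta> K" if "K \<subseteq> {..n}" for K
    using that eq by (intro gen_cong) auto
  have "(\<Sum>i\<le>n. \<delta>' i - 1) = (\<Sum>i\<le>n. \<delta> i - 1)" using eq by (intro sum.cong) auto
  moreover have "regular n q' \<delta>'"
    unfolding regular_def
  proof (intro allI impI)
    fix K i k assume K: "K \<subseteq> {..n}" and i: "i \<in> {..n} - K"
    then show "colon n (gen n q' \<delta>' K) (q' i) (\<delta>' i) k \<subseteq> gen n q' \<delta>' K k"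
      using CID(3)[OF CI K, of i k] eq[of i] by (simp add: g[OF K])
  qed
  moreover have "\<forall>i\<le>n. 1 \<le> \<delta>' i \<and> q' i \<in> homog n (\<delta>' i)" using CID(1,2)[OF CI] eq by metis
  ultimately show ?thesis using CID(4,5)[OF CI] unfolding CI_def by (simp add: g)
qed

text \<open>Two generic choices are made: the coefficients of \<open>l\<close> and the combinations
  \<open>G\<close>. As no common zero of the \<open>F i\<close> lies on the hyperplane of
  \<open>l\<close>, the exchanges can keep \<open>l\<close> in the last place.\<close>

lemma generic_hyperplane:
  assumes e: "e \<ge> 1" and F: "\<And>i. i \<le> n \<Longrightarrow> F i \<in> homog n e"
    and fin: "finite (proj_point ` {c. zero_of n (gen n F (\<lambda>_. e) {..n}) c})"
  obtains l G where "l \<in> homog n 1" "\<And>c. zero_of n (gen n F (\<lambda>_. e) {..n}) c \<Longrightarrow> mpoly_eval l c \<noteq> 0"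
    "\<And>i. i \<le> n \<Longrightarrow> G i \<in> homog n e" "gen n G (\<lambda>_. e) {..n} = gen n F (\<lambda>_. e) {..n}"
    "CI n (\<lambda>i. if i < n then G i else l) (\<lambda>i. if i < n then e else 1)"
proof -
  have hom: "mpoly_var i \<in> homog n 1" if "i \<le> n" for i using that by simp
  obtain t where t: "t \<noteq> 0" "\<And>c. c \<in> {c. zero_of n (gen n F (\<lambda>_. e) {..n}) c} \<Longrightarrow>
      mpoly_eval (power_comb n mpoly_var t) c \<noteq> 0"
    by (rule generic_power_comb[OF fin hom])
      (auto simp: eval.subst_var zero_of_def homog_coords_def)
  define l where "l = power_comb n mpoly_var t"
  have l: "l \<in> homog n 1" unfolding l_def by (rule power_comb_homog) simp
  let ?q = "mpoly_var(n := l)" and ?d = "(\<lambda>_. 1)(n := 1)"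
  have CIl: "CI n ?q ?d"
  proof (rule CI_exchange[OF CI_vars order_refl l])
    show "artinian n (gen n ?q ?d {..n})"
    proof (rule artinian_if_no_zeros)
      show "graded n (gen n ?q ?d {..n})" using l by (intro graded_gen) auto
      fix c show "\<not> zero_of n (gen n ?q ?d {..n}) c"
      proof
        assume z: "zero_of n (gen n ?q ?d {..n}) c"
        have zi: "mpoly_eval (?q i) c = 0" if "i \<le> n" for i
          using that by (intro zero_of_gen[OF _ z]) auto
        then have ci: "c i = 0" if "i < n" for i using that zi[of i] by (simp add: eval.subst_var)
        \<comment> \<open>The coefficient of the last variable in \<open>l\<close> is
          \<open>t ^ n \<noteq> 0\<close>, so \<open>x_0, ..., x_(n-1), l\<close> have only the
          trivial common zero.\<close>
        have "mpoly_eval l c = (\<Sum>i\<le>n. t ^ i * c i)"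
          by (simp add: l_def power_comb_def eval.subst_sum eval.subst_scale eval.subst_var)
        also have "\<dots> = (\<Sum>i\<in>{n}. t ^ i * c i)" using ci by (intro sum.mono_neutral_right) auto
        finally have "t ^ n * c n = 0" using zi[of n] by simp
        then have "c n = 0" using t(1) by simp
        then have "c i = 0" if "i \<le> n" for i using ci that by (cases "i = n") auto
        then show False using z by (auto simp: zero_of_def homog_coords_def)
      qed
    qed
  qed simp
  obtain G where G: "\<And>i. i \<le> n \<Longrightarrow> G i \<in> homog n e" "gen n G (\<lambda>_. e) {..n} = gen n F (\<lambda>_. e) {..n}"
    "CI n (\<lambda>i. if i < n then G i else ?q i) (\<lambda>i. if i < n then e else ?d i)"
  proof (rule CI_path[OF CIl, of n F e])
    fix p assume p: "p \<in> homog_coords n" and "\<And>i. n \<le> i \<Longrightarrow> i \<le> n \<Longrightarrow> mpoly_eval (?q i) p = 0"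
    then have lp: "mpoly_eval l p = 0" by (metis fun_upd_same order_refl)
    show "\<exists>i\<le>n. mpoly_eval (F i) p \<noteq> 0"
    proof (rule ccontr)
      assume "\<not> ?thesis"
      then have "zero_of n (gen n F (\<lambda>_. e) {..n}) p"
        using p gen_eval_zero[of _ n F "\<lambda>_. e" "{..n}" _ p] by (auto simp: zero_of_def)
      then show False using t(2) lp by (simp add: l_def)
    qed
  qed (use e F in auto)
  have "CI n (\<lambda>i. if i < n then G i else l) (\<lambda>i. if i < n then e else 1)"
    by (rule CI_cong[OF G(3)]) auto
  with l t(2) G(1,2) show ?thesis unfolding l_def by (intro that) auto
qed

theorem defect_formula:
  assumes e: "e \<ge> 1" and F: "\<And>i. i \<le> n \<Longrightarrow> F i \<in> homog n e"
    and fin: "finite (proj_point ` {c. zero_of n (gen n F (\<lambda>_. e) {..n}) c})"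
    and Fs: "\<And>i. i \<le> n \<Longrightarrow> Fs i \<in> homog n e"
    and no: "\<And>p. p \<in> homog_coords n \<Longrightarrow> \<exists>i\<le>n. mpoly_eval (Fs i) p \<noteq> 0"
  defines "J \<equiv> gen n F (\<lambda>_. e) {..n}" and "Js \<equiv> gen n Fs (\<lambda>_. e) {..n}"
  obtains l K \<tau> where "l \<in> homog n 1" "\<And>c. zero_of n J c \<Longrightarrow> mpoly_eval l c \<noteq> 0"
    "artinian n (adj n J l 1)" "K \<ge> 0" "\<And>k. k \<ge> K \<Longrightarrow> colon n J l 1 k \<subseteq> J k"
    "\<And>k. k \<ge> K \<Longrightarrow> HF n J k = \<tau>"
    "\<And>k. HF n J ((int n + 1) * (e - 1) - k) + HF n J k = HF n Js k + \<tau> + mpoly.qdim (satd n J k) (J k)"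
proof -
  obtain l G where l: "l \<in> homog n 1" "\<And>c. zero_of n J c \<Longrightarrow> mpoly_eval l c \<noteq> 0"
    and G: "\<And>i. i \<le> n \<Longrightarrow> G i \<in> homog n e" "gen n G (\<lambda>_. e) {..n} = J"
    and CIl: "CI n (\<lambda>i. if i < n then G i else l) (\<lambda>i. if i < n then e else 1)"
  proof (rule generic_hyperplane[OF e F fin])
    fix l G
    assume "l \<in> homog n 1" "\<And>c. zero_of n (gen n F (\<lambda>_. e) {..n}) c \<Longrightarrow> mpoly_eval l c \<noteq> 0"
      "\<And>i. i \<le> n \<Longrightarrow> G i \<in> homog n e" "gen n G (\<lambda>_. e) {..n} = gen n F (\<lambda>_. e) {..n}"
      "CI n (\<lambda>i. if i < n then G i else l) (\<lambda>i. if i < n then e else 1)"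
    then show thesis by (intro that[of l G]) (simp_all add: J_def)
  qed
  have J: "graded n J" unfolding J_def using F by (intro graded_gen) auto
  \<comment> \<open>The common part of several ideals: adding \<open>G n\<close> gives
    \<open>J\<close>, while adding \<open>l\<close> or a power of it gives a complete
    intersection.\<close>
  define A where "A = gen n G (\<lambda>_. e) {..<n}"
  have A_eq: "gen n (\<lambda>i. if i < n then G i else b) (\<lambda>i. if i < n then e else \<beta>) {..<n} = A" for b \<beta>
    unfolding A_def by (intro gen_cong) auto
  have ins: "{..n} = insert n {..<n}" by auto
  have full: "gen n (\<lambda>i. if i < n then G i else b) (\<lambda>i. if i < n then e else \<beta>) {..n} = adj n A b \<beta>" for b \<beta>
    unfolding ins by (subst gen_insert) (auto simp: A_eq)
  have JA: "J = adj n A (G n) e" unfolding G(2)[symmetric] A_def ins by (subst gen_insert) auto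
  have A: "graded n A" unfolding A_def using G(1) by (intro graded_gen) auto
  have artJ: "artinian n (adj n J b \<beta>)" if "artinian n (adj n A b \<beta>)" for b \<beta>
  proof -
    have "adj n A b \<beta> k \<subseteq> adj n J b \<beta> k" for k
      using adj_superset[of _ A k n "G n" e] unfolding JA by (auto simp: adj_def[of n _ b])
    then show ?thesis using that unfolding artinian_def by blast
  qed
  have art: "artinian n (adj n J l 1)" using CID(4)[OF CIl] by (intro artJ) (simp add: full)
  obtain K \<tau> where K: "K \<ge> 0" "\<And>k. k \<ge> K \<Longrightarrow> HF n J k = \<tau>" "\<And>k. k \<ge> K \<Longrightarrow> colon n J l 1 k \<subseteq> J k"
    using eventually_stable[OF J l(1) art] by blast
  obtain G' where G': "\<And>i. i \<le> n \<Longrightarrow> G' i \<in> homog n e" "gen n G' (\<lambda>_. e) {..n} = Js"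
    and CIs: "CI n (\<lambda>i. if i < Suc n then G' i else mpoly_var i) (\<lambda>i. if i < Suc n then e else 1)"
    unfolding Js_def by (rule CI_path[where F = Fs and e = e, OF CI_vars order_refl]) (use Fs e no in auto)
  let ?q' = "\<lambda>i. if i < Suc n then G' i else mpoly_var i" and ?d' = "\<lambda>i. if i < Suc n then e else 1"
  have Js_eq: "gen n ?q' ?d' {..n} = Js" unfolding G'(2)[symmetric] by (intro gen_cong) auto
  have sumJs: "(\<Sum>i\<le>n. ?d' i - 1) = (int n + 1) * (e - 1)"
  proof -
    have "(\<Sum>i\<le>n. ?d' i - 1) = (\<Sum>i\<le>n. e - 1)" by (intro sum.cong) auto
    then show ?thesis by (simp add: algebra_simps)
  qed
  show ?thesis
  proof (rule that[OF l art K(1,3,2)])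
    fix k
    define T where "T = (int n + 1) * (e - 1)"
    \<comment> \<open>\<open>r > T - k\<close> makes \<open>l ^ r\<close> invisible in degree
      \<open>T - k\<close>; \<open>r \<ge> K\<close> and \<open>k + r \<ge> K\<close> reach the
      stable range of \<open>J\<close>; \<open>r \<ge> 1\<close> is demanded of degrees in
      \<open>CI\<close>.\<close>
    define r where "r = nat (max (max (T - k + 1) 1) (max K (K - k)))"
    have r: "int r > T - k" "int r \<ge> 1" "int r \<ge> K" "k + int r \<ge> K" by (auto simp: r_def)
    let ?q = "\<lambda>i. if i < n then G i else l ^ r" and ?d = "\<lambda>i. if i < n then e else int r"
    have lr: "l ^ r \<in> homog n (int r)" using homog_power[OF l(1), of r] by simp
    have CI: "CI n ?q ?d"
    proof -
      have "CI n ((\<lambda>i. if i < n then G i else l)(n := l ^ r)) ((\<lambda>i. if i < n then e else 1)(n := int r))"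
      proof (rule CI_exchange[OF CIl order_refl lr r(2)])
        have "gen n ((\<lambda>i. if i < n then G i else l)(n := l ^ r)) ((\<lambda>i. if i < n then e else 1)(n := int r)) {..n}
          = adj n A (l ^ r) (int r)"
          unfolding full[of "l ^ r" "int r", symmetric] by (intro gen_cong) auto
        moreover have "artinian n (adj n A (l ^ r) (int r))"
        proof (rule artinian_if_no_zeros[OF graded_adj[OF A lr]])
          fix c show "\<not> zero_of n (adj n A (l ^ r) (int r)) c"
          proof
            assume z: "zero_of n (adj n A (l ^ r) (int r)) c"
            have "1 * l ^ r \<in> adj n A (l ^ r) (int r) (int r)" by (rule adj_gen[OF A]) simp
            then have "mpoly_eval (1 * l ^ r) c = 0" using z unfolding zero_of_def by blast
            then have lc: "mpoly_eval l c = 0" by (simp add: eval.subst_power)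
            have "mpoly_eval u c = 0" if "u \<in> A k" for u k
              using z adj_superset[of u A k] that unfolding zero_of_def by blast
            then have "zero_of n (adj n A l 1) c"
              using z lc unfolding zero_of_def by (auto simp: adj_def eval.subst_add eval.subst_mult)
            moreover have "artinian n (adj n A l 1)" using CID(4)[OF CIl] by (simp add: full)
            ultimately show False using artinian_no_zero by blast
          qed
        qed
        ultimately show "artinian n (gen n ((\<lambda>i. if i < n then G i else l)(n := l ^ r)) ((\<lambda>i. if i < n then e else 1)(n := int r)) {..n})"
          by simp
      qed
      then show ?thesis by (rule CI_cong) auto
    qed
    define Q where "Q = gen n ?q ?d {..n}"
    have QA: "Q = adj n A (l ^ r) (int r)" by (simp add: Q_def full)
    note Q = CID(6)[OF CI order_refl, folded Q_def]
    have sumQ: "(\<Sum>i\<le>n. ?d i - 1) = int n * (e - 1) + int r - 1"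
    proof -
      have "(\<Sum>i\<le>n. ?d i - 1) = (\<Sum>i\<in>insert n {..<n}. ?d i - 1)" unfolding ins ..
      also have "\<dots> = int r - 1 + (\<Sum>i<n. ?d i - 1)" by (subst sum.insert) auto
      also have "(\<Sum>i<n. ?d i - 1) = (\<Sum>i<n. e - 1)" by (intro sum.cong) auto
      finally show ?thesis by simp
    qed
    \<comment> \<open>Below degree \<open>r\<close>, \<open>Q\<close> has the Hilbert function of
      \<open>A\<close>, which is also that of the first \<open>n\<close> forms obtained from
      \<open>Fs\<close>; one more regular form of degree \<open>e\<close> completes these to
      \<open>Js\<close>.\<close>
    have HQ: "HF n Q j = HF n Js j + HF n Q (j - e)" if j: "j < int r" for j
    proof -
      have lo: "HF n A i = HF n Q i" if "i < int r" for i
      proof -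
        have "HF n A (i - int r) = 0"
          using that HF_0_iff[OF A, of "i - int r"] graded_0[OF A] homog_neg_degree[of "i - int r"] by simp
        moreover have "{..<n} \<subseteq> {..n}" by auto
        ultimately show ?thesis using HF_regular[OF CI, of "{..<n}" n i] by (simp add: A_eq full QA flip: ins)
      qed
      have "HF n A i = HF n (gen n ?q' ?d' {..<n}) i" for i
        using HF_CI_cong[OF CI CIs, of "{..<n}" i] unfolding A_eq by fastforce
      then have "HF n A j = HF n Js j + HF n A (j - e)"
        using HF_regular[OF CIs, of "{..<n}" n j] Js_eq unfolding ins[symmetric] by fastforce
      then show ?thesis using lo[of j] lo[of "j - e"] j e by simp
    qed
    define R where "R = adj n Q (G n) e"
    have R: "R = adj n J (l ^ r) (int r)" unfolding R_def QA JA by (rule adj_commute)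
    have Gn: "G n \<in> homog n e" using G(1) by simp
    \<comment> \<open>In degree \<open>j1\<close> the ideals \<open>R\<close> and \<open>J\<close>
      coincide; in degree \<open>j2\<close> the colon ideal of \<open>l ^ r\<close> in degree
      \<open>k\<close>, that is the saturation, becomes visible.\<close>
    define j1 where "j1 = T - k"
    define j2 where "j2 = k + int r"
    have rank: "mpoly.qdim (homog n (j1 - e)) (colon n Q (G n) e (j1 - e))
       = mpoly.qdim (homog n (j2 - e)) (colon n Q (G n) e (j2 - e))"
      unfolding Q_def by (rule CI_dual_rank[OF CI Gn]) (simp add: sumQ j1_def j2_def T_def algebra_simps)
    have 1: "HF n Q j1 = HF n R j1 + mpoly.qdim (homog n (j1 - e)) (colon n Q (G n) e (j1 - e))"
      unfolding R_def by (rule HF_adj[OF Q Gn])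
    have 2: "HF n Q j2 = HF n R j2 + mpoly.qdim (homog n (j2 - e)) (colon n Q (G n) e (j2 - e))"
      unfolding R_def by (rule HF_adj[OF Q Gn])
    have 3: "HF n Q j2 = HF n Q (j1 - e)"
      using CI_HF_symmetric[OF CI, of j2, folded Q_def] by (simp add: sumQ j1_def j2_def T_def algebra_simps)
    have 4: "HF n Q j1 = HF n Js j1 + HF n Q (j1 - e)" using r by (intro HQ) (simp add: j1_def)
    have 5: "HF n Js j1 = HF n Js k"
      using CI_HF_symmetric[OF CIs, of k] unfolding Js_eq sumJs j1_def T_def by (rule sym)
    have "R j1 = J j1" unfolding R using r homog_neg_degree[of "j1 - int r" n] by (simp add: adj_def j1_def)
    then have 6: "HF n R j1 = HF n J j1" by (simp add: HF_def)
    have artr: "artinian n (adj n J (l ^ r) (int r))" using CID(4)[OF CI] by (intro artJ) (simp add: full)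
    have sat: "satd n J k = colon n J (l ^ r) (int r) k"
      by (rule satd_eq_colon[OF J l(1) K(1,3) r(3) artr])
    have 7: "HF n J j2 = HF n R j2 + mpoly.qdim (homog n k) (satd n J k)"
      using HF_adj[OF J lr, of j2] by (simp add: sat R j2_def)
    have 8: "HF n J k = mpoly.qdim (homog n k) (satd n J k) + mpoly.qdim (satd n J k) (J k)"
      using HF_colon[OF J lr, of k] by (simp add: sat)
    have 9: "HF n J j2 = \<tau>" using K(2)[of j2] r by (simp add: j2_def)
    \<comment> \<open>The equal ranks cancel between 1 and 2, which leaves
      \<open>HF n J j1 = HF n Js k + HF n R j2\<close>; by 7 and 9 the last term is \<tau> minus the
      dimension of the forms of degree \<open>k\<close> modulo the saturation.\<close>
    show "HF n J ((int n + 1) * (e - 1) - k) + HF n J k = HF n Js k + \<tau> + mpoly.qdim (satd n J k) (J k)"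
      using rank 1 2 3 4 5 6 7 8 9 unfolding j1_def T_def by linarith
  qed
qed

subsection \<open>Convergent power series\<close>

definition mfps_mon :: "monom \<Rightarrow> mfps" where
  "mfps_mon p = Abs_mfps (\<lambda>m. if m = p then 1 else 0)"

lemma nth_mon: "mfps_nth (mfps_mon p) m = (if m = p then 1 else 0)"
  by (simp add: mfps_mon_def Abs_mfps_inverse)

lemma nth_add [simp]: "mfps_nth (a + b) m = mfps_nth a m + mfps_nth b m"
  by (simp add: plus_mfps.rep_eq)

lemma nth_diff [simp]: "mfps_nth (a - b) m = mfps_nth a m - mfps_nth b m"
  by (simp add: minus_mfps.rep_eq)

lemma nth_zero [simp]: "mfps_nth 0 m = 0"
  by (simp add: zero_mfps.rep_eq)

lemma nth_one: "mfps_nth 1 m = (if m = 0 then 1 else 0)"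
  by (simp add: one_mfps.rep_eq)

lemma nth_scale [simp]: "mfps_nth (mfps_scale c a) m = c * mfps_nth a m"
  by (simp add: mfps_scale.rep_eq)

lemma nth_mult: "mfps_nth (a * b) m = (\<Sum>(k, l)\<in>antidiag m. mfps_nth a k * mfps_nth b l)"
  by (simp add: times_mfps.rep_eq)

lemma nth_sum: "mfps_nth (sum f A) m = (\<Sum>a\<in>A. mfps_nth (f a) m)"
  by (induction A rule: infinite_finite_induct) auto

lemma antidiag_0: "antidiag 0 = {(0, 0)}"
proof -
  have "k = 0 \<and> l = 0" if "k + l = (0::monom)" for k l
  proof -
    have "mdeg k + mdeg l = 0" using that mdeg_add[of k l] by simp
    then show ?thesis by (simp add: mdeg_eq_0_iff)
  qed
  then have "antidiag 0 \<subseteq> {(0, 0)}" unfolding antidiag_def by blast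
  moreover have "(0, 0) \<in> antidiag 0" by (simp add: antidiag_def)
  ultimately show ?thesis by blast
qed

lemma nth_0_mult: "mfps_nth (a * b) 0 = mfps_nth a 0 * mfps_nth b 0"
  by (simp add: nth_mult antidiag_0)

lemma nth_mon_mult: "mfps_nth (mfps_mon p * b) (p + q) = mfps_nth b q"
proof -
  have "mfps_nth (mfps_mon p * b) (p + q) = (\<Sum>(k, l)\<in>{(p, q)}. mfps_nth (mfps_mon p) k * mfps_nth b l)"
    unfolding nth_mult
    by (rule sum.mono_neutral_right[OF finite_antidiag]) (auto simp: antidiag_def nth_mon split: if_splits)
  then show ?thesis by (simp add: nth_mon)
qed

lemma nth_mon_mult_0: "(\<And>q. m \<noteq> p + q) \<Longrightarrow> mfps_nth (mfps_mon p * b) m = 0"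
  unfolding nth_mult by (rule sum.neutral) (auto simp: antidiag_def nth_mon)

lemma mfps_mon_add: "mfps_mon (p + q) = mfps_mon p * mfps_mon q"
proof (rule mfps_eqI)
  fix m
  show "mfps_nth (mfps_mon (p + q)) m = mfps_nth (mfps_mon p * mfps_mon q) m"
  proof (cases "\<exists>q'. m = p + q'")
    case True
    then show ?thesis by (auto simp: nth_mon_mult nth_mon)
  next
    case False
    then show ?thesis by (subst nth_mon_mult_0) (auto simp: nth_mon)
  qed
qed

lemma mfps_mon_0: "mfps_mon 0 = 1"
  by (rule mfps_eqI) (simp add: nth_mon nth_one)

lemma mfps_var_mon: "mfps_var i = mfps_mon (single i 1)"
  by (rule mfps_eqI) (simp add: nth_mon mfps_var.rep_eq)

lemma mfps_var_power: "mfps_var i ^ k = mfps_mon (single i k)"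
  by (induction k) (simp_all add: mfps_mon_0 mfps_var_mon mfps_mon_add[symmetric] single_add[symmetric])

lemma monom_val_mfps_var: "monom_val mfps_var m = mfps_mon m"
proof -
  have "(\<Prod>i\<in>A. mfps_var i ^ lookup m i) = mfps_mon (\<Sum>i\<in>A. single i (lookup m i))" if "finite A" for A
    using that by (induction A rule: finite_induct) (simp_all add: mfps_mon_0 mfps_mon_add mfps_var_power)
  then show ?thesis using poly_mapping_eq_sum_single[of m] by (simp add: monom_val_def)
qed

lemma const_mult: "mfps_const c * b = mfps_scale c b"
proof (rule mfps_eqI)
  fix m
  have "mfps_nth (mfps_const c * b) m = (\<Sum>(k, l)\<in>{(0, m)}. mfps_nth (mfps_const c) k * mfps_nth b l)"
    unfolding nth_mult
    by (rule sum.mono_neutral_right[OF finite_antidiag]) (auto simp: antidiag_def mfps_const.rep_eq split: if_splits)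
  then show "mfps_nth (mfps_const c * b) m = mfps_nth (mfps_scale c b) m" by (simp add: mfps_const.rep_eq)
qed

interpretation const_hom: coeff_hom mfps_const
proof
  show "mfps_const (a + b) = mfps_const a + mfps_const b" for a b
    by (rule mfps_eqI) (simp add: mfps_const.rep_eq)
  show "mfps_const (a * b) = mfps_const a * mfps_const b" for a b
    by (rule mfps_eqI) (simp add: const_mult, simp add: mfps_const.rep_eq)
  show "mfps_const 1 = 1"
    by (rule mfps_eqI) (simp add: mfps_const.rep_eq nth_one)
qed

text \<open>Bounds finite partial sums, which keeps estimates free of infinite sums; the least such
  \<open>C\<close> is the weighted l1 norm for the radius \<open>r\<close>.\<close>

definition mfps_bound :: "mfps \<Rightarrow> real \<Rightarrow> real \<Rightarrow> bool" where
  "mfps_bound a r C \<longleftrightarrow> (\<forall>F. finite F \<longrightarrow> (\<Sum>m\<in>F. norm (mfps_nth a m) * r ^ mdeg m) \<le> C)"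

lemma mfps_boundD: "mfps_bound a r C \<Longrightarrow> finite F \<Longrightarrow> (\<Sum>m\<in>F. norm (mfps_nth a m) * r ^ mdeg m) \<le> C"
  by (simp add: mfps_bound_def)

lemma mfps_bound_nonneg: "mfps_bound a r C \<Longrightarrow> 0 \<le> C"
  using mfps_boundD[of a r C "{}"] by simp

lemma convergent_series_iff:
  "a \<in> convergent_series V \<longleftrightarrow> (\<forall>m. mfps_nth a m \<noteq> 0 \<longrightarrow> keys m \<subseteq> V) \<and> (\<exists>r>0. \<exists>C. mfps_bound a r C)"
proof -
  have "(\<lambda>m. norm (mfps_nth a m) * r ^ mdeg m) summable_on UNIV \<longleftrightarrow> (\<exists>C. mfps_bound a r C)" if "r > 0" for r
  proof
    assume "(\<lambda>m. norm (mfps_nth a m) * r ^ mdeg m) summable_on UNIV"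
    then have "mfps_bound a r (infsum (\<lambda>m. norm (mfps_nth a m) * r ^ mdeg m) UNIV)"
      unfolding mfps_bound_def using that by (auto intro!: finite_sum_le_infsum)
    then show "\<exists>C. mfps_bound a r C" ..
  next
    assume "\<exists>C. mfps_bound a r C"
    then obtain C where "mfps_bound a r C" ..
    then show "(\<lambda>m. norm (mfps_nth a m) * r ^ mdeg m) summable_on UNIV"
      using that by (intro nonneg_bdd_above_summable_on bdd_aboveI2[of _ _ C]) (auto dest: mfps_boundD)
  qed
  then show ?thesis unfolding convergent_series_def by blast
qed

section \<open>Norm estimates and closure properties of convergent series\<close>

lemma mfps_bound_add:
  assumes "mfps_bound a r C" "mfps_bound b r D" "r \<ge> 0"
  shows "mfps_bound (a + b) r (C + D)"
  unfolding mfps_bound_def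
proof (intro allI impI)
  fix F :: "monom set" assume F: "finite F"
  have "(\<Sum>m\<in>F. norm (mfps_nth (a + b) m) * r ^ mdeg m)
     \<le> (\<Sum>m\<in>F. norm (mfps_nth a m) * r ^ mdeg m + norm (mfps_nth b m) * r ^ mdeg m)"
    using assms(3) by (intro sum_mono) (simp add: norm_triangle_ineq mult_right_mono flip: distrib_right)
  also have "\<dots> \<le> C + D" using assms F by (simp add: sum.distrib add_mono mfps_boundD)
  finally show "(\<Sum>m\<in>F. norm (mfps_nth (a + b) m) * r ^ mdeg m) \<le> C + D" .
qed

text \<open>Submultiplicativity of the norm: a finite part of the Cauchy product only involves index
  pairs from a finite rectangle, over which the double sum factors.\<close>

lemma mfps_bound_mult:
  assumes a: "mfps_bound a r C" and b: "mfps_bound b r D" and r: "r \<ge> 0"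
  shows "mfps_bound (a * b) r (C * D)"
  unfolding mfps_bound_def
proof (intro allI impI)
  fix F :: "monom set" assume F: "finite F"
  let ?f = "\<lambda>m. norm (mfps_nth a m) * r ^ mdeg m" and ?g = "\<lambda>m. norm (mfps_nth b m) * r ^ mdeg m"
  define U where "U = (\<Union>m\<in>F. antidiag m)"
  have U: "finite U" using F by (simp add: U_def)
  have "(\<Sum>m\<in>F. norm (mfps_nth (a * b) m) * r ^ mdeg m) \<le> (\<Sum>m\<in>F. \<Sum>(k, l)\<in>antidiag m. ?f k * ?g l)"
  proof (rule sum_mono)
    fix m
    have "norm (mfps_nth (a * b) m) * r ^ mdeg m
        \<le> (\<Sum>(k, l)\<in>antidiag m. norm (mfps_nth a k) * norm (mfps_nth b l)) * r ^ mdeg m"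
      unfolding nth_mult using r
      by (intro mult_right_mono order.trans[OF norm_sum] sum_mono) (auto simp: norm_mult)
    also have "\<dots> = (\<Sum>(k, l)\<in>antidiag m. ?f k * ?g l)"
      unfolding sum_distrib_right
      by (intro sum.cong) (auto simp: antidiag_def mdeg_add power_add)
    finally show "norm (mfps_nth (a * b) m) * r ^ mdeg m \<le> (\<Sum>(k, l)\<in>antidiag m. ?f k * ?g l)" .
  qed
  also have "\<dots> = (\<Sum>(k, l)\<in>U. ?f k * ?g l)"
    unfolding U_def
    by (rule sum.UNION_disjoint[OF F, symmetric]) (simp, auto simp: antidiag_def)
  also have "\<dots> \<le> (\<Sum>(k, l)\<in>fst ` U \<times> snd ` U. ?f k * ?g l)"
    using U r by (intro sum_mono2) (auto intro: rev_image_eqI)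
  also have "\<dots> = (\<Sum>k\<in>fst ` U. ?f k) * (\<Sum>l\<in>snd ` U. ?g l)"
    by (simp add: sum_product sum.cartesian_product)
  also have "\<dots> \<le> C * D"
    using U a b r by (intro mult_mono mfps_boundD sum_nonneg) (auto dest: mfps_bound_nonneg)
  finally show "(\<Sum>m\<in>F. norm (mfps_nth (a * b) m) * r ^ mdeg m) \<le> C * D" .
qed

lemma mfps_bound_mono:
  assumes "mfps_bound a r C" "0 \<le> r'" "r' \<le> r"
  shows "mfps_bound a r' C"
  unfolding mfps_bound_def
proof (intro allI impI)
  fix F :: "monom set" assume F: "finite F"
  have "(\<Sum>m\<in>F. norm (mfps_nth a m) * r' ^ mdeg m) \<le> (\<Sum>m\<in>F. norm (mfps_nth a m) * r ^ mdeg m)"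
    using assms by (intro sum_mono mult_left_mono power_mono) auto
  also have "\<dots> \<le> C" using assms(1) F by (rule mfps_boundD)
  finally show "(\<Sum>m\<in>F. norm (mfps_nth a m) * r' ^ mdeg m) \<le> C" .
qed

lemma convergent_common:
  assumes "a \<in> convergent_series V" "b \<in> convergent_series V"
  obtains r C D where "r > 0" "mfps_bound a r C" "mfps_bound b r D"
proof -
  obtain r C where 1: "r > 0" "mfps_bound a r C" using assms(1) by (auto simp: convergent_series_iff)
  obtain r' D where 2: "r' > 0" "mfps_bound b r' D" using assms(2) by (auto simp: convergent_series_iff)
  show ?thesis
    by (rule that[of "min r r'" C D]) (use 1 2 in \<open>auto intro: mfps_bound_mono\<close>)
qed

lemma conv_mon: "keys p \<subseteq> V \<Longrightarrow> mfps_mon p \<in> convergent_series V"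
proof -
  assume p: "keys p \<subseteq> V"
  have "mfps_bound (mfps_mon p) 1 1"
    unfolding mfps_bound_def by (simp add: nth_mon if_distrib[of norm] cong: if_cong)
  then show ?thesis
    using p unfolding convergent_series_iff by (auto simp: nth_mon split: if_splits intro: zero_less_one)
qed

lemma conv_add: "a \<in> convergent_series V \<Longrightarrow> b \<in> convergent_series V \<Longrightarrow> a + b \<in> convergent_series V"
proof -
  assume ab: "a \<in> convergent_series V" "b \<in> convergent_series V"
  obtain r C D where r: "r > 0" "mfps_bound a r C" "mfps_bound b r D" using convergent_common[OF ab] .
  then have "mfps_bound (a + b) r (C + D)" by (intro mfps_bound_add) auto
  moreover have "keys m \<subseteq> V" if "mfps_nth (a + b) m \<noteq> 0" for m
    using ab that unfolding convergent_series_iff by (cases "mfps_nth a m = 0") auto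
  ultimately show ?thesis using r(1) unfolding convergent_series_iff by blast
qed

lemma conv_mult: "a \<in> convergent_series V \<Longrightarrow> b \<in> convergent_series V \<Longrightarrow> a * b \<in> convergent_series V"
proof -
  assume ab: "a \<in> convergent_series V" "b \<in> convergent_series V"
  obtain r C D where r: "r > 0" "mfps_bound a r C" "mfps_bound b r D" using convergent_common[OF ab] .
  then have "mfps_bound (a * b) r (C * D)" by (intro mfps_bound_mult) auto
  moreover have "keys m \<subseteq> V" if "mfps_nth (a * b) m \<noteq> 0" for m
  proof -
    have "\<exists>x\<in>antidiag m. mfps_nth a (fst x) * mfps_nth b (snd x) \<noteq> 0"
      using that sum.neutral[of "antidiag m" "\<lambda>x. mfps_nth a (fst x) * mfps_nth b (snd x)"]
      unfolding nth_mult case_prod_beta by metis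
    then obtain k l where "m = k + l" "mfps_nth a k \<noteq> 0" "mfps_nth b l \<noteq> 0" by (auto simp: antidiag_def)
    then show ?thesis using ab unfolding convergent_series_iff by (simp add: keys_add_monom)
  qed
  ultimately show ?thesis using r(1) unfolding convergent_series_iff by blast
qed

lemma conv_1: "1 \<in> convergent_series V"
  using conv_mon[of 0 V] by (simp add: mfps_mon_0)

lemma conv_0: "0 \<in> convergent_series V"
proof -
  have "mfps_bound 0 1 0" by (simp add: mfps_bound_def)
  then show ?thesis unfolding convergent_series_iff by (auto intro: zero_less_one)
qed

lemma conv_scale:
  assumes "a \<in> convergent_series V"
  shows "mfps_scale c a \<in> convergent_series V"
proof -
  obtain r C where r: "r > 0" "mfps_bound a r C" using assms by (auto simp: convergent_series_iff)
  have "mfps_bound (mfps_scale c a) r (norm c * C)"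
    unfolding mfps_bound_def
  proof (intro allI impI)
    fix F :: "monom set" assume "finite F"
    then have "norm c * (\<Sum>m\<in>F. norm (mfps_nth a m) * r ^ mdeg m) \<le> norm c * C"
      using r by (intro mult_left_mono mfps_boundD) auto
    then show "(\<Sum>m\<in>F. norm (mfps_nth (mfps_scale c a) m) * r ^ mdeg m) \<le> norm c * C"
      by (simp add: sum_distrib_left norm_mult mult.assoc)
  qed
  then show ?thesis using assms r(1) unfolding convergent_series_iff by auto
qed

lemma conv_const: "mfps_const c \<in> convergent_series V"
  using conv_scale[OF conv_1, of c V] const_mult[of c 1] by simp

lemma conv_var: "j \<in> V \<Longrightarrow> mfps_var j \<in> convergent_series V"
  unfolding mfps_var_mon by (rule conv_mon) simp

lemma subspace_conv: "mfps.subspace (convergent_series V)"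
  by (rule mfps.subspaceI) (auto intro: conv_0 conv_add conv_scale)

lemma conv_diff: "a \<in> convergent_series V \<Longrightarrow> b \<in> convergent_series V \<Longrightarrow> a - b \<in> convergent_series V"
  by (rule mfps.subspace_diff[OF subspace_conv])

lemma conv_power: "a \<in> convergent_series V \<Longrightarrow> a ^ k \<in> convergent_series V"
  by (induction k) (auto intro: conv_1 conv_mult)

lemma conv_prod: "(\<And>i. i \<in> A \<Longrightarrow> a i \<in> convergent_series V) \<Longrightarrow> prod a A \<in> convergent_series V"
  by (induction A rule: infinite_finite_induct) (auto intro: conv_1 conv_mult)

lemma power_order:
  assumes "mfps_nth w 0 = 0" "mdeg m < k"
  shows "mfps_nth (w ^ k) m = 0"
  using assms(2)
proof (induction k arbitrary: m)
  case (Suc k)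
  have "mfps_nth w x * mfps_nth (w ^ k) y = 0" if "x + y = m" for x y
  proof (cases "x = 0")
    case False
    then have "mdeg x \<noteq> 0" by (simp add: mdeg_eq_0_iff)
    then have "mdeg y < k" using Suc.prems mdeg_add[of x y] that by simp
    then show ?thesis using Suc.IH by simp
  qed (use assms in simp)
  then show ?case by (auto simp: nth_mult antidiag_def intro!: sum.neutral)
qed simp

text \<open>The inverse of \<open>1 - w\<close> is the geometric series; it converges because \<open>w\<close> has norm at most
  \<open>1/2\<close> on a small polydisc.\<close>

lemma conv_inverse_1:
  assumes w: "w \<in> convergent_series V" "mfps_nth w 0 = 0"
  shows "\<exists>v\<in>convergent_series V. (1 - w) * v = 1"
proof -
  obtain R C where R: "R > 0" "mfps_bound w R C" using w(1) by (auto simp: convergent_series_iff)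
  note C = mfps_bound_nonneg[OF R(2)]
  \<comment> \<open>Shrinking the radius by \<theta> scales each term of positive degree by at most
    \<theta>, and \<open>w\<close> has no constant term. This value gives
    \<open>\<theta> * C \<le> 1 / 2\<close>, also when \<open>C = 0\<close>.\<close>
  define \<theta> where "\<theta> = 1 / (2 * C + 1)"
  define r where "r = \<theta> * R"
  have \<theta>: "0 < \<theta>" "\<theta> \<le> 1" "\<theta> * C \<le> 1 / 2" using C by (auto simp: \<theta>_def field_simps)
  have r: "r > 0" using \<theta> R by (simp add: r_def)
  have bw: "mfps_bound w r (1 / 2)"
    unfolding mfps_bound_def
  proof (intro allI impI)
    fix F :: "monom set" assume F: "finite F"
    have "(\<Sum>m\<in>F. norm (mfps_nth w m) * r ^ mdeg m) \<le> (\<Sum>m\<in>F. \<theta> * (norm (mfps_nth w m) * R ^ mdeg m))"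
    proof (rule sum_mono)
      fix m
      show "norm (mfps_nth w m) * r ^ mdeg m \<le> \<theta> * (norm (mfps_nth w m) * R ^ mdeg m)"
      proof (cases "m = 0")
        case False
        then have "mdeg m \<noteq> 0" by (simp add: mdeg_eq_0_iff)
        then have "\<theta> ^ mdeg m \<le> \<theta>" using \<theta> power_decreasing[of 1 "mdeg m" \<theta>] by simp
        then have "\<theta> ^ mdeg m * (norm (mfps_nth w m) * R ^ mdeg m) \<le> \<theta> * (norm (mfps_nth w m) * R ^ mdeg m)"
          using R by (intro mult_right_mono) auto
        then show ?thesis by (simp add: r_def power_mult_distrib mult_ac)
      qed (use w \<theta> in simp)
    qed
    also have "\<dots> = \<theta> * (\<Sum>m\<in>F. norm (mfps_nth w m) * R ^ mdeg m)" by (simp add: sum_distrib_left)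
    also have "\<dots> \<le> \<theta> * C" using \<theta> R F by (intro mult_left_mono mfps_boundD) auto
    also have "\<dots> \<le> 1 / 2" by (rule \<theta>)
    finally show "(\<Sum>m\<in>F. norm (mfps_nth w m) * r ^ mdeg m) \<le> 1 / 2" .
  qed
  have bpow: "mfps_bound (w ^ k) r ((1 / 2) ^ k)" for k
  proof (induction k)
    case 0
    show ?case unfolding mfps_bound_def
    proof (intro allI impI)
      fix F :: "monom set" assume "finite F"
      have "(\<Sum>m\<in>F. norm (mfps_nth 1 m) * r ^ mdeg m) = (\<Sum>m\<in>F. if m = 0 then 1 else 0)"
        by (intro sum.cong) (auto simp: nth_one)
      then show "(\<Sum>m\<in>F. norm (mfps_nth (w ^ 0) m) * r ^ mdeg m) \<le> (1 / 2) ^ 0"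
        using \<open>finite F\<close> by simp
    qed
  next
    case (Suc k)
    then show ?case using mfps_bound_mult[OF bw Suc] r by simp
  qed
  \<comment> \<open>By \<open>power_order\<close>, powers beyond \<open>mdeg m\<close> do not reach
    the coefficient of \<open>m\<close>, so cutting the geometric series there is exact.\<close>
  define v where "v = Abs_mfps (\<lambda>m. \<Sum>k\<le>mdeg m. mfps_nth (w ^ k) m)"
  have vn: "mfps_nth v m = (\<Sum>k\<le>M. mfps_nth (w ^ k) m)" if "mdeg m \<le> M" for m M
    unfolding v_def Abs_mfps_inverse[OF UNIV_I] using that
    by (intro sum.mono_neutral_left) (auto intro: power_order[OF w(2)])
  have "mfps_bound v r 2"
    unfolding mfps_bound_def
  proof (intro allI impI)
    fix F :: "monom set" assume F: "finite F"
    define M where "M = Max (insert 0 (mdeg ` F))"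
    have M: "mdeg m \<le> M" if "m \<in> F" for m using that F by (simp add: M_def)
    have "(\<Sum>m\<in>F. norm (mfps_nth v m) * r ^ mdeg m) \<le> (\<Sum>m\<in>F. \<Sum>k\<le>M. norm (mfps_nth (w ^ k) m) * r ^ mdeg m)"
      using r by (intro sum_mono) (auto simp: vn[OF M] sum_distrib_right[symmetric] intro!: mult_right_mono norm_sum)
    also have "\<dots> = (\<Sum>k\<le>M. \<Sum>m\<in>F. norm (mfps_nth (w ^ k) m) * r ^ mdeg m)" by (rule sum.swap)
    also have "\<dots> \<le> (\<Sum>k\<le>M. (1 / 2) ^ k)" using bpow F by (intro sum_mono mfps_boundD) auto
    also have "\<dots> \<le> 2" using sum_gp[of "1 / 2 :: real" 0 M] by (simp add: atMost_atLeast0)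
    finally show "(\<Sum>m\<in>F. norm (mfps_nth v m) * r ^ mdeg m) \<le> 2" .
  qed
  moreover have "keys m \<subseteq> V" if "mfps_nth v m \<noteq> 0" for m
  proof -
    obtain k where "mfps_nth (w ^ k) m \<noteq> 0"
      using \<open>mfps_nth v m \<noteq> 0\<close> vn[of m "mdeg m"] by (metis order_refl sum.neutral)
    then show ?thesis using conv_power[OF w(1), of k] by (auto simp: convergent_series_iff)
  qed
  ultimately have "v \<in> convergent_series V" using r unfolding convergent_series_iff by blast
  moreover have "(1 - w) * v = 1"
  proof (rule mfps_eqI)
    fix m
    \<comment> \<open>For one fixed coefficient the series may be replaced by a partial sum, to
      which telescoping applies.\<close>
    define M where "M = mdeg m"
    define s where "s = (\<Sum>k\<le>M. w ^ k)"
    have tel: "(1 - w) * s = 1 - w ^ Suc M"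
      unfolding s_def
    proof (induction M)
      case (Suc M)
      have "(1 - w) * (\<Sum>k\<le>Suc M. w ^ k) = (1 - w) * (\<Sum>k\<le>M. w ^ k) + (1 - w) * w ^ Suc M"
        by (simp only: sum.atMost_Suc distrib_left)
      then show ?case unfolding Suc by (simp add: left_diff_distrib)
    qed simp
    have "mfps_nth ((1 - w) * (v - s)) m = 0"
    proof -
      have "mfps_nth (v - s) y = 0" if "x + y = m" for x y
        using that mdeg_add[of x y] by (simp add: vn[of y M] M_def s_def nth_sum)
      then show ?thesis unfolding nth_mult by (auto simp: antidiag_def intro!: sum.neutral)
    qed
    moreover have "(1 - w) * v = (1 - w) * (v - s) + (1 - w ^ Suc M)" unfolding tel[symmetric] by (simp add: algebra_simps)
    ultimately have "mfps_nth ((1 - w) * v) m = mfps_nth (1 - w ^ Suc M) m" by simp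
    also have "\<dots> = mfps_nth 1 m" using power_order[OF w(2), of m "Suc M"] by (simp add: M_def del: power_Suc)
    finally show "mfps_nth ((1 - w) * v) m = mfps_nth 1 m" .
  qed
  ultimately show ?thesis by blast
qed

lemma conv_inverse:
  assumes a: "a \<in> convergent_series V" "mfps_nth a 0 \<noteq> 0"
  shows "\<exists>b\<in>convergent_series V. a * b = 1"
proof -
  define c where "c = inverse (mfps_nth a 0)"
  define w where "w = 1 - mfps_scale c a"
  have "w \<in> convergent_series V" unfolding w_def using a by (intro conv_diff conv_1 conv_scale)
  moreover have "mfps_nth w 0 = 0" using a by (simp add: w_def c_def nth_one)
  ultimately obtain v where v: "v \<in> convergent_series V" "(1 - w) * v = 1" using conv_inverse_1 by blast
  have "a * mfps_scale c v = (1 - w) * v"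
    by (simp add: w_def ac_simps flip: const_mult)
  then show ?thesis using v by (intro bexI[of _ "mfps_scale c v"]) (auto intro: conv_scale)
qed

text \<open>One variable at a time, the monomials divisible by its \<open>N\<close>-th power are
  split off and shifted down, which costs a factor \<open>1 / r ^ N\<close> in the bound. With
  \<open>W = V\<close> the remainder \<open>p\<close> has finite support if \<open>V\<close> is
  finite.\<close>

lemma conv_divide:
  assumes W: "finite W" "W \<subseteq> V" and a: "a \<in> convergent_series V"
  shows "\<exists>p b. a = p + (\<Sum>j\<in>W. mfps_var j ^ N * b j) \<and> p \<in> convergent_series V \<and>
    (\<forall>j\<in>W. b j \<in> convergent_series V) \<and> (\<forall>m. mfps_nth p m \<noteq> 0 \<longrightarrow> (\<forall>j\<in>W. lookup m j < N))"
  using W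
proof (induction W rule: finite_induct)
  case empty
  then show ?case using a by (intro exI[of _ a]) auto
next
  case (insert j W)
  then obtain p b where pb: "a = p + (\<Sum>j\<in>W. mfps_var j ^ N * b j)" "p \<in> convergent_series V"
    "\<forall>j\<in>W. b j \<in> convergent_series V" "\<And>m. mfps_nth p m \<noteq> 0 \<Longrightarrow> \<forall>j\<in>W. lookup m j < N" by auto
  define p' where "p' = Abs_mfps (\<lambda>m. if lookup m j < N then mfps_nth p m else 0)"
  define c where "c = Abs_mfps (\<lambda>m. mfps_nth p (single j N + m))"
  have p'n: "mfps_nth p' m = (if lookup m j < N then mfps_nth p m else 0)" for m
    by (simp add: p'_def Abs_mfps_inverse)
  have cn: "mfps_nth c m = mfps_nth p (single j N + m)" for m
    by (simp add: c_def Abs_mfps_inverse)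
  obtain r C where r: "r > 0" "mfps_bound p r C" using pb(2) by (auto simp: convergent_series_iff)
  have "mfps_bound p' r C"
    unfolding mfps_bound_def
  proof (intro allI impI)
    fix F :: "monom set" assume "finite F"
    have "(\<Sum>m\<in>F. norm (mfps_nth p' m) * r ^ mdeg m) \<le> (\<Sum>m\<in>F. norm (mfps_nth p m) * r ^ mdeg m)"
      using r by (intro sum_mono mult_right_mono) (auto simp: p'n)
    then show "(\<Sum>m\<in>F. norm (mfps_nth p' m) * r ^ mdeg m) \<le> C" using mfps_boundD[OF r(2) \<open>finite F\<close>] by simp
  qed
  then have p'c: "p' \<in> convergent_series V"
    using pb(2) r(1) unfolding convergent_series_iff by (auto simp: p'n split: if_splits)
  have "mfps_bound c r (C / r ^ N)"
    unfolding mfps_bound_def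
  proof (intro allI impI)
    fix F :: "monom set" assume F: "finite F"
    have inj: "inj_on ((+) (single j N)) F" by (simp add: inj_on_def)
    have "r ^ N * (\<Sum>m\<in>F. norm (mfps_nth c m) * r ^ mdeg m) = (\<Sum>m\<in>(+) (single j N) ` F. norm (mfps_nth p m) * r ^ mdeg m)"
      unfolding sum.reindex[OF inj] sum_distrib_left by (intro sum.cong) (auto simp: cn mdeg_add power_add)
    also have "\<dots> \<le> C" using F by (intro mfps_boundD[OF r(2)]) auto
    finally show "(\<Sum>m\<in>F. norm (mfps_nth c m) * r ^ mdeg m) \<le> C / r ^ N"
      using r by (simp add: field_simps)
  qed
  moreover have "keys m \<subseteq> V" if "mfps_nth c m \<noteq> 0" for m
  proof -
    have "keys (single j N + m) \<subseteq> V" using pb(2) that unfolding cn convergent_series_iff by blast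
    then show ?thesis by (simp add: keys_add_monom)
  qed
  ultimately have cc: "c \<in> convergent_series V" using r(1) unfolding convergent_series_iff by blast
  have "p = p' + mfps_var j ^ N * c"
  proof (rule mfps_eqI)
    fix m
    show "mfps_nth p m = mfps_nth (p' + mfps_var j ^ N * c) m"
    proof (cases "lookup m j < N")
      case True
      then have "m \<noteq> single j N + q" for q by (auto simp: lookup_add)
      then show ?thesis using True by (simp add: p'n mfps_var_power nth_mon_mult_0)
    next
      case False
      then have "m = single j N + (m - single j N)"
        by (intro poly_mapping_eqI) (auto simp: lookup_add lookup_minus lookup_single when_def)
      then obtain q where "m = single j N + q" by blast
      then show ?thesis using False by (simp add: p'n mfps_var_power nth_mon_mult cn)
    qed
  qed
  then have "a = p' + (\<Sum>i\<in>insert j W. mfps_var i ^ N * (b(j := c)) i)"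
  proof -
    have "(\<Sum>i\<in>W. mfps_var i ^ N * (b(j := c)) i) = (\<Sum>i\<in>W. mfps_var i ^ N * b i)"
      using insert by (intro sum.cong) auto
    then show ?thesis using pb(1) \<open>p = _\<close> insert by (simp add: algebra_simps)
  qed
  moreover have "\<forall>i\<in>insert j W. (b(j := c)) i \<in> convergent_series V" using pb(3) cc by auto
  moreover have "\<forall>m. mfps_nth p' m \<noteq> 0 \<longrightarrow> (\<forall>i\<in>insert j W. lookup m i < N)"
    using pb(4) by (auto simp: p'n split: if_splits)
  ultimately show ?case using p'c by blast
qed

lemma finite_monoms_below:
  assumes "finite V"
  shows "finite {m :: monom. keys m \<subseteq> V \<and> (\<forall>j\<in>V. lookup m j < N)}" (is "finite ?D")
proof -
  let ?r = "\<lambda>m :: monom. restrict (lookup m) V"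
  have "inj_on ?r ?D"
  proof (rule inj_onI, rule poly_mapping_eqI)
    fix k l i assume D: "k \<in> ?D" "l \<in> ?D" and eq: "?r k = ?r l"
    show "lookup k i = lookup l i"
    proof (cases "i \<in> V")
      case True
      then show ?thesis using fun_cong[OF eq, of i] by simp
    next
      case False
      then have "i \<notin> keys k" "i \<notin> keys l" using D by auto
      then show ?thesis by (simp add: in_keys_iff)
    qed
  qed
  moreover have "?r ` ?D \<subseteq> (\<Pi>\<^sub>E i\<in>V. {..<N})" by (auto simp: PiE_def Pi_def)
  moreover have "finite (\<Pi>\<^sub>E i\<in>V. {..<N})" using assms by (intro finite_PiE) auto
  ultimately show ?thesis by (meson finite_imageD finite_subset)
qed

lemma mfps_finite_support:
  assumes "finite A" "\<And>m. mfps_nth p m \<noteq> 0 \<Longrightarrow> m \<in> A"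
  shows "p = (\<Sum>m\<in>A. mfps_scale (mfps_nth p m) (mfps_mon m))"
proof (rule mfps_eqI)
  fix k
  have "mfps_nth (\<Sum>m\<in>A. mfps_scale (mfps_nth p m) (mfps_mon m)) k = (\<Sum>m\<in>A. if k = m then mfps_nth p m else 0)"
    by (simp add: nth_sum nth_mon if_distrib[of "\<lambda>x. _ * x"] cong: if_cong)
  also have "\<dots> = mfps_nth p k" using assms by auto
  finally show "mfps_nth p k = mfps_nth (\<Sum>m\<in>A. mfps_scale (mfps_nth p m) (mfps_mon m)) k" by simp
qed

subsection \<open>Ideals as sets of linear combinations\<close>

definition subring :: "'a::comm_ring_1 set \<Rightarrow> bool" where
  "subring R \<longleftrightarrow> 0 \<in> R \<and> 1 \<in> R \<and> (\<forall>a\<in>R. \<forall>b\<in>R. a + b \<in> R \<and> a * b \<in> R)"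

text \<open>Unlike in \<open>ideal_gen\<close>, there is one coefficient per index, so membership
  supplies a witness of fixed shape.\<close>

definition lincomb :: "'a::comm_ring_1 set \<Rightarrow> ('i \<Rightarrow> 'a) \<Rightarrow> 'i set \<Rightarrow> 'a set" where
  "lincomb R G A = {\<Sum>j\<in>A. h j * G j | h. \<forall>j\<in>A. h j \<in> R}"

lemma subring_conv: "subring (convergent_series V)"
  by (simp add: subring_def conv_0 conv_1 conv_add conv_mult)

lemma subring_polys: "subring (polys n)"
  by (simp add: subring_def polys_add polys_mult)

lemma subring_sum: "subring R \<Longrightarrow> (\<And>i. i \<in> A \<Longrightarrow> f i \<in> R) \<Longrightarrow> sum f A \<in> R"
  by (induction A rule: infinite_finite_induct) (auto simp: subring_def)

lemma lincombI: "(\<And>j. j \<in> A \<Longrightarrow> h j \<in> R) \<Longrightarrow> x = (\<Sum>j\<in>A. h j * G j) \<Longrightarrow> x \<in> lincomb R G A"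
  by (auto simp: lincomb_def)

lemma lincomb_0: "subring R \<Longrightarrow> 0 \<in> lincomb R G A"
  by (rule lincombI[of _ "\<lambda>_. 0"]) (auto simp: subring_def)

lemma lincomb_add:
  assumes "subring R" "x \<in> lincomb R G A" "y \<in> lincomb R G A"
  shows "x + y \<in> lincomb R G A"
proof -
  obtain h k where "x = (\<Sum>j\<in>A. h j * G j)" "\<forall>j\<in>A. h j \<in> R" "y = (\<Sum>j\<in>A. k j * G j)" "\<forall>j\<in>A. k j \<in> R"
    using assms(2,3) by (auto simp: lincomb_def)
  then show ?thesis
    using assms(1) by (intro lincombI[of _ "\<lambda>j. h j + k j"]) (auto simp: subring_def distrib_right sum.distrib)
qed

lemma lincomb_mult:
  assumes "subring R" "a \<in> R" "x \<in> lincomb R G A"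
  shows "a * x \<in> lincomb R G A"
proof -
  obtain h where "x = (\<Sum>j\<in>A. h j * G j)" "\<forall>j\<in>A. h j \<in> R"
    using assms(3) by (auto simp: lincomb_def)
  then show ?thesis
    using assms(1,2) by (intro lincombI[of _ "\<lambda>j. a * h j"]) (auto simp: subring_def sum_distrib_left mult.assoc)
qed

lemma lincomb_sum: "subring R \<Longrightarrow> (\<And>i. i \<in> I \<Longrightarrow> x i \<in> lincomb R G A) \<Longrightarrow> sum x I \<in> lincomb R G A"
  by (induction I rule: infinite_finite_induct) (auto intro: lincomb_0 lincomb_add)

lemma lincomb_base:
  assumes "subring R" "finite A" "j \<in> A"
  shows "G j \<in> lincomb R G A"
proof (rule lincombI[of _ "\<lambda>i. if i = j then 1 else 0"])
  have "(\<Sum>i\<in>A. (if i = j then 1 else 0) * G i) = (\<Sum>i\<in>A. if i = j then G i else 0)"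
    by (intro sum.cong) auto
  then show "G j = (\<Sum>i\<in>A. (if i = j then 1 else 0) * G i)" using assms by simp
qed (use assms in \<open>auto simp: subring_def\<close>)

lemma lincomb_subset:
  assumes "subring R" "\<And>j. j \<in> A \<Longrightarrow> G j \<in> lincomb R G' A'"
  shows "lincomb R G A \<subseteq> lincomb R G' A'"
  using assms by (auto simp: lincomb_def[of R G A] intro!: lincomb_sum lincomb_mult)

lemma ideal_gen_image:
  assumes R: "subring R" and A: "finite A"
  shows "ideal_gen R (G ` A) = lincomb R G A"
proof (rule equalityI; rule subsetI)
  fix x assume "x \<in> ideal_gen R (G ` A)"
  then obtain t h where t: "x = (\<Sum>g\<in>t. h g * g)" "finite t" "t \<subseteq> G ` A" "h ` t \<subseteq> R"
    by (auto simp: ideal_gen_def)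
  have "h g * g \<in> lincomb R G A" if g: "g \<in> t" for g
  proof -
    obtain j where "j \<in> A" "g = G j" using t(3) g by blast
    then show ?thesis using lincomb_base[OF R A] t(4) g by (auto intro!: lincomb_mult[OF R])
  qed
  then show "x \<in> lincomb R G A" unfolding t(1) by (rule lincomb_sum[OF R])
next
  fix x assume "x \<in> lincomb R G A"
  then obtain h where h: "x = (\<Sum>j\<in>A. h j * G j)" "\<forall>j\<in>A. h j \<in> R" by (auto simp: lincomb_def)
  \<comment> \<open>Different indices may carry the same generator; their coefficients are
    collected.\<close>
  define k where "k g = (\<Sum>j | j \<in> A \<and> G j = g. h j)" for g
  have "x = (\<Sum>g\<in>G ` A. \<Sum>j | j \<in> A \<and> G j = g. h j * G j)"
    unfolding h(1) by (rule sum.image_gen[OF A])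
  also have "\<dots> = (\<Sum>g\<in>G ` A. k g * g)"
    unfolding k_def sum_distrib_right by (intro sum.cong refl) auto
  finally have "x = (\<Sum>g\<in>G ` A. k g * g)" .
  moreover have "k ` G ` A \<subseteq> R" unfolding k_def using h(2) by (auto intro!: subring_sum[OF R])
  ultimately show "x \<in> ideal_gen R (G ` A)" unfolding ideal_gen_def using A by blast
qed

subsection \<open>Derivatives\<close>

text \<open>Multiplication by a variable and differentiation are expressed on arbitrary coefficient
  functions, so that polynomials and power series share one product rule.\<close>

definition shift_coeff :: "nat \<Rightarrow> (monom \<Rightarrow> complex) \<Rightarrow> monom \<Rightarrow> complex" where
  "shift_coeff t a m = (if lookup m t = 0 then 0 else a (m - single t 1))"

definition deriv_coeff :: "nat \<Rightarrow> (monom \<Rightarrow> complex) \<Rightarrow> monom \<Rightarrow> complex" where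
  "deriv_coeff j a m = of_nat (lookup m j + 1) * a (m + single j 1)"

lemma deriv_shift_coeff:
  "deriv_coeff j (shift_coeff t a) m = (if j = t then a m else 0) + shift_coeff t (deriv_coeff j a) m"
proof (cases "lookup m t = 0")
  case True
  have "lookup (m + single j 1) t = 0" if "j \<noteq> t" using True that by (simp add: lookup_add lookup_single)
  then show ?thesis using True by (simp add: deriv_coeff_def shift_coeff_def lookup_add)
next
  case False
  have 1: "m + single j 1 - single t 1 = m - single t 1 + single j 1"
    by (rule poly_mapping_eqI) (use False in \<open>auto simp: lookup_add lookup_minus lookup_single when_def\<close>)
  have 2: "m - single t 1 + single t 1 = m"
    by (rule poly_mapping_eqI) (use False in \<open>auto simp: lookup_add lookup_minus lookup_single when_def\<close>)
  have "lookup (m - single t 1) j = (if j = t then lookup m j - 1 else lookup m j)"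
    by (simp add: lookup_minus lookup_single)
  then show ?thesis using False 1 2
    by (cases "j = t") (auto simp: deriv_coeff_def shift_coeff_def lookup_add algebra_simps of_nat_diff)
qed

lemma lookup_var_mult_shift: "lookup (mpoly_var t * p) = shift_coeff t (lookup p)"
proof
  fix m
  show "lookup (mpoly_var t * p) m = shift_coeff t (lookup p) m"
  proof (cases "lookup m t = 0")
    case True
    have "m \<notin> keys (mpoly_var t * p)"
    proof
      assume "m \<in> keys (mpoly_var t * p)"
      then obtain a b where "m = a + b" "a \<in> keys (mpoly_var t)" using keys_mult_subset by blast
      then show False using True by (auto simp: mpoly_var_def lookup_add)
    qed
    then show ?thesis using True by (simp add: shift_coeff_def in_keys_iff)
  next
    case False
    have "m = single t 1 + (m - single t 1)"
      by (rule poly_mapping_eqI) (use False in \<open>auto simp: lookup_add lookup_minus lookup_single when_def\<close>)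
    then show ?thesis using lookup_var_mult[of t p "m - single t 1"] False by (simp add: shift_coeff_def)
  qed
qed

lemma nth_var_mult_shift: "mfps_nth (mfps_var t * a) = shift_coeff t (mfps_nth a)"
proof
  fix m
  show "mfps_nth (mfps_var t * a) m = shift_coeff t (mfps_nth a) m"
  proof (cases "lookup m t = 0")
    case True
    then have "m \<noteq> single t 1 + q" for q by (auto simp: lookup_add)
    then show ?thesis using True by (simp add: shift_coeff_def mfps_var_mon nth_mon_mult_0)
  next
    case False
    have "m = single t 1 + (m - single t 1)"
      by (rule poly_mapping_eqI) (use False in \<open>auto simp: lookup_add lookup_minus lookup_single when_def\<close>)
    then show ?thesis using nth_mon_mult[of "single t 1" a "m - single t 1"] False
      by (simp add: shift_coeff_def mfps_var_mon)
  qed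
qed

lemma lookup_deriv: "lookup (mpoly_deriv j p) = deriv_coeff j (lookup p)"
  by (simp add: mpoly_deriv.rep_eq deriv_coeff_def fun_eq_iff)

lemma nth_deriv: "mfps_nth (mfps_deriv j a) = deriv_coeff j (mfps_nth a)"
  by (simp add: mfps_deriv.rep_eq deriv_coeff_def fun_eq_iff)

lemma mpoly_deriv_var_mult:
  "mpoly_deriv j (mpoly_var t * p) = (if j = t then p else 0) + mpoly_var t * mpoly_deriv j p"
  by (rule poly_mapping_eqI)
    (simp add: lookup_deriv lookup_var_mult_shift deriv_shift_coeff lookup_add)

lemma mfps_deriv_var_mult:
  "mfps_deriv j (mfps_var t * a) = (if j = t then a else 0) + mfps_var t * mfps_deriv j a"
  by (rule mfps_eqI) (simp add: nth_deriv nth_var_mult_shift deriv_shift_coeff)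

lemma mpoly_deriv_add: "mpoly_deriv j (p + q) = mpoly_deriv j p + mpoly_deriv j q"
  by (rule poly_mapping_eqI) (simp add: lookup_deriv deriv_coeff_def lookup_add distrib_left)

lemma mfps_deriv_add: "mfps_deriv j (a + b) = mfps_deriv j a + mfps_deriv j b"
  by (rule mfps_eqI) (simp add: nth_deriv deriv_coeff_def distrib_left)

lemma mfps_deriv_scale: "mfps_deriv j (mfps_scale c a) = mfps_scale c (mfps_deriv j a)"
  by (rule mfps_eqI) (simp add: nth_deriv deriv_coeff_def)

lemma mpoly_deriv_0 [simp]: "mpoly_deriv j 0 = 0"
  by (rule poly_mapping_eqI) (simp add: lookup_deriv deriv_coeff_def)

lemma mfps_deriv_0 [simp]: "mfps_deriv j 0 = 0"
  by (rule mfps_eqI) (simp add: nth_deriv deriv_coeff_def)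

lemma add_single_nonzero: "m + single j 1 \<noteq> (0 :: monom)"
proof
  assume "m + single j 1 = 0"
  then have "mdeg (m + single j 1) = 0" by simp
  then show False by (simp add: mdeg_add)
qed

lemma mpoly_deriv_const: "mpoly_deriv j (single 0 c) = 0"
  by (rule poly_mapping_eqI)
    (simp add: lookup_deriv deriv_coeff_def lookup_single_not_eq[OF add_single_nonzero[symmetric]] del: One_nat_def)

lemma mfps_deriv_const: "mfps_deriv j (mfps_const c) = 0"
  by (rule mfps_eqI)
    (simp add: nth_deriv deriv_coeff_def mfps_const.rep_eq add_single_nonzero del: One_nat_def)

lemma homog_deriv:
  assumes h: "h \<in> homog n k"
  shows "mpoly_deriv j h \<in> homog n (k - 1)"
proof (rule homogI)
  fix m assume "m \<in> keys (mpoly_deriv j h)"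
  then have "m + single j 1 \<in> keys h" by (simp add: in_keys_iff lookup_deriv deriv_coeff_def)
  from homog_vars[OF h this] homog_mdeg[OF h this]
  show "keys m \<subseteq> {..n} \<and> int (mdeg m) = k - 1" by (simp add: keys_add_monom mdeg_add)
qed

text \<open>Here the predicate may refer to the degree, as is needed for Euler's formula.\<close>

lemma homog_nat_induct [consumes 1, case_names const add var]:
  assumes "h \<in> homog n (int k)" and "\<And>c. P 0 (single 0 c)"
    and "\<And>k p q. p \<in> homog n (int k) \<Longrightarrow> q \<in> homog n (int k) \<Longrightarrow> P k p \<Longrightarrow> P k q \<Longrightarrow> P k (p + q)"
    and "\<And>k j u. j \<le> n \<Longrightarrow> u \<in> homog n (int k) \<Longrightarrow> P k u \<Longrightarrow> P (Suc k) (mpoly_var j * u)"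
  shows "P k h"
  using assms(1)
proof (induction k arbitrary: h)
  case 0
  then show ?case using homog_zero_degree[of h n] assms(2) by auto
next
  case (Suc k)
  have hom: "mpoly_var j * u \<in> homog n (int (Suc k))" if "j \<le> n" "u \<in> homog n (int k)" for j u
    by (rule homog_mult'[OF mpoly_var_in_homog[OF that(1)] that(2)]) simp
  have "h \<in> homog n (int k + 1)" using Suc.prems by (simp add: algebra_simps)
  then have "h \<in> homog n (int (Suc k)) \<and> P (Suc k) h"
  proof (induction rule: homog_step_induct)
    case zero
    \<comment> \<open>In positive degree the zero form is covered by the variable case.\<close>
    have "P (Suc k) (mpoly_var 0 * 0)" by (rule assms(4)) (auto intro: Suc.IH)
    then show ?case by simp
  next
    case (add p q)
    then show ?case using assms(3)[of p "Suc k" q] homog_add by auto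
  next
    case (var j u)
    then show ?case using assms(4) Suc.IH hom by auto
  qed simp
  then show ?case by simp
qed

lemma euler: "h \<in> homog n (int k) \<Longrightarrow> (\<Sum>j\<le>n. mpoly_var j * mpoly_deriv j h) = mpoly_scale (of_nat k) h"
proof (induction rule: homog_nat_induct)
  case (const c)
  then show ?case by (simp add: mpoly_deriv_const)
next
  case (add k p q)
  then show ?case by (simp add: mpoly_deriv_add distrib_left sum.distrib mpoly.scale_right_distrib)
next
  case (var k t u)
  have "(\<Sum>j\<le>n. mpoly_var j * mpoly_deriv j (mpoly_var t * u))
     = (\<Sum>j\<le>n. (if j = t then mpoly_var t * u else 0) + mpoly_var t * (mpoly_var j * mpoly_deriv j u))"
    unfolding mpoly_deriv_var_mult by (intro sum.cong refl) (auto simp: algebra_simps)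
  also have "\<dots> = mpoly_var t * u + mpoly_var t * (\<Sum>j\<le>n. mpoly_var j * mpoly_deriv j u)"
    using var(1) by (simp add: sum.distrib sum_distrib_left)
  also have "\<dots> = mpoly_scale (of_nat (Suc k)) (mpoly_var t * u)"
    by (simp add: var.IH mpoly.scale_left_distrib mpoly_scale_mult_right distrib_left)
  finally show ?case .
qed

subsection \<open>Germs in affine charts\<close>

text \<open>\<open>local_equation\<close> is a ring homomorphism on all polynomials. From here on it
  serves as the germ of an arbitrary form, not only of the equation \<open>f\<close>.\<close>

lemmas germ_add = const_hom.subst_add[where x = "\<lambda>j. if j = i then 1 else mfps_const (p j / p i) + mfps_var j" for i p,
    folded local_equation_def]
lemmas germ_mult = const_hom.subst_mult[where x = "\<lambda>j. if j = i then 1 else mfps_const (p j / p i) + mfps_var j" for i p,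
    folded local_equation_def]
lemmas germ_diff = const_hom.subst_diff[where x = "\<lambda>j. if j = i then 1 else mfps_const (p j / p i) + mfps_var j" for i p,
    folded local_equation_def]
lemmas germ_sum = const_hom.subst_sum[where x = "\<lambda>j. if j = i then 1 else mfps_const (p j / p i) + mfps_var j" for i p,
    folded local_equation_def]
lemmas germ_prod = const_hom.subst_prod[where x = "\<lambda>j. if j = i then 1 else mfps_const (p j / p i) + mfps_var j" for i p,
    folded local_equation_def]
lemmas germ_power = const_hom.subst_power[where x = "\<lambda>j. if j = i then 1 else mfps_const (p j / p i) + mfps_var j" for i p,
    folded local_equation_def]

lemma germ_0 [simp]: "local_equation 0 i p = 0"
  unfolding local_equation_def by (rule const_hom.subst_0)

lemma germ_scale: "local_equation (mpoly_scale c h) i p = mfps_scale c (local_equation h i p)"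
  unfolding local_equation_def const_hom.subst_scale const_mult ..

lemma germ_const: "local_equation (single 0 c) i p = mfps_const c"
  unfolding local_equation_def const_hom.subst_single by simp

lemma germ_var: "local_equation (mpoly_var j) i p = (if j = i then 1 else mfps_const (p j / p i) + mfps_var j)"
  unfolding local_equation_def const_hom.subst_var ..

lemma germ_deriv:
  "h \<in> homog n (int k) \<Longrightarrow> j \<noteq> i \<Longrightarrow> mfps_deriv j (local_equation h i p) = local_equation (mpoly_deriv j h) i p"
proof (induction rule: homog_nat_induct)
  case (const c)
  then show ?case by (simp add: mpoly_deriv_const mfps_deriv_const germ_const)
next
  case (add k q r)
  then show ?case by (simp add: mpoly_deriv_add mfps_deriv_add germ_add)
next
  case (var k t u)
  then show ?case
    by (simp add: mpoly_deriv_var_mult germ_mult germ_add germ_var distrib_right mfps_deriv_add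
        mfps_deriv_var_mult const_mult mfps_deriv_scale)
qed

lemma germ_conv:
  assumes "h \<in> polys n"
  shows "local_equation h i p \<in> convergent_series ({..n} - {i})"
  using assms
proof (induction rule: polys_monom_induct)
  case (monom m c)
  have "(if j = i then 1 else mfps_const (p j / p i) + mfps_var j) \<in> convergent_series ({..n} - {i})"
    if "j \<in> keys m" for j
    using that monom(1) by (auto intro!: conv_1 conv_add conv_const conv_var)
  then show ?case unfolding local_equation_def const_hom.subst_single monom_val_def
    by (intro conv_mult conv_const conv_prod conv_power)
qed (auto simp: germ_add conv_0 conv_add)

lemma nth_0_prod: "mfps_nth (prod f A) 0 = (\<Prod>a\<in>A. mfps_nth (f a) 0)"
  by (induction A rule: infinite_finite_induct) (simp_all add: nth_0_mult nth_one)

lemma nth_0_power: "mfps_nth (a ^ k) 0 = mfps_nth a 0 ^ k"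
  by (induction k) (simp_all add: nth_0_mult nth_one)

text \<open>The constant term is the value at the representative whose \<open>i\<close>-th
  coordinate is 1. Hence the germ is a unit exactly if the form does not vanish at the
  point.\<close>

lemma germ_nth_0:
  assumes h: "h \<in> homog n (int k)" and i: "i \<le> n" "p i \<noteq> 0"
  shows "mfps_nth (local_equation h i p) 0 = (1 / p i) ^ k * mpoly_eval h p"
proof -
  let ?y = "\<lambda>j. if j = i then 1 else p j / p i"
  have *: "mfps_nth (if j = i then 1 else mfps_const (p j / p i) + mfps_var j) 0 = ?y j" for j
    using add_single_nonzero[of 0 j] by (auto simp: nth_one mfps_const.rep_eq mfps_var_mon nth_mon)
  have "mfps_nth (local_equation h i p) 0 = mpoly_eval h ?y"
    unfolding local_equation_def mpoly_subst_def
    by (simp add: nth_sum nth_0_mult nth_0_prod nth_0_power * mfps_const.rep_eq)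
  also have "\<dots> = (1 / p i) ^ nat (int k) * mpoly_eval h p"
    by (rule eval_homog[OF h]) (use i in auto)
  finally show ?thesis by simp
qed

definition local_ideal :: "nat \<Rightarrow> (nat \<Rightarrow> mpoly) \<Rightarrow> nat \<Rightarrow> (nat \<Rightarrow> complex) \<Rightarrow> mfps set" where
  "local_ideal n F i p = lincomb (convergent_series ({..n} - {i})) (\<lambda>j. local_equation (F j) i p) {..n}"

text \<open>In the chart \<open>x_i = 1\<close>, Euler's formula writes \<open>d\<close> times the
  local equation as a combination of the germs of all partials, in which the \<open>i\<close>-th has
  coefficient 1. It thus expresses the local equation by the partials, and the \<open>i\<close>-th
  partial by the local equation and its derivatives.\<close>

lemma tjurina_ideal_eq:
  assumes f: "f \<in> homog n (int d)" and d: "d \<ge> 1" and i: "i \<le> n"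
  shows "ideal_gen (convergent_series ({..n} - {i}))
      (insert (local_equation f i p) {mfps_deriv j (local_equation f i p) | j. j \<in> {..n} - {i}})
    = local_ideal n (\<lambda>j. mpoly_deriv j f) i p"
proof -
  let ?R = "convergent_series ({..n} - {i})" and ?g = "local_equation f i p"
  let ?G = "\<lambda>j. if j = i then ?g else mfps_deriv j ?g" and ?F = "\<lambda>j. local_equation (mpoly_deriv j f) i p"
  note R = subring_conv[of "{..n} - {i}"]
  have im: "insert ?g {mfps_deriv j ?g | j. j \<in> {..n} - {i}} = ?G ` {..n}"
    using i by (auto simp: image_iff)
  have GF: "?G j = ?F j" if "j \<noteq> i" for j using that germ_deriv[OF f that] by simp
  have x: "local_equation (mpoly_var j) i p \<in> ?R" if "j \<le> n" for j
    using that by (intro germ_conv homog_polys[of _ n 1]) auto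
  have euler': "(\<Sum>j\<le>n. local_equation (mpoly_var j) i p * ?F j) = mfps_scale (of_nat d) ?g"
    using arg_cong[OF euler[OF f], of "\<lambda>h. local_equation h i p"] by (simp add: germ_sum germ_mult germ_scale)
  have "lincomb ?R ?G {..n} \<subseteq> lincomb ?R ?F {..n}"
  proof (rule lincomb_subset[OF R])
    fix j assume j: "j \<in> {..n}"
    show "?G j \<in> lincomb ?R ?F {..n}"
    proof (cases "j = i")
      case True
      have "?g = mfps_const (1 / of_nat d) * (\<Sum>j\<le>n. local_equation (mpoly_var j) i p * ?F j)"
        using d by (simp add: euler' const_mult)
      moreover have "(\<Sum>j\<le>n. local_equation (mpoly_var j) i p * ?F j) \<in> lincomb ?R ?F {..n}"
        by (rule lincombI[of _ "\<lambda>j. local_equation (mpoly_var j) i p"]) (use x in auto)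
      ultimately show ?thesis using True lincomb_mult[OF R conv_const] by simp
    next
      case False
      show ?thesis unfolding GF[OF False] by (rule lincomb_base[OF R]) (use j in auto)
    qed
  qed
  moreover have "lincomb ?R ?F {..n} \<subseteq> lincomb ?R ?G {..n}"
  proof (rule lincomb_subset[OF R])
    fix j assume j: "j \<in> {..n}"
    have base: "?G j \<in> lincomb ?R ?G {..n}" if "j \<le> n" for j by (rule lincomb_base[OF R]) (use that in auto)
    show "?F j \<in> lincomb ?R ?G {..n}"
    proof (cases "j = i")
      case False
      then show ?thesis using base[of j] j GF[OF False] by simp
    next
      case True
      let ?s = "\<Sum>j\<in>{..n} - {i}. local_equation (mpoly_var j) i p * ?F j"
      have "mfps_scale (of_nat d) ?g = ?F i + ?s"
        unfolding euler'[symmetric] using i by (subst sum.remove[of _ i]) (auto simp: germ_var)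
      then have "?F i = mfps_const (of_nat d) * ?g + mfps_const (- 1) * ?s"
        by (simp add: const_mult algebra_simps)
      moreover have "?g \<in> lincomb ?R ?G {..n}" using base[OF i] by simp
      moreover have "?s \<in> lincomb ?R ?G {..n}"
      proof (intro lincomb_sum[OF R] lincomb_mult[OF R] x)
        fix j assume "j \<in> {..n} - {i}"
        then show "?F j \<in> lincomb ?R ?G {..n}" using base[of j] GF[of j] by simp
      qed auto
      ultimately have "?F i \<in> lincomb ?R ?G {..n}"
        using lincomb_add[OF R lincomb_mult[OF R conv_const] lincomb_mult[OF R conv_const]] by simp
      then show ?thesis using True by simp
    qed
  qed
  ultimately show ?thesis
    unfolding im local_ideal_def ideal_gen_image[OF R finite_atMost] by blast
qed

subsection \<open>Affine coordinates centred at a point\<close>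

text \<open>The linear form that becomes the local coordinate \<open>u_j\<close> in the chart
  \<open>x_i = 1\<close>.\<close>

definition centred_var :: "nat \<Rightarrow> (nat \<Rightarrow> complex) \<Rightarrow> nat \<Rightarrow> mpoly" where
  "centred_var i p j = mpoly_var j - mpoly_scale (p j / p i) (mpoly_var i)"

text \<open>The local monomial \<open>u ^ m\<close> homogenized to degree \<open>k\<close> by powers
  of \<open>x_i\<close>; it has that degree provided \<open>mdeg m \<le> k\<close>.\<close>

definition centred_monom :: "nat \<Rightarrow> (nat \<Rightarrow> complex) \<Rightarrow> int \<Rightarrow> monom \<Rightarrow> mpoly" where
  "centred_monom i p k m = monom_val (centred_var i p) m * mpoly_var i ^ nat (k - int (mdeg m))"

lemma centred_var_homog: "i \<le> n \<Longrightarrow> j \<le> n \<Longrightarrow> centred_var i p j \<in> homog n 1"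
  unfolding centred_var_def by (intro homog_diff homog_scale) auto

lemma eval_centred_var: "p i \<noteq> 0 \<Longrightarrow> mpoly_eval (centred_var i p j) p = 0"
  by (simp add: centred_var_def eval.subst_diff eval.subst_scale eval.subst_var)

lemma germ_centred_var: "j \<noteq> i \<Longrightarrow> local_equation (centred_var i p j) i p = mfps_var j"
  by (simp add: centred_var_def germ_diff germ_scale germ_var const_mult[of _ 1, symmetric])

lemma centred_monom_homog:
  assumes i: "i \<le> n" and m: "keys m \<subseteq> {..n}" "int (mdeg m) \<le> k"
  shows "centred_monom i p k m \<in> homog n k"
proof -
  have "centred_var i p j ^ lookup m j \<in> homog n (int (lookup m j))" if "j \<in> keys m" for j
    using homog_power[OF centred_var_homog[OF i, of j p], of "lookup m j"] that m by auto
  then have "monom_val (centred_var i p) m \<in> homog n (\<Sum>j\<in>keys m. int (lookup m j))"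
    unfolding monom_val_def by (intro homog_prod) auto
  then have "monom_val (centred_var i p) m \<in> homog n (int (mdeg m))" by (simp add: mdeg_def)
  then show ?thesis
    unfolding centred_monom_def using homog_power[OF mpoly_var_in_homog[OF i], of "nat (k - int (mdeg m))"] m
    by (intro homog_mult') auto
qed

lemma germ_centred_monom:
  assumes "i \<notin> keys m"
  shows "local_equation (centred_monom i p k m) i p = mfps_mon m"
proof -
  have "local_equation (monom_val (centred_var i p) m) i p = monom_val mfps_var m"
    unfolding monom_val_def germ_prod germ_power using assms
    by (intro prod.cong refl) (metis germ_centred_var)
  then show ?thesis
    by (simp add: centred_monom_def germ_mult germ_power germ_var monom_val_mfps_var)
qed

lemma finite_monoms_deg:
  assumes "finite V"
  shows "finite {m :: monom. keys m \<subseteq> V \<and> int (mdeg m) \<le> k}"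
proof (rule finite_subset[OF _ finite_monoms_below[OF assms, of "Suc (nat k)"]], rule subsetI)
  fix m :: monom assume m: "m \<in> {m. keys m \<subseteq> V \<and> int (mdeg m) \<le> k}"
  have "lookup m j \<le> mdeg m" if "j \<in> V" for j
    using m assms that by (auto simp: mdeg_superset[OF assms] intro!: member_le_sum)
  then show "m \<in> {m. keys m \<subseteq> V \<and> (\<forall>j\<in>V. lookup m j < Suc (nat k))}" using m by fastforce
qed

text \<open>Repeated substitution of \<open>x_j = y_j + (p_j / p_i) x_i\<close>, where
  \<open>y_j\<close> is the centred variable.\<close>

lemma homog_centred_span:
  assumes i: "i \<le> n"
  shows "h \<in> homog n (int k) \<Longrightarrow>
    h \<in> mpoly.span (centred_monom i p (int k) ` {m. keys m \<subseteq> {..n} - {i} \<and> int (mdeg m) \<le> int k})"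
proof (induction rule: homog_nat_induct)
  case (const c)
  have "centred_monom i p 0 0 = 1" by (simp add: centred_monom_def)
  then have "1 \<in> mpoly.span (centred_monom i p (int 0) ` {m. keys m \<subseteq> {..n} - {i} \<and> int (mdeg m) \<le> int 0})"
    by (intro mpoly.span_base) (auto simp: image_iff intro!: exI[of _ 0])
  then have "mpoly_scale c 1 \<in> mpoly.span (centred_monom i p (int 0) ` {m. keys m \<subseteq> {..n} - {i} \<and> int (mdeg m) \<le> int 0})"
    by (rule mpoly.span_scale)
  moreover have "mpoly_scale c 1 = single 0 c" by (simp add: mpoly_scale_def)
  ultimately show ?case by simp
next
  case (var k j u)
  let ?V = "{..n} - {i}"
  let ?S = "\<lambda>k. mpoly.span (centred_monom i p (int k) ` {m. keys m \<subseteq> ?V \<and> int (mdeg m) \<le> int k})"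
  have gen: "centred_monom i p (int k) m \<in> ?S k" if "keys m \<subseteq> ?V" "mdeg m \<le> k" for m k
    using that by (intro mpoly.span_base) auto
  have xi: "mpoly_var i * centred_monom i p (int k) m \<in> ?S (Suc k)" if m: "keys m \<subseteq> ?V" "mdeg m \<le> k" for m
  proof -
    have "nat (int (Suc k) - int (mdeg m)) = Suc (nat (int k - int (mdeg m)))" using m by simp
    then have "mpoly_var i * centred_monom i p (int k) m = centred_monom i p (int (Suc k)) m"
      by (simp add: centred_monom_def ac_simps)
    then show ?thesis using gen[of m "Suc k"] m by simp
  qed
  have "mpoly_var j * centred_monom i p (int k) m \<in> ?S (Suc k)" if m: "keys m \<subseteq> ?V" "mdeg m \<le> k" for m
  proof (cases "j = i")
    case True
    then show ?thesis using xi m by simp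
  next
    case False
    have "nat (int (Suc k) - int (mdeg (single j 1 + m))) = nat (int k - int (mdeg m))"
      by (simp add: mdeg_add)
    then have 1: "centred_var i p j * centred_monom i p (int k) m = centred_monom i p (int (Suc k)) (single j 1 + m)"
      by (simp add: centred_monom_def monom_val_add ac_simps)
    have "keys (single j 1 + m) \<subseteq> ?V" using m False var(1) by (auto simp: keys_add_monom)
    moreover have "mdeg (single j 1 + m) \<le> Suc k" using m by (simp add: mdeg_add)
    ultimately have "centred_var i p j * centred_monom i p (int k) m \<in> ?S (Suc k)" unfolding 1 by (rule gen)
    moreover have "mpoly_scale (p j / p i) (mpoly_var i * centred_monom i p (int k) m) \<in> ?S (Suc k)"
      using xi[OF m] by (rule mpoly.span_scale)
    ultimately have "centred_var i p j * centred_monom i p (int k) m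
        + mpoly_scale (p j / p i) (mpoly_var i * centred_monom i p (int k) m) \<in> ?S (Suc k)"
      by (rule mpoly.span_add)
    then show ?thesis by (simp add: centred_var_def left_diff_distrib mpoly_scale_mult_left)
  qed
  then have g: "mpoly_var j * x \<in> ?S (Suc k)"
    if "x \<in> centred_monom i p (int k) ` {m. keys m \<subseteq> ?V \<and> int (mdeg m) \<le> int k}" for x
    using that by auto
  from var.IH show ?case
  proof (induction rule: mpoly.span_induct_alt)
    case (step c x y)
    have "mpoly_scale c (mpoly_var j * x) + mpoly_var j * y \<in> ?S (Suc k)"
      using g[OF step(1)] step(2) by (intro mpoly.span_add mpoly.span_scale)
    then show ?case by (simp add: distrib_left mpoly_scale_mult_right)
  qed (simp add: mpoly.span_zero)
qed (rule mpoly.span_add)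

lemma centred_expansion:
  assumes i: "i \<le> n" and h: "h \<in> homog n (int k)"
  obtains c where "h = (\<Sum>m | keys m \<subseteq> {..n} - {i} \<and> int (mdeg m) \<le> int k. mpoly_scale (c m) (centred_monom i p (int k) m))"
proof -
  let ?A = "{m :: monom. keys m \<subseteq> {..n} - {i} \<and> int (mdeg m) \<le> int k}" and ?Y = "centred_monom i p (int k)"
  have fin: "finite ?A" by (rule finite_monoms_deg) simp
  have inj: "inj_on ?Y ?A"
  proof (rule inj_onI)
    fix a b assume ab: "a \<in> ?A" "b \<in> ?A" "?Y a = ?Y b"
    then have "i \<notin> keys a" "i \<notin> keys b" by auto
    then have "mfps_mon a = mfps_mon b"
      using germ_centred_monom[of i a p "int k"] germ_centred_monom[of i b p "int k"] ab(3) by simp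
    then have "mfps_nth (mfps_mon a) a = mfps_nth (mfps_mon b) a" by simp
    then show "a = b" by (simp add: nth_mon split: if_splits)
  qed
  have "h \<in> mpoly.span (?Y ` ?A)" by (rule homog_centred_span[OF i h])
  then obtain u where "h = (\<Sum>b\<in>?Y ` ?A. mpoly_scale (u b) b)"
    using mpoly.span_finite[of "?Y ` ?A"] fin by auto
  then have "h = (\<Sum>m\<in>?A. mpoly_scale (u (?Y m)) (?Y m))" by (simp only: sum.reindex[OF inj] o_def)
  then show ?thesis by (rule that)
qed

text \<open>After division by the \<open>N\<close>-th powers of the local coordinates the remainder
  is a polynomial of bounded degree, so it can be homogenized in every sufficiently large
  degree.\<close>

lemma series_division:
  assumes i: "i \<le> n"
  obtains K where "K \<ge> 0" "\<And>a k. a \<in> convergent_series ({..n} - {i}) \<Longrightarrow> k \<ge> K \<Longrightarrow>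
    \<exists>h\<in>homog n k. \<exists>b. (\<forall>j\<in>{..n} - {i}. b j \<in> convergent_series ({..n} - {i})) \<and>
      a = local_equation h i p + (\<Sum>j\<in>{..n} - {i}. mfps_var j ^ N * b j)"
proof -
  let ?V = "{..n} - {i}"
  define A where "A = {m :: monom. keys m \<subseteq> ?V \<and> (\<forall>j\<in>?V. lookup m j < N)}"
  have A: "finite A" unfolding A_def by (rule finite_monoms_below) simp
  define K where "K = int (Max (insert 0 (mdeg ` A)))"
  have mK: "int (mdeg m) \<le> K" if "m \<in> A" for m using that A by (simp add: K_def)
  show ?thesis
  proof (rule that[of K])
    show "0 \<le> K" by (simp add: K_def)
    fix a k assume a: "a \<in> convergent_series ?V" and k: "K \<le> k"
    obtain q b where qb: "a = q + (\<Sum>j\<in>?V. mfps_var j ^ N * b j)" "q \<in> convergent_series ?V"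
      "\<forall>j\<in>?V. b j \<in> convergent_series ?V" "\<And>m. mfps_nth q m \<noteq> 0 \<Longrightarrow> \<forall>j\<in>?V. lookup m j < N"
      using conv_divide[of ?V ?V a N] a by auto
    have qA: "q = (\<Sum>m\<in>A. mfps_scale (mfps_nth q m) (mfps_mon m))"
      using qb(2,4) by (intro mfps_finite_support A) (auto simp: A_def convergent_series_iff)
    define h where "h = (\<Sum>m\<in>A. mpoly_scale (mfps_nth q m) (centred_monom i p k m))"
    have "h \<in> homog n k" unfolding h_def
    proof (intro homog_sum homog_scale centred_monom_homog[OF i])
      fix m assume m: "m \<in> A"
      then show "keys m \<subseteq> {..n}" by (auto simp: A_def)
      show "int (mdeg m) \<le> k" using mK[OF m] k by simp
    qed
    moreover have "local_equation h i p = q"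
    proof -
      have "local_equation h i p = (\<Sum>m\<in>A. mfps_scale (mfps_nth q m) (mfps_mon m))"
        unfolding h_def germ_sum germ_scale by (intro sum.cong refl, subst germ_centred_monom) (auto simp: A_def)
      then show ?thesis using qA by simp
    qed
    ultimately show "\<exists>h\<in>homog n k. \<exists>b. (\<forall>j\<in>?V. b j \<in> convergent_series ?V) \<and>
        a = local_equation h i p + (\<Sum>j\<in>?V. mfps_var j ^ N * b j)"
      using qb(1,3) by (intro bexI[of _ h] exI[of _ b]) auto
  qed
qed

text \<open>The coefficients of \<open>h\<close> in the centred monomials are those of its germ.
  Hence only monomials divisible by some \<open>u_j ^ N\<close> occur, and multiplication by
  \<open>s\<close> sends the corresponding forms into \<open>J\<close>.\<close>

lemma mem_if_germ_high_order:
  assumes J: "graded n J" and i: "i \<le> n" and s: "s \<in> homog n a"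
    and y: "\<And>j. j \<in> {..n} - {i} \<Longrightarrow> s * centred_var i p j ^ N \<in> J (a + int N)"
    and h: "h \<in> homog n (int k)" "local_equation h i p = (\<Sum>j\<in>{..n} - {i}. mfps_var j ^ N * b j)"
  shows "s * h \<in> J (a + int k)"
proof -
  let ?V = "{..n} - {i}" and ?A = "{m :: monom. keys m \<subseteq> {..n} - {i} \<and> int (mdeg m) \<le> int k}"
  let ?Y = "centred_monom i p (int k)"
  obtain c where c: "h = (\<Sum>m\<in>?A. mpoly_scale (c m) (?Y m))" using centred_expansion[OF i h(1)] by blast
  have fin: "finite ?A" by (rule finite_monoms_deg) simp
  have "local_equation h i p = (\<Sum>m\<in>?A. mfps_scale (c m) (mfps_mon m))"
    unfolding c germ_sum germ_scale by (intro sum.cong refl, subst germ_centred_monom) auto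
  then have "mfps_nth (local_equation h i p) m = (\<Sum>k\<in>?A. if k = m then c k else 0)" for m
    by (simp add: nth_sum nth_mon if_distrib[of "\<lambda>x. _ * x"] eq_commute[of m] cong: if_cong)
  then have coeff: "mfps_nth (local_equation h i p) m = c m" if "m \<in> ?A" for m
    using that fin by simp
  have "s * mpoly_scale (c m) (?Y m) \<in> J (a + int k)" if m: "m \<in> ?A" for m
  proof (cases "\<exists>j\<in>?V. N \<le> lookup m j")
    case True
    then obtain j where j: "j \<in> ?V" "N \<le> lookup m j" by blast
    define m' where "m' = m - single j N"
    have mm: "m = single j N + m'"
      unfolding m'_def by (intro poly_mapping_eqI) (use j in \<open>auto simp: lookup_add lookup_minus lookup_single when_def\<close>)
    have km: "keys m' \<subseteq> {..n}" "mdeg m = N + mdeg m'"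
      using m unfolding mm by (auto simp: keys_add_monom mdeg_add)
    have "s * ?Y m = centred_monom i p (int k - int N) m' * (s * centred_var i p j ^ N)"
      by (simp add: centred_monom_def mm monom_val_add mdeg_add ac_simps diff_diff_eq)
    also have "\<dots> \<in> J (a + int k)"
      by (rule graded_mult[OF J centred_monom_homog[OF i km(1)] y[OF j(1)]]) (use m km in auto)
    finally have "mpoly_scale (c m) (s * ?Y m) \<in> J (a + int k)" by (rule graded_scale[OF J])
    then show ?thesis by (simp add: mpoly_scale_mult_right)
  next
    case False
    have "mfps_nth (mfps_var j ^ N * b j) m = 0" if "j \<in> ?V" for j
      unfolding mfps_var_power
    proof (rule nth_mon_mult_0)
      fix q show "m \<noteq> single j N + q" using False that by (force simp: lookup_add)
    qed
    then have "c m = 0" unfolding coeff[OF m, symmetric] h(2) nth_sum by (intro sum.neutral) auto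
    then show ?thesis using graded_0[OF J] by simp
  qed
  then show ?thesis unfolding c sum_distrib_left by (intro graded_sum[OF J])
qed

subsection \<open>Local and global multiplicities\<close>

text \<open>An ideal with finitely many zeros, none on the hyperplane of \<open>l\<close>; from
  degree \<open>K\<close> on, \<open>l\<close> acts injectively modulo \<open>J\<close>.\<close>

locale zero_scheme =
  fixes n :: nat and F :: "nat \<Rightarrow> mpoly" and e K :: int and l :: mpoly and J :: "int \<Rightarrow> mpoly set"
  assumes J_def: "J = gen n F (\<lambda>_. e) {..n}" and e: "e \<ge> 1"
    and F: "\<And>i. i \<le> n \<Longrightarrow> F i \<in> homog n e"
    and fin: "finite (proj_point ` {c. zero_of n J c})"
    and l: "l \<in> homog n 1" "\<And>c. zero_of n J c \<Longrightarrow> mpoly_eval l c \<noteq> 0"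
    and art: "artinian n (adj n J l 1)"
    and K: "K \<ge> 0" and stable: "\<And>k. k \<ge> K \<Longrightarrow> colon n J l 1 k \<subseteq> J k"
begin

lemma J: "graded n J"
  unfolding J_def using F by (intro graded_gen) auto

lemma l_power: "l ^ t \<in> homog n (int t)"
  using homog_power[OF l(1), of t] by simp

lemma zero_coords: "zero_of n J p \<Longrightarrow> p \<in> homog_coords n"
  by (simp add: zero_of_def)

lemma eval_proportional:
  assumes "proj_point p = proj_point q" "h \<in> homog n (int k)"
  shows "mpoly_eval h p = 0 \<longleftrightarrow> mpoly_eval h q = 0"
proof -
  obtain c where c: "c \<noteq> 0" "\<And>i. p i = c * q i" using proj_point_eqD[OF assms(1)] by blast
  have "mpoly_eval h p = c ^ nat (int k) * mpoly_eval h q" by (rule eval_homog[OF assms(2)], rule c(2), simp)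
  then show ?thesis using c(1) by simp
qed

text \<open>A product of linear forms vanishing at the other zeros but not at \<open>p\<close>,
  times \<nu>, vanishes at every zero of \<open>J\<close>. By the Nullstellensatz a power of it lies
  in \<open>J\<close> up to a factor of high degree, for which a power of \<open>l\<close> is
  taken.\<close>

lemma local_annihilator:
  assumes p: "zero_of n J p" and \<nu>: "\<nu> \<in> homog n 1" "mpoly_eval \<nu> p = 0"
  shows "\<exists>a N s. s \<in> homog n (int a) \<and> mpoly_eval s p \<noteq> 0 \<and> s * \<nu> ^ N \<in> J (int a + int N)"
proof -
  let ?Z = "{c. zero_of n J c}"
  obtain Y where Y: "Y \<subseteq> ?Z" "finite Y" "proj_point ` ?Z = proj_point ` Y"
    using finite_subset_image[OF fin, of proj_point ?Z] by blast
  define Y' where "Y' = {q \<in> Y. proj_point q \<noteq> proj_point p}"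
  have "\<exists>\<mu>. \<mu> \<in> homog n 1 \<and> mpoly_eval \<mu> q = 0 \<and> mpoly_eval \<mu> p \<noteq> 0" if "q \<in> Y'" for q
  proof -
    have "q \<in> homog_coords n" "proj_point p \<noteq> proj_point q" using that Y(1) zero_coords by (auto simp: Y'_def)
    then show ?thesis using separating_linear_form[OF zero_coords[OF p]] by blast
  qed
  then obtain \<mu> where \<mu>: "\<And>q. q \<in> Y' \<Longrightarrow> \<mu> q \<in> homog n 1 \<and> mpoly_eval (\<mu> q) q = 0 \<and> mpoly_eval (\<mu> q) p \<noteq> 0"
    by metis
  have fY': "finite Y'" using Y(2) by (simp add: Y'_def)
  define s where "s = prod \<mu> Y'"
  have "s \<in> homog n (\<Sum>q\<in>Y'. 1)" unfolding s_def using \<mu> fY' by (intro homog_prod) auto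
  then have s: "s \<in> homog n (int (card Y'))" by simp
  have sp: "mpoly_eval s p \<noteq> 0" unfolding s_def eval.subst_prod using \<mu> fY' by simp
  define \<rho> where "\<rho> = int (card Y') + 1"
  have h: "s * \<nu> \<in> homog n \<rho>" unfolding \<rho>_def by (rule homog_mult[OF s \<nu>(1)])
  have hz: "mpoly_eval (s * \<nu>) c = 0" if c: "zero_of n J c" for c
  proof (cases "proj_point c = proj_point p")
    case True
    then have "mpoly_eval \<nu> c = 0" using eval_proportional[OF True, of \<nu> 1] \<nu> by simp
    then show ?thesis by (simp add: eval.subst_mult)
  next
    case False
    obtain q where q: "q \<in> Y" "proj_point c = proj_point q" using Y(3) c by (metis (no_types, lifting) imageE image_eqI mem_Collect_eq)
    then have q': "q \<in> Y'" using False by (simp add: Y'_def)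
    have "mpoly_eval s q = 0" unfolding s_def eval.subst_prod using \<mu>[OF q'] q' fY' by (intro prod_zero) auto
    then have "mpoly_eval s c = 0" using eval_proportional[OF q(2) s] by simp
    then show ?thesis by (simp add: eval.subst_mult)
  qed
  have "\<not> avoids n (s * \<nu>) \<rho> J"
  proof
    assume av: "avoids n (s * \<nu>) \<rho> J"
    have "\<exists>c. zero_of n J c \<and> mpoly_eval (s * \<nu>) c \<noteq> 0"
      by (rule nullstellensatz[OF J h _ av]) (use l(1) art in \<open>auto simp: \<rho>_def artinian_def\<close>)
    then show False using hz by blast
  qed
  then obtain i t where it: "\<And>v. v \<in> homog n (int t) \<Longrightarrow> (s * \<nu>) ^ i * v \<in> J (int i * \<rho> + int t)"
    unfolding avoids_def by blast
  have "s ^ i * l ^ t \<in> homog n (int (i * card Y' + t))"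
    using homog_mult[OF homog_power[OF s, of i] l_power[of t]] by simp
  moreover have "mpoly_eval (s ^ i * l ^ t) p \<noteq> 0"
    using sp l(2)[OF p] by (simp add: eval.subst_mult eval.subst_power)
  moreover have "(s ^ i * l ^ t) * \<nu> ^ i \<in> J (int (i * card Y' + t) + int i)"
    using it[OF l_power] by (simp add: \<rho>_def algebra_simps power_mult_distrib)
  ultimately show ?thesis by blast
qed

lemma germ_mem:
  assumes "u \<in> J k"
  shows "local_equation u i p \<in> local_ideal n F i p"
proof -
  obtain v where v: "u = (\<Sum>j\<le>n. v j * F j)" "\<And>j. j \<le> n \<Longrightarrow> v j \<in> homog n (k - e)"
    using assms by (auto simp: J_def gen_def)
  show ?thesis
    unfolding local_ideal_def
    by (rule lincombI[of _ "\<lambda>j. local_equation (v j) i p"])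
      (use v in \<open>auto simp: germ_sum germ_mult intro!: germ_conv homog_polys\<close>)
qed

lemmas local_add = lincomb_add[OF subring_conv, of _ "{..n} - {i}" "\<lambda>j. local_equation (F j) i p" "{..n}" for i p,
    folded local_ideal_def]
lemmas local_mult = lincomb_mult[OF subring_conv, of _ "{..n} - {i}" _ "\<lambda>j. local_equation (F j) i p" "{..n}" for i p,
    folded local_ideal_def]
lemmas local_0 = lincomb_0[OF subring_conv, of "{..n} - {i}" "\<lambda>j. local_equation (F j) i p" "{..n}" for i p,
    folded local_ideal_def]
lemmas local_sum = lincomb_sum[OF subring_conv, of _ _ "{..n} - {i}" "\<lambda>j. local_equation (F j) i p" "{..n}" for i p,
    folded local_ideal_def]

lemma subspace_local: "mfps.subspace (local_ideal n F i p)"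
proof (rule mfps.subspaceI)
  fix c x assume "x \<in> local_ideal n F i p"
  then show "mfps_scale c x \<in> local_ideal n F i p"
    unfolding const_mult[symmetric] by (rule local_mult[OF conv_const])
qed (auto intro: local_0 local_add)

lemma germ_inverse:
  assumes "s \<in> homog n (int a)" "mpoly_eval s p \<noteq> 0" "i \<le> n" "p i \<noteq> 0"
  obtains v where "v \<in> convergent_series ({..n} - {i})" "local_equation s i p * v = 1"
proof -
  have "local_equation s i p \<in> convergent_series ({..n} - {i})"
    by (rule germ_conv[OF homog_polys[OF assms(1)]])
  moreover have "mfps_nth (local_equation s i p) 0 \<noteq> 0"
    using germ_nth_0[where p = p, OF assms(1,3,4)] assms(2,4) by simp
  ultimately show ?thesis using conv_inverse that by blast
qed

text \<open>The annihilating form does not vanish at \<open>p\<close>, so its germ is invertible and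
  can be removed.\<close>

lemma germ_power_mem:
  assumes p: "zero_of n J p" "i \<le> n" "p i \<noteq> 0" and \<nu>: "\<nu> \<in> homog n 1" "mpoly_eval \<nu> p = 0"
  shows "\<exists>N. local_equation \<nu> i p ^ N \<in> local_ideal n F i p"
proof -
  obtain a N s where s: "s \<in> homog n (int a)" "mpoly_eval s p \<noteq> 0" "s * \<nu> ^ N \<in> J (int a + int N)"
    using local_annihilator[OF p(1) \<nu>] by blast
  obtain v where v: "v \<in> convergent_series ({..n} - {i})" "local_equation s i p * v = 1"
    using germ_inverse[OF s(1,2) p(2,3)] by blast
  have "v * local_equation (s * \<nu> ^ N) i p \<in> local_ideal n F i p"
    by (rule local_mult[OF v(1) germ_mem[OF s(3)]])
  moreover have "v * local_equation (s * \<nu> ^ N) i p = local_equation \<nu> i p ^ N"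
    using v(2) by (metis germ_mult germ_power mult.assoc mult.commute mult_1)
  ultimately show ?thesis by auto
qed

text \<open>The local coordinates are nilpotent modulo the local ideal, so a series may be truncated
  to a polynomial in them and then homogenized.\<close>

lemma germ_surjective:
  assumes p: "zero_of n J p" "i \<le> n" "p i \<noteq> 0"
  obtains k0 where "\<And>a k. a \<in> convergent_series ({..n} - {i}) \<Longrightarrow> k \<ge> k0 \<Longrightarrow>
    \<exists>h\<in>homog n k. a - local_equation h i p \<in> local_ideal n F i p"
proof -
  let ?V = "{..n} - {i}"
  have "\<exists>N. mfps_var j ^ N \<in> local_ideal n F i p" if "j \<in> ?V" for j
    using germ_power_mem[OF p centred_var_homog[OF p(2), of j p] eval_centred_var[of p i j]] that p germ_centred_var[of j i p]
    by auto
  then obtain M where M: "\<And>j. j \<in> ?V \<Longrightarrow> mfps_var j ^ M j \<in> local_ideal n F i p" by metis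
  \<comment> \<open>The sum of the exponents is a common exponent for all coordinates.\<close>
  define N where "N = sum M ?V"
  have N: "mfps_var j ^ N \<in> local_ideal n F i p" if j: "j \<in> ?V" for j
  proof -
    have "M j \<le> N" unfolding N_def using j by (intro member_le_sum) auto
    then have "mfps_var j ^ N = mfps_var j ^ (N - M j) * mfps_var j ^ M j" by (simp flip: power_add)
    also have "\<dots> \<in> local_ideal n F i p" by (rule local_mult[OF conv_power[OF conv_var[OF j]] M[OF j]])
    finally show ?thesis .
  qed
  obtain k0 where k0: "k0 \<ge> 0" "\<And>a k. a \<in> convergent_series ?V \<Longrightarrow> k \<ge> k0 \<Longrightarrow>
    \<exists>h\<in>homog n k. \<exists>b. (\<forall>j\<in>?V. b j \<in> convergent_series ?V) \<and>
      a = local_equation h i p + (\<Sum>j\<in>?V. mfps_var j ^ N * b j)"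
    using series_division[OF p(2), of p N] by blast
  show ?thesis
  proof (rule that[of k0])
    fix a k assume "a \<in> convergent_series ?V" "k0 \<le> k"
    then obtain h b where hb: "h \<in> homog n k" "\<forall>j\<in>?V. b j \<in> convergent_series ?V"
      "a = local_equation h i p + (\<Sum>j\<in>?V. mfps_var j ^ N * b j)" using k0(2) by blast
    have "(\<Sum>j\<in>?V. b j * mfps_var j ^ N) \<in> local_ideal n F i p"
      using hb(2) N by (intro local_sum local_mult) auto
    then have "a - local_equation h i p \<in> local_ideal n F i p" unfolding hb(3) by (simp add: mult.commute)
    then show "\<exists>h\<in>homog n k. a - local_equation h i p \<in> local_ideal n F i p" using hb(1) by blast
  qed
qed

text \<open>A converse to \<open>germ_mem\<close>, up to a factor that does not vanish at
  \<open>p\<close>. The power series coefficients are approximated by forms \<open>g t\<close>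
  modulo the \<open>N\<close>-th powers of the coordinates; the error has high order at
  \<open>p\<close> and is annihilated by \<open>S\<close>.\<close>

lemma local_mem_annihilator:
  assumes p: "zero_of n J p" "i \<le> n" "p i \<noteq> 0"
    and h: "h \<in> homog n (int k)" "local_equation h i p \<in> local_ideal n F i p"
  shows "\<exists>a s. s \<in> homog n (int a) \<and> mpoly_eval s p \<noteq> 0 \<and> s * h \<in> J (int a + int k)"
proof -
  let ?V = "{..n} - {i}" and ?y = "centred_var i p"
  have "\<exists>a N s. s \<in> homog n (int a) \<and> mpoly_eval s p \<noteq> 0 \<and> s * ?y j ^ N \<in> J (int a + int N)" if "j \<in> ?V" for j
    using that p by (intro local_annihilator centred_var_homog eval_centred_var) auto
  then obtain a M s where s: "\<And>j. j \<in> ?V \<Longrightarrow> s j \<in> homog n (int (a j)) \<and> mpoly_eval (s j) p \<noteq> 0 \<and>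
      s j * ?y j ^ M j \<in> J (int (a j) + int (M j))" by metis
  define N where "N = sum M ?V"
  define S where "S = prod s ?V"
  have "S \<in> homog n (\<Sum>j\<in>?V. int (a j))" unfolding S_def using s by (intro homog_prod) auto
  then have S: "S \<in> homog n (int (sum a ?V))" by simp
  have Sp: "mpoly_eval S p \<noteq> 0" unfolding S_def eval.subst_prod using s by simp
  have SN: "S * ?y j ^ N \<in> J (int (sum a ?V) + int N)" if j: "j \<in> ?V" for j
  proof -
    have MN: "M j \<le> N" unfolding N_def using j by (intro member_le_sum) auto
    have "S * ?y j ^ N = (prod s (?V - {j}) * ?y j ^ (N - M j)) * (s j * ?y j ^ M j)"
    proof -
      have "S = s j * prod s (?V - {j})" unfolding S_def using j by (intro prod.remove) auto
      moreover have "?y j ^ N = ?y j ^ (N - M j) * ?y j ^ M j" using MN by (simp flip: power_add)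
      ultimately show ?thesis by (simp add: ac_simps)
    qed
    also have "\<dots> \<in> J (int (sum a ?V) + int N)"
    proof (rule graded_mult[OF J])
      show "s j * ?y j ^ M j \<in> J (int (a j) + int (M j))" using s[OF j] by blast
      have "prod s (?V - {j}) \<in> homog n (\<Sum>j\<in>?V - {j}. int (a j))" using s by (intro homog_prod) auto
      moreover have "?y j ^ (N - M j) \<in> homog n (int (N - M j) * 1)"
        using j p by (intro homog_power centred_var_homog) auto
      ultimately show "prod s (?V - {j}) * ?y j ^ (N - M j) \<in> homog n ((\<Sum>j\<in>?V - {j}. int (a j)) + int (N - M j))"
        by (intro homog_mult) auto
      have "sum a ?V = a j + sum a (?V - {j})" using j by (intro sum.remove) auto
      then show "int (sum a ?V) + int N = (\<Sum>j\<in>?V - {j}. int (a j)) + int (N - M j) + (int (a j) + int (M j))"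
        using MN by simp
    qed
    finally show ?thesis .
  qed
  obtain c where c: "local_equation h i p = (\<Sum>t\<le>n. c t * local_equation (F t) i p)"
    "\<And>t. t \<le> n \<Longrightarrow> c t \<in> convergent_series ?V"
    using h(2) by (auto simp: local_ideal_def lincomb_def)
  obtain k0 where k0: "k0 \<ge> 0" "\<And>a k. a \<in> convergent_series ?V \<Longrightarrow> k \<ge> k0 \<Longrightarrow>
    \<exists>h\<in>homog n k. \<exists>b. (\<forall>j\<in>?V. b j \<in> convergent_series ?V) \<and>
      a = local_equation h i p + (\<Sum>j\<in>?V. mfps_var j ^ N * b j)"
    using series_division[OF p(2), of p N] by blast
  define k1 where "k1 = max k0 (int k)"
  have "\<exists>g b. g \<in> homog n k1 \<and> c t = local_equation g i p + (\<Sum>j\<in>?V. mfps_var j ^ N * b j)" if "t \<le> n" for t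
    using k0(2)[OF c(2)[OF that], of k1] by (auto simp: k1_def)
  then obtain g b where gb: "\<And>t. t \<le> n \<Longrightarrow> g t \<in> homog n k1 \<and>
      c t = local_equation (g t) i p + (\<Sum>j\<in>?V. mfps_var j ^ N * b t j)" by metis
  \<comment> \<open>The factor \<open>x_i ^ r\<close> has germ 1; it raises the degree of
    \<open>h\<close> to that of the products \<open>g t * F t\<close>.\<close>
  define r where "r = nat (k1 + e - int k)"
  have "int k \<le> k1" by (simp add: k1_def)
  then have r: "int r + int k = k1 + e" using e by (simp add: r_def)
  define h' where "h' = mpoly_var i ^ r * h - (\<Sum>t\<le>n. g t * F t)"
  have xr: "mpoly_var i ^ r \<in> homog n (int r)" using homog_power[OF mpoly_var_in_homog[OF p(2)], of r] by simp
  have h'_hom: "h' \<in> homog n (int (nat (k1 + e)))"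
    unfolding h'_def using xr h(1) gb F r k0(1) e
    by (intro homog_diff homog_sum homog_mult'[of _ n "int r" _ "int k"] homog_mult'[of _ n k1 _ e]) (auto simp: k1_def)
  have germ_h': "local_equation h' i p = (\<Sum>j\<in>?V. mfps_var j ^ N * (\<Sum>t\<le>n. b t j * local_equation (F t) i p))"
  proof -
    have "local_equation h' i p = (\<Sum>t\<le>n. (c t - local_equation (g t) i p) * local_equation (F t) i p)"
      by (simp add: h'_def germ_diff germ_mult germ_power germ_var germ_sum c(1) left_diff_distrib sum_subtractf)
    also have "\<dots> = (\<Sum>t\<le>n. \<Sum>j\<in>?V. mfps_var j ^ N * (b t j * local_equation (F t) i p))"
      using gb by (intro sum.cong refl) (simp add: sum_distrib_right mult.assoc)
    also have "\<dots> = (\<Sum>j\<in>?V. \<Sum>t\<le>n. mfps_var j ^ N * (b t j * local_equation (F t) i p))" by (rule sum.swap)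
    finally show ?thesis by (simp add: sum_distrib_left)
  qed
  have Sh': "S * h' \<in> J (int (sum a ?V) + int (nat (k1 + e)))"
    by (rule mem_if_germ_high_order[OF J p(2) S SN h'_hom germ_h'])
  have "(\<Sum>t\<le>n. g t * F t) \<in> J (k1 + e)"
    unfolding J_def gen_def using gb by auto
  then have "S * (\<Sum>t\<le>n. g t * F t) \<in> J (int (sum a ?V) + int (nat (k1 + e)))"
    using k0(1) e by (intro graded_mult[OF J S]) (auto simp: k1_def)
  then have "S * h' + S * (\<Sum>t\<le>n. g t * F t) \<in> J (int (sum a ?V) + int (nat (k1 + e)))"
    using Sh' by (intro graded_add[OF J])
  moreover have "S * h' + S * (\<Sum>t\<le>n. g t * F t) = (S * mpoly_var i ^ r) * h" by (simp add: h'_def algebra_simps)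
  moreover have "int (sum a ?V) + int (nat (k1 + e)) = int (sum a ?V + r) + int k"
    using r k0(1) e by (simp add: k1_def)
  ultimately have "(S * mpoly_var i ^ r) * h \<in> J (int (sum a ?V + r) + int k)" by (simp only:)
  moreover have "S * mpoly_var i ^ r \<in> homog n (int (sum a ?V + r))" using homog_mult[OF S xr] by simp
  moreover have "mpoly_eval (S * mpoly_var i ^ r) p \<noteq> 0"
    using Sp p(3) by (simp add: eval.subst_mult eval.subst_power eval.subst_var)
  ultimately show ?thesis by blast
qed

section \<open>Gluing the local quotients\<close>

definition kernel :: "('p \<Rightarrow> nat) \<Rightarrow> ('p \<Rightarrow> nat \<Rightarrow> complex) \<Rightarrow> 'p set \<Rightarrow> int \<Rightarrow> mpoly set" where
  "kernel ix pt A k = {h \<in> homog n k. \<forall>P\<in>A. local_equation h (ix P) (pt P) \<in> local_ideal n F (ix P) (pt P)}"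

lemma subspace_kernel: "mpoly.subspace (kernel ix pt A k)"
  by (rule mpoly.subspaceI)
    (auto simp: kernel_def homog_add homog_scale germ_add germ_scale
      intro: local_0 local_add mfps.subspace_scale[OF subspace_local])

text \<open>The Chinese remainder theorem, adding one point \<open>P\<close> at a time. A form
  \<open>s\<close> that is a unit at \<open>P\<close> and lies in the local ideals at
  \<open>A\<close> realizes, by its multiples, every germ at \<open>P\<close> modulo the local ideal
  while staying in the kernel for \<open>A\<close>.\<close>

lemma local_dims_sum:
  assumes "finite A" and pt: "\<And>P. P \<in> A \<Longrightarrow> zero_of n J (pt P) \<and> ix P \<le> n \<and> pt P (ix P) \<noteq> 0"
    and inj: "inj_on (\<lambda>P. proj_point (pt P)) A"
  shows "\<exists>k0. \<forall>k\<ge>k0. (\<Sum>P\<in>A. mfps_quotient_dim (convergent_series ({..n} - {ix P})) (local_ideal n F (ix P) (pt P)))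
    = enat (mpoly.qdim (homog n k) (kernel ix pt A k))"
  using assms
proof (induction A rule: finite_induct)
  case empty
  have "mpoly.qdim (homog n k) (kernel ix pt {} k) = 0" for k
    by (simp add: kernel_def mpoly.qdim_same)
  then show ?case by (simp add: zero_enat_def)
next
  case (insert P A)
  let ?C = "\<lambda>P. convergent_series ({..n} - {ix P})" and ?L = "\<lambda>P. local_ideal n F (ix P) (pt P)"
    and ?\<psi> = "\<lambda>P h. local_equation h (ix P) (pt P)"
  have P: "zero_of n J (pt P)" "ix P \<le> n" "pt P (ix P) \<noteq> 0" using insert.prems by auto
  obtain k0 where k0: "\<And>k. k \<ge> k0 \<Longrightarrow> (\<Sum>P\<in>A. mfps_quotient_dim (?C P) (?L P)) = enat (mpoly.qdim (homog n k) (kernel ix pt A k))"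
    using insert.IH insert.prems by (auto simp: inj_on_def)
  have "\<exists>\<mu> a. \<mu> \<in> homog n (int a) \<and> mpoly_eval \<mu> (pt P) \<noteq> 0 \<and> ?\<psi> Q \<mu> \<in> ?L Q" if Q: "Q \<in> A" for Q
  proof -
    have Qz: "zero_of n J (pt Q)" "ix Q \<le> n" "pt Q (ix Q) \<noteq> 0" using insert.prems(1)[of Q] Q by auto
    have "proj_point (pt P) \<noteq> proj_point (pt Q)" using insert Q by (metis inj_onD insertCI)
    then obtain \<nu> where \<nu>: "\<nu> \<in> homog n 1" "mpoly_eval \<nu> (pt Q) = 0" "mpoly_eval \<nu> (pt P) \<noteq> 0"
      using separating_linear_form[OF zero_coords[OF P(1)] zero_coords[OF Qz(1)]] by blast
    obtain N where "?\<psi> Q \<nu> ^ N \<in> ?L Q" using germ_power_mem[OF Qz \<nu>(1,2)] by blast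
    then show ?thesis using \<nu>(3) homog_power[OF \<nu>(1), of N]
      by (intro exI[of _ "\<nu> ^ N"] exI[of _ N]) (auto simp: germ_power eval.subst_power)
  qed
  then obtain \<mu> a where \<mu>: "\<And>Q. Q \<in> A \<Longrightarrow> \<mu> Q \<in> homog n (int (a Q)) \<and> mpoly_eval (\<mu> Q) (pt P) \<noteq> 0 \<and> ?\<psi> Q (\<mu> Q) \<in> ?L Q"
    by metis
  define s where "s = prod \<mu> A"
  have "s \<in> homog n (\<Sum>Q\<in>A. int (a Q))" unfolding s_def using \<mu> insert.hyps by (intro homog_prod) auto
  then have s: "s \<in> homog n (int (sum a A))" by simp
  have sp: "mpoly_eval s (pt P) \<noteq> 0" unfolding s_def eval.subst_prod using \<mu> insert.hyps by simp
  have sQ: "?\<psi> Q s \<in> ?L Q" if Q: "Q \<in> A" for Q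
  proof -
    have "s = prod \<mu> (A - {Q}) * \<mu> Q" unfolding s_def using Q insert.hyps by (simp add: prod.remove mult.commute)
    moreover have "prod \<mu> (A - {Q}) \<in> homog n (\<Sum>Q\<in>A - {Q}. int (a Q))" using \<mu> insert.hyps by (intro homog_prod) auto
    ultimately show ?thesis using \<mu>[OF Q] by (auto simp: germ_mult intro!: local_mult germ_conv homog_polys)
  qed
  obtain v where v: "v \<in> ?C P" "?\<psi> P s * v = 1" using germ_inverse[OF s sp P(2,3)] by blast
  obtain k1 where k1: "\<And>a k. a \<in> ?C P \<Longrightarrow> k \<ge> k1 \<Longrightarrow> \<exists>h\<in>homog n k. a - ?\<psi> P h \<in> ?L P"
    using germ_surjective[OF P] by blast
  show ?case
  proof (intro exI[of _ "max k0 (k1 + int (sum a A))"] allI impI)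
    fix k assume k: "k \<ge> max k0 (k1 + int (sum a A))"
    let ?V = "kernel ix pt A k" and ?W = "kernel ix pt (insert P A) k"
    have finVW: "mpoly.fin_quotient ?V ?W"
      by (rule fin_quotient_homog[OF subspace_kernel subspace_kernel]) (auto simp: kernel_def)
    have "mfps_quotient_dim (?C P) (?L P) = enat (mpoly.qdim ?V ?W)"
      unfolding mfps_quotient_dim_def
    proof (rule qdim_transport(3)[where \<phi> = "?\<psi> P"])
      show "quotient_space mpoly_scale" "quotient_space mfps_scale" by unfold_locales
      show "mpoly.subspace ?V" "mpoly.subspace ?W" by (rule subspace_kernel)+
      show "mfps.subspace (?L P)" by (rule subspace_local)
      show "mpoly.fin_quotient ?V ?W" by (rule finVW)
      show "?\<psi> P x \<in> ?C P" if "x \<in> ?V" for x using that by (auto simp: kernel_def intro!: germ_conv homog_polys)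
      fix y assume y: "y \<in> ?C P"
      have "v * y \<in> ?C P" using v(1) y by (rule conv_mult)
      then obtain h where h: "h \<in> homog n (k - int (sum a A))" "v * y - ?\<psi> P h \<in> ?L P" using k1[of "v * y" "k - int (sum a A)"] k by auto
      have "?\<psi> P s \<in> ?C P" by (rule germ_conv[OF homog_polys[OF s]])
      then have "?\<psi> P s * (v * y - ?\<psi> P h) \<in> ?L P" using h(2) by (rule local_mult)
      moreover have "?\<psi> P s * (v * y - ?\<psi> P h) = y - ?\<psi> P (s * h)"
        using v(2) by (simp add: right_diff_distrib germ_mult flip: mult.assoc)
      moreover have "s * h \<in> ?V"
      proof -
        have "?\<psi> Q (s * h) \<in> ?L Q" if "Q \<in> A" for Q
          using local_mult[OF germ_conv[OF homog_polys[OF h(1)]] sQ[OF that]] by (simp add: germ_mult mult.commute)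
        moreover have "s * h \<in> homog n k" by (rule homog_mult'[OF s h(1)]) simp
        ultimately show ?thesis by (simp add: kernel_def)
      qed
      ultimately show "\<exists>x\<in>?V. y - ?\<psi> P x \<in> ?L P" by force
    qed (auto simp: kernel_def germ_add germ_scale)
    moreover have "mpoly.qdim (homog n k) ?W = mpoly.qdim (homog n k) ?V + mpoly.qdim ?V ?W"
      by (rule mpoly.qdim_add[OF subspace_kernel subspace_kernel _ _ fin_quotient_homog[OF _ subspace_kernel] finVW])
        (auto simp: kernel_def)
    ultimately show "(\<Sum>P\<in>insert P A. mfps_quotient_dim (?C P) (?L P)) = enat (mpoly.qdim (homog n k) ?W)"
      using insert.hyps k0[of k] k by simp
  qed
qed

text \<open>By \<open>local_mem_annihilator\<close> no zero of \<open>J\<close> is a zero of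
  \<open>J : h\<close>, so \<open>J : h\<close> contains all forms of some degree, in particular a
  power of \<open>l\<close>. From degree \<open>K\<close> on this power can be cancelled.\<close>

lemma kernel_all:
  assumes pt: "\<And>P. P \<in> A \<Longrightarrow> zero_of n J (pt P) \<and> ix P \<le> n \<and> pt P (ix P) \<noteq> 0"
    and all: "\<And>c. zero_of n J c \<Longrightarrow> \<exists>P\<in>A. proj_point c = proj_point (pt P)" and k: "k \<ge> K"
  shows "kernel ix pt A k = J k"
proof
  show "J k \<subseteq> kernel ix pt A k" using gradedD(2)[OF J] germ_mem by (auto simp: kernel_def)
  show "kernel ix pt A k \<subseteq> J k"
  proof
    fix h assume h: "h \<in> kernel ix pt A k"
    then have hk: "h \<in> homog n k" by (simp add: kernel_def)
    have hk': "h \<in> homog n (int (nat k))" using hk k K by simp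
    have "artinian n (colon n J h k)"
    proof (rule artinian_if_no_zeros[OF graded_colon[OF J hk]])
      fix c show "\<not> zero_of n (colon n J h k) c"
      proof
        assume z: "zero_of n (colon n J h k) c"
        then have "zero_of n J c" using colon_superset[OF J hk] by (auto simp: zero_of_def)
        then obtain P where P: "P \<in> A" "proj_point c = proj_point (pt P)" using all by blast
        have P': "zero_of n J (pt P)" "ix P \<le> n" "pt P (ix P) \<noteq> 0" using pt[OF P(1)] by auto
        obtain a s where s: "s \<in> homog n (int a)" "mpoly_eval s (pt P) \<noteq> 0" "s * h \<in> J (int a + int (nat k))"
          using local_mem_annihilator[OF P' hk'] h P(1) by (auto simp: kernel_def)
        have "s \<in> colon n J h k (int a)" using s k K by (simp add: colon_def)
        then have "mpoly_eval s c = 0" using z by (auto simp: zero_of_def)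
        then show False using eval_proportional[OF P(2) s(1)] s(2) by simp
      qed
    qed
    then obtain t where "homog n (int t) \<subseteq> colon n J h k (int t)" by (auto simp: artinian_def)
    then have lt: "l ^ t * h \<in> J (int t + k)" using l_power[of t] by (auto simp: colon_def)
    show "h \<in> J k" by (rule stable_descend[OF J l(1) stable hk k lt])
  qed
qed

theorem local_dims_eq_HF:
  assumes "finite A" and "\<And>P. P \<in> A \<Longrightarrow> zero_of n J (pt P) \<and> ix P \<le> n \<and> pt P (ix P) \<noteq> 0"
    and "inj_on (\<lambda>P. proj_point (pt P)) A"
    and "\<And>c. zero_of n J c \<Longrightarrow> \<exists>P\<in>A. proj_point c = proj_point (pt P)"
    and "\<And>k. k \<ge> K \<Longrightarrow> HF n J k = \<tau>"
  shows "(\<Sum>P\<in>A. mfps_quotient_dim (convergent_series ({..n} - {ix P})) (local_ideal n F (ix P) (pt P))) = enat \<tau>"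
proof -
  obtain k0 where k0: "\<And>k. k \<ge> k0 \<Longrightarrow>
    (\<Sum>P\<in>A. mfps_quotient_dim (convergent_series ({..n} - {ix P})) (local_ideal n F (ix P) (pt P)))
    = enat (mpoly.qdim (homog n k) (kernel ix pt A k))"
    using local_dims_sum[OF assms(1-3)] by blast
  have "kernel ix pt A (max k0 K) = J (max k0 K)" by (rule kernel_all[OF assms(2,4)]) auto
  then show ?thesis using k0[of "max k0 K"] assms(5)[of "max k0 K"] by (simp add: HF_def)
qed

end

subsection \<open>The Jacobian ideal and its saturation\<close>

lemma ideal_gen_add:
  assumes R: "subring R" and x: "x \<in> ideal_gen R G" and y: "y \<in> ideal_gen R G"
  shows "x + y \<in> ideal_gen R G"
proof -
  obtain t h where t: "x = (\<Sum>g\<in>t. h g * g)" "finite t" "t \<subseteq> G" "h ` t \<subseteq> R"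
    using x by (auto simp: ideal_gen_def)
  obtain t' h' where t': "y = (\<Sum>g\<in>t'. h' g * g)" "finite t'" "t' \<subseteq> G" "h' ` t' \<subseteq> R"
    using y by (auto simp: ideal_gen_def)
  let ?k = "\<lambda>g. (if g \<in> t then h g else 0) + (if g \<in> t' then h' g else 0)"
  have "(\<Sum>g\<in>t \<union> t'. (if g \<in> t then h g else 0) * g) = x"
    unfolding t(1) using t t' by (intro sum.mono_neutral_cong_right) auto
  moreover have "(\<Sum>g\<in>t \<union> t'. (if g \<in> t' then h' g else 0) * g) = y"
    unfolding t'(1) using t t' by (intro sum.mono_neutral_cong_right) auto
  ultimately have "x + y = (\<Sum>g\<in>t \<union> t'. ?k g * g)" by (simp add: distrib_right sum.distrib)
  moreover have "?k ` (t \<union> t') \<subseteq> R" using R t(4) t'(4) by (auto simp: subring_def image_subset_iff)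
  ultimately show ?thesis unfolding ideal_gen_def using t(2,3) t'(2,3)
    by (intro CollectI exI[of _ "t \<union> t'"] exI[of _ ?k]) auto
qed

lemma ideal_gen_base: "subring R \<Longrightarrow> g \<in> G \<Longrightarrow> g \<in> ideal_gen R G"
  unfolding ideal_gen_def by (intro CollectI exI[of _ "{g}"] exI[of _ "\<lambda>_. 1"]) (auto simp: subring_def)

lemma ideal_gen_0: "0 \<in> ideal_gen R G"
  unfolding ideal_gen_def by (intro CollectI exI[of _ "{}"] exI[of _ "\<lambda>_. 1"]) auto

lemma ideal_gen_least:
  assumes "0 \<in> E" "\<And>x y. x \<in> E \<Longrightarrow> y \<in> E \<Longrightarrow> x + y \<in> E" "\<And>r x. r \<in> R \<Longrightarrow> x \<in> E \<Longrightarrow> r * x \<in> E" "G \<subseteq> E"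
  shows "ideal_gen R G \<subseteq> E"
proof
  fix x assume "x \<in> ideal_gen R G"
  then obtain t h where t: "x = (\<Sum>g\<in>t. h g * g)" "finite t" "t \<subseteq> G" "h ` t \<subseteq> R"
    by (auto simp: ideal_gen_def)
  have "(\<Sum>g\<in>t. h g * g) \<in> E"
    using t(2-4) by (induction t rule: finite_induct) (use assms in auto)
  then show "x \<in> E" using t by simp
qed

definition homog_part :: "int \<Rightarrow> mpoly \<Rightarrow> mpoly" where
  "homog_part k p = (\<Sum>m\<in>{m \<in> keys p. int (mdeg m) = k}. single m (lookup p m))"

lemma lookup_homog_part: "lookup (homog_part k p) m = (if int (mdeg m) = k then lookup p m else 0)"
  by (simp add: homog_part_def lookup_sum lookup_single when_def in_keys_iff)

lemma homog_part_add: "homog_part k (p + q) = homog_part k p + homog_part k q"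
  by (rule poly_mapping_eqI) (simp add: lookup_homog_part lookup_add)

lemma homog_part_0 [simp]: "homog_part k 0 = 0"
  by (rule poly_mapping_eqI) (simp add: lookup_homog_part)

lemma homog_part_homog:
  assumes "p \<in> homog n j"
  shows "homog_part k p = (if j = k then p else 0)"
proof (rule poly_mapping_eqI)
  fix m
  show "lookup (homog_part k p) m = lookup (if j = k then p else 0) m"
    using homog_mdeg[OF assms, of m] by (auto simp: lookup_homog_part in_keys_iff)
qed

lemma homog_part_in: "p \<in> polys n \<Longrightarrow> homog_part k p \<in> homog n k"
  by (rule homogI) (auto simp: in_keys_iff lookup_homog_part polys_def split: if_splits)

lemma homog_part_mult:
  assumes q: "q \<in> homog n e" and h: "h \<in> polys n"
  shows "homog_part k (h * q) = homog_part (k - e) h * q"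
  using h
proof (induction rule: polys_monom_induct)
  case (monom m c)
  have s: "single m c \<in> homog n (int (mdeg m))" using monom(1) by (intro single_in_homog) auto
  show ?case unfolding homog_part_homog[OF homog_mult[OF s q]] homog_part_homog[OF s] by auto
qed (simp_all add: homog_part_add distrib_right)

lemma homog_part_sum: "homog_part k (sum p A) = (\<Sum>a\<in>A. homog_part k (p a))"
  by (induction A rule: infinite_finite_induct) (simp_all add: homog_part_add)

lemma jacobian_ideal_lincomb: "jacobian_ideal n f = lincomb (polys n) (\<lambda>i. mpoly_deriv i f) {..n}"
proof -
  have "{mpoly_deriv i f | i. i \<le> n} = (\<lambda>i. mpoly_deriv i f) ` {..n}" by auto
  then show ?thesis unfolding jacobian_ideal_def using ideal_gen_image[OF subring_polys finite_atMost] by metis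
qed

text \<open>The partials are homogeneous of one degree, so in a combination of degree
  \<open>k\<close> each coefficient may be replaced by its homogeneous part of degree
  \<open>k - (d - 1)\<close>.\<close>

lemma jacobian_ideal_homog:
  assumes f: "f \<in> homog n (int d)"
  shows "jacobian_ideal n f \<inter> homog n k = gen n (\<lambda>i. mpoly_deriv i f) (\<lambda>_. int d - 1) {..n} k"
proof
  show "jacobian_ideal n f \<inter> homog n k \<subseteq> gen n (\<lambda>i. mpoly_deriv i f) (\<lambda>_. int d - 1) {..n} k"
  proof
    fix u assume u: "u \<in> jacobian_ideal n f \<inter> homog n k"
    then obtain h where h: "u = (\<Sum>i\<le>n. h i * mpoly_deriv i f)" "\<And>i. i \<le> n \<Longrightarrow> h i \<in> polys n"
      by (auto simp: jacobian_ideal_lincomb lincomb_def)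
    have "u = homog_part k u" using u homog_part_homog[of u n k k] by simp
    also have "\<dots> = (\<Sum>i\<le>n. homog_part (k - (int d - 1)) (h i) * mpoly_deriv i f)"
      unfolding h(1) homog_part_sum
      by (intro sum.cong refl homog_part_mult[OF homog_deriv[OF f] h(2)]) auto
    finally show "u \<in> gen n (\<lambda>i. mpoly_deriv i f) (\<lambda>_. int d - 1) {..n} k"
      unfolding gen_def using h(2) homog_part_in
      by (intro CollectI exI[of _ "\<lambda>i. homog_part (k - (int d - 1)) (h i)"]) auto
  qed
  show "gen n (\<lambda>i. mpoly_deriv i f) (\<lambda>_. int d - 1) {..n} k \<subseteq> jacobian_ideal n f \<inter> homog n k"
  proof
    fix u assume u: "u \<in> gen n (\<lambda>i. mpoly_deriv i f) (\<lambda>_. int d - 1) {..n} k"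
    then obtain v where v: "u = (\<Sum>i\<le>n. v i * mpoly_deriv i f)" "\<And>i. i \<le> n \<Longrightarrow> v i \<in> homog n (k - (int d - 1))"
      by (auto simp: gen_def)
    have "u \<in> jacobian_ideal n f"
      unfolding jacobian_ideal_lincomb by (rule lincombI[OF _ v(1)]) (use v(2) homog_polys in auto)
    moreover have "graded n (gen n (\<lambda>i. mpoly_deriv i f) (\<lambda>_. int d - 1) {..n})"
      using homog_deriv[OF f] by (intro graded_gen) auto
    ultimately show "u \<in> jacobian_ideal n f \<inter> homog n k" using gradedD(2) u by blast
  qed
qed

lemma homog_subset_irrelevant_power: "homog n (int m) \<subseteq> ideal_power (polys n) (irrelevant_ideal n) m"
proof (induction m)
  case 0
  then show ?case using homog_polys by auto
next
  case (Suc m)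
  show ?case
  proof
    fix h assume "h \<in> homog n (int (Suc m))"
    then have "h \<in> homog n (int m + 1)" by (simp add: algebra_simps)
    then show "h \<in> ideal_power (polys n) (irrelevant_ideal n) (Suc m)"
    proof (induction rule: homog_step_induct)
      case (var j u)
      have "mpoly_var j \<in> irrelevant_ideal n"
        unfolding irrelevant_ideal_def using var(1) by (intro ideal_gen_base[OF subring_polys]) auto
      then have "mpoly_var j * u \<in> {a * b | a b. a \<in> ideal_power (polys n) (irrelevant_ideal n) m \<and> b \<in> irrelevant_ideal n}"
        using var(2) Suc.IH by (auto simp: mult.commute)
      then show ?case by (simp add: ideal_gen_base[OF subring_polys])
    qed (simp_all add: ideal_gen_0 ideal_gen_add[OF subring_polys])
  qed
qed

text \<open>Bounds the powers of the irrelevant ideal from above by order, complementing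
  \<open>homog_subset_irrelevant_power\<close>.\<close>

definition polys_from :: "nat \<Rightarrow> nat \<Rightarrow> mpoly set" where
  "polys_from n r = {p \<in> polys n. \<forall>m\<in>keys p. r \<le> mdeg m}"

lemma polys_from_mult: "p \<in> polys_from n r \<Longrightarrow> q \<in> polys_from n s \<Longrightarrow> p * q \<in> polys_from n (r + s)"
  unfolding polys_from_def using keys_mult_subset[of p q] by (fastforce simp: polys_mult mdeg_add)

lemma polys_from_add: "p \<in> polys_from n r \<Longrightarrow> q \<in> polys_from n r \<Longrightarrow> p + q \<in> polys_from n r"
  unfolding polys_from_def using Poly_Mapping.keys_add[of p q] polys_add by blast

lemma ideal_gen_polys_from: "G \<subseteq> polys_from n r \<Longrightarrow> ideal_gen (polys n) G \<subseteq> polys_from n r"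
  using polys_from_mult[of _ n 0 _ r]
  by (intro ideal_gen_least polys_from_add) (auto simp: polys_from_def)

lemma irrelevant_power_subset: "ideal_power (polys n) (irrelevant_ideal n) m \<subseteq> polys_from n m"
proof (induction m)
  case 0
  then show ?case by (simp add: polys_from_def)
next
  case (Suc m)
  have "mpoly_var i \<in> polys_from n 1" if "i \<le> n" for i
    using homog_mdeg[OF mpoly_var_in_homog[OF that]] homog_polys[OF mpoly_var_in_homog[OF that]] by (force simp: polys_from_def)
  then have "irrelevant_ideal n \<subseteq> polys_from n 1"
    unfolding irrelevant_ideal_def by (intro ideal_gen_polys_from) auto
  then have "{a * b | a b. a \<in> ideal_power (polys n) (irrelevant_ideal n) m \<and> b \<in> irrelevant_ideal n} \<subseteq> polys_from n (Suc m)"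
    using Suc polys_from_mult[of _ n m _ 1] by auto
  then show ?case by (simp add: ideal_gen_polys_from)
qed

text \<open>If all forms of degree \<open>r\<close> multiply \<open>h\<close> into \<open>J\<close>,
  so do all forms of higher degree, hence all polynomials of order at least \<open>r\<close>, which
  include the \<open>r\<close>-th power of the irrelevant ideal.\<close>

lemma saturation_homog:
  assumes f: "f \<in> homog n (int d)"
  defines "J \<equiv> gen n (\<lambda>i. mpoly_deriv i f) (\<lambda>_. int d - 1) {..n}"
  shows "saturation n (jacobian_ideal n f) \<inter> homog n k = satd n J k"
proof
  have J: "graded n J" unfolding J_def using homog_deriv[OF f] by (intro graded_gen) auto
  note JJ = jacobian_ideal_homog[OF f, folded J_def]
  show "saturation n (jacobian_ideal n f) \<inter> homog n k \<subseteq> satd n J k"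
  proof
    fix h assume h: "h \<in> saturation n (jacobian_ideal n f) \<inter> homog n k"
    then obtain m where m: "\<And>g. g \<in> ideal_power (polys n) (irrelevant_ideal n) m \<Longrightarrow> g * h \<in> jacobian_ideal n f"
      by (auto simp: saturation_def)
    have "v * h \<in> J (k + int m)" if v: "v \<in> homog n (int m)" for v
    proof -
      have "v * h \<in> homog n (k + int m)" using h v by (intro homog_mult'[of v n "int m"]) auto
      moreover have "v * h \<in> jacobian_ideal n f" using v homog_subset_irrelevant_power by (intro m) auto
      ultimately show ?thesis using JJ by blast
    qed
    then show "h \<in> satd n J k" using h by (auto simp: satd_def)
  qed
  show "satd n J k \<subseteq> saturation n (jacobian_ideal n f) \<inter> homog n k"
  proof
    fix h assume "h \<in> satd n J k"
    then obtain r where h: "h \<in> homog n k" and r: "\<And>v. v \<in> homog n (int r) \<Longrightarrow> v * h \<in> J (k + int r)"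
      by (auto simp: satd_def)
    have "homog n (int r) \<subseteq> colon n J h k (int r)" using r by (auto simp: colon_def add.commute)
    then have up: "v * h \<in> J (j + k)" if "v \<in> homog n j" "int r \<le> j" for v j
      using graded_full_above[OF graded_colon[OF J h], of "int r" j] that by (auto simp: colon_def)
    have "g * h \<in> jacobian_ideal n f" if g: "g \<in> polys_from n r" for g
    proof -
      have "g \<in> polys n" using g by (simp add: polys_from_def)
      then show ?thesis
      proof (induction rule: polys_monom_induct)
        case (monom m c)
        have "single m c \<in> homog n (int (mdeg m))" using monom(1) by (intro single_in_homog) auto
        moreover have "int r \<le> int (mdeg m)" using g monom(2) by (simp add: polys_from_def)
        ultimately have "single m c * h \<in> J (int (mdeg m) + k)" by (rule up)
        then show ?case using JJ by blast
      qed (simp_all add: jacobian_ideal_lincomb lincomb_0[OF subring_polys] lincomb_add[OF subring_polys] distrib_right)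
    qed
    then show "h \<in> saturation n (jacobian_ideal n f) \<inter> homog n k"
      using h irrelevant_power_subset[of n r] homog_polys[OF h] by (auto simp: saturation_def)
  qed
qed

subsection \<open>Finiteness of the singular locus\<close>

lemma continuous_on_eval: "continuous_on UNIV (mpoly_eval h)"
  unfolding mpoly_subst_def
  by (intro continuous_intros continuous_on_product_coordinates)

lemma singular_coords_scale:
  assumes f: "f \<in> homog n (int d)" and x: "x \<in> singular_coords n f" and c: "c \<noteq> 0"
  shows "(\<lambda>i. c * x i) \<in> singular_coords n f"
proof -
  have ev: "mpoly_eval h (\<lambda>i. c * x i) = 0" if h: "h \<in> homog n k" "mpoly_eval h x = 0" for h k
  proof (cases "k < 0")
    case True
    then show ?thesis using h homog_neg_degree by (simp add: eval.subst_0)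
  next
    case False
    then show ?thesis using eval_homog[OF h(1), of "\<lambda>i. c * x i" c x] h(2) by simp
  qed
  show ?thesis
    using x c ev[OF f] ev[OF homog_deriv[OF f]] by (auto simp: singular_coords_def homog_coords_def)
qed

text \<open>Compactness of projective space, by representatives whose coordinate of largest modulus
  is 1. Infinitely many singular points would accumulate at a point that is singular by continuity,
  against isolation.\<close>

lemma finite_singular_points:
  assumes f: "f \<in> homog n (int d)" and iso: "isolated_singularities n f"
  shows "finite (singular_points n f)"
proof -
  \<comment> \<open>Coordinates beyond \<open>n\<close> are confined to 0, which makes
    \<open>B\<close> compact in the product topology on all functions.\<close>
  define B where "B = PiE UNIV (\<lambda>j. if j \<le> n then cball (0::complex) 1 else {0})"
  define C where "C i = B \<inter> {x. x i = 1} \<inter> singular_coords n f" for i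
  have "compactin (product_topology (\<lambda>_. euclidean) UNIV) B"
    unfolding B_def compactin_PiE by auto
  then have B: "compact B" by (simp add: euclidean_product_topology compactin_euclidean_iff)
  have closed_ev: "closed {x. mpoly_eval h x = 0}" for h
    by (rule closed_Collect_eq[OF continuous_on_eval continuous_on_const])
  have fin: "finite (proj_point ` C i)" if i: "i \<le> n" for i
  proof (rule ccontr)
    assume inf: "infinite (proj_point ` C i)"
    have "C i = B \<inter> ({x. x i = 1} \<inter> {x. mpoly_eval f x = 0} \<inter> (\<Inter>j\<in>{..n}. {x. mpoly_eval (mpoly_deriv j f) x = 0}))"
      using i by (auto simp: C_def singular_coords_def homog_coords_def B_def PiE_iff split: if_splits)
    then have "compact (C i)"
      using closed_ev
      by (auto intro!: compact_Int_closed[OF B] closed_Int closed_INT closed_Collect_eq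
          continuous_on_product_coordinates continuous_on_const continuous_on_eval)
    moreover obtain t where t: "t \<subseteq> C i" "inj_on proj_point t" "proj_point ` C i = proj_point ` t"
      using subset_image_inj[of "proj_point ` C i" proj_point "C i"] by auto
    moreover have "infinite t" using inf t(3) by auto
    ultimately obtain x where x: "x \<in> C i" "x islimpt t"
      using Heine_Borel_imp_Bolzano_Weierstrass by metis
    then have "x \<in> singular_coords n f" by (simp add: C_def)
    then obtain \<epsilon> where \<epsilon>: "\<epsilon> > 0" "\<And>y. y \<in> singular_coords n f \<Longrightarrow> (\<forall>i\<le>n. dist (y i) (x i) < \<epsilon>) \<Longrightarrow> proj_point y = proj_point x"
      using iso unfolding isolated_singularities_def by metis
    define U where "U = (\<Inter>j\<in>{..n}. {y :: nat \<Rightarrow> complex. dist (y j) (x j) < \<epsilon>})"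
    have U: "open U" unfolding U_def
      by (intro open_INT ballI open_Collect_less continuous_intros continuous_on_product_coordinates) auto
    have xU: "x \<in> U" using \<epsilon>(1) by (simp add: U_def)
    \<comment> \<open>Two distinct elements \<open>y\<close> and \<open>z\<close> of
      \<open>t\<close> close to \<open>x\<close> would represent the same projective point, but
      \<open>proj_point\<close> is injective on \<open>t\<close>.\<close>
    obtain y where y: "y \<in> t" "y \<in> U" "y \<noteq> x" using islimptE[OF x(2) xU U] by blast
    have "open (U - {y})" using U by (intro open_Diff) auto
    then obtain z where z: "z \<in> t" "z \<in> U - {y}" "z \<noteq> x" using islimptE[OF x(2), of "U - {y}"] xU y(3) by blast
    have "proj_point w = proj_point x" if "w \<in> t" "w \<in> U" for w
      using that t(1) by (intro \<epsilon>(2)) (auto simp: C_def U_def)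
    then have "proj_point y = proj_point z" using y z by auto
    then show False using t(2) y z by (auto dest: inj_onD)
  qed
  have "singular_points n f \<subseteq> (\<Union>i\<in>{..n}. proj_point ` C i)"
  proof
    fix P assume "P \<in> singular_points n f"
    then obtain x where x: "x \<in> singular_coords n f" "P = proj_point x" by (auto simp: singular_points_def)
    have "Max ((\<lambda>j. norm (x j)) ` {..n}) \<in> (\<lambda>j. norm (x j)) ` {..n}" by (intro Max_in) auto
    then obtain i where i: "i \<le> n" "norm (x i) = Max ((\<lambda>j. norm (x j)) ` {..n})"
      by (metis (no_types, lifting) atMost_iff imageE)
    have le: "norm (x j) \<le> norm (x i)" if "j \<le> n" for j unfolding i(2) using that by (intro Max_ge) auto
    have xi: "x i \<noteq> 0"
    proof
      assume "x i = 0"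
      then have "x j = 0" if "j \<le> n" for j using le[OF that] by simp
      then show False using x(1) by (auto simp: singular_coords_def homog_coords_def)
    qed
    define y where "y j = (1 / x i) * x j" for j
    have "y \<in> singular_coords n f" unfolding y_def using xi by (intro singular_coords_scale[OF f x(1)]) auto
    moreover have "y \<in> B"
      unfolding B_def using le xi x(1)
      by (auto simp: y_def norm_divide divide_le_eq_1 singular_coords_def homog_coords_def)
    ultimately have "y \<in> C i" using xi by (simp add: C_def y_def)
    moreover have "proj_point y = P" unfolding x(2) by (rule proj_point_scale[of "1 / x i"]) (use xi in \<open>auto simp: y_def\<close>)
    ultimately show "P \<in> (\<Union>i\<in>{..n}. proj_point ` C i)" using i(1) by blast
  qed
  moreover have "finite (\<Union>i\<in>{..n}. proj_point ` C i)" using fin by (intro finite_UN_I) auto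
  ultimately show ?thesis by (rule finite_subset)
qed

subsection \<open>Hypersurfaces\<close>

lemma eval_zero_if_deriv_zero:
  assumes f: "f \<in> homog n (int d)" and d: "d \<ge> 1"
    and z: "\<And>i. i \<le> n \<Longrightarrow> mpoly_eval (mpoly_deriv i f) c = 0"
  shows "mpoly_eval f c = 0"
proof -
  have "mpoly_eval (mpoly_scale (of_nat d) f) c = 0"
    unfolding euler[OF f, symmetric] eval.subst_sum eval.subst_mult using z by simp
  then show ?thesis using d by (simp add: eval.subst_scale)
qed

lemma zero_of_jacobian_iff:
  assumes f: "f \<in> homog n (int d)" and d: "d \<ge> 1"
  shows "zero_of n (gen n (\<lambda>i. mpoly_deriv i f) (\<lambda>_. int d - 1) {..n}) c \<longleftrightarrow> c \<in> singular_coords n f"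
proof
  assume z: "zero_of n (gen n (\<lambda>i. mpoly_deriv i f) (\<lambda>_. int d - 1) {..n}) c"
  have "mpoly_eval (mpoly_deriv i f) c = 0" if "i \<le> n" for i
    using zero_of_gen[OF finite_atMost z, of i] that by simp
  then show "c \<in> singular_coords n f"
    using z eval_zero_if_deriv_zero[OF f d] by (auto simp: singular_coords_def zero_of_def)
next
  assume "c \<in> singular_coords n f"
  then show "zero_of n (gen n (\<lambda>i. mpoly_deriv i f) (\<lambda>_. int d - 1) {..n}) c"
    using gen_eval_zero[of _ n "\<lambda>i. mpoly_deriv i f" "\<lambda>_. int d - 1" "{..n}" _ c]
    by (auto simp: zero_of_def singular_coords_def)
qed

lemma milnor_dim_eq_HF:
  assumes f: "f \<in> homog n (int d)"
  shows "milnor_dim n f k = enat (HF n (gen n (\<lambda>i. mpoly_deriv i f) (\<lambda>_. int d - 1) {..n}) k)"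
proof -
  have J: "graded n (gen n (\<lambda>i. mpoly_deriv i f) (\<lambda>_. int d - 1) {..n})"
    using homog_deriv[OF f] by (intro graded_gen) auto
  show ?thesis
    unfolding milnor_dim_def jacobian_ideal_homog[OF f] HF_def
    by (rule mpoly.quotient_dim_qdim[OF gradedD(1)[OF J] fin_graded[OF J]])
qed

lemma projectively_rigid_iff:
  assumes f: "f \<in> homog n (int d)"
  defines "J \<equiv> gen n (\<lambda>i. mpoly_deriv i f) (\<lambda>_. int d - 1) {..n}"
  shows "projectively_rigid n d f \<longleftrightarrow> mpoly.qdim (satd n J (int d)) (J (int d)) = 0"
proof -
  have J: "graded n J" unfolding J_def using homog_deriv[OF f] by (intro graded_gen) auto
  have add: "x + y \<in> satd n J k" if xy: "x \<in> satd n J k" "y \<in> satd n J k" for x y k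
  proof -
    obtain r where r: "x \<in> homog n k" "\<And>v. v \<in> homog n (int r) \<Longrightarrow> v * x \<in> J (k + int r)"
      using xy(1) by (auto simp: satd_def)
    obtain s where s: "y \<in> homog n k" "\<And>v. v \<in> homog n (int s) \<Longrightarrow> v * y \<in> J (k + int s)"
      using xy(2) by (auto simp: satd_def)
    \<comment> \<open>The two exponents are raised to the common value \<open>r + s\<close>.\<close>
    have "homog n (int r) \<subseteq> colon n J x k (int r)" "homog n (int s) \<subseteq> colon n J y k (int s)"
      using r s by (auto simp: colon_def add.commute)
    then have "homog n (int (r + s)) \<subseteq> colon n J x k (int (r + s)) \<inter> colon n J y k (int (r + s))"
      using graded_full_above[OF graded_colon[OF J r(1)], of "int r" "int (r + s)"]
        graded_full_above[OF graded_colon[OF J s(1)], of "int s" "int (r + s)"] by auto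
    then have 1: "v * x \<in> J (k + int (r + s))" "v * y \<in> J (k + int (r + s))" if "v \<in> homog n (int (r + s))" for v
      using that by (auto simp: colon_def add.commute)
    have "v * (x + y) \<in> J (k + int (r + s))" if "v \<in> homog n (int (r + s))" for v
      unfolding distrib_left using 1[OF that] by (rule graded_add[OF J])
    moreover have "x + y \<in> homog n k" using r(1) s(1) by (rule homog_add)
    ultimately show ?thesis unfolding satd_def by blast
  qed
  have sub: "mpoly.subspace (satd n J k)" for k
  proof (rule mpoly.subspaceI)
    show "0 \<in> satd n J k" using graded_0[OF J] by (auto simp: satd_def)
    show "mpoly_scale c x \<in> satd n J k" if "x \<in> satd n J k" for c x
    proof -
      obtain r where r: "x \<in> homog n k" "\<And>v. v \<in> homog n (int r) \<Longrightarrow> v * x \<in> J (k + int r)"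
        using \<open>x \<in> satd n J k\<close> by (auto simp: satd_def)
      have "v * mpoly_scale c x \<in> J (k + int r)" if "v \<in> homog n (int r)" for v
        unfolding mpoly_scale_mult_right[symmetric] by (rule graded_scale[OF J r(2)[OF that]])
      then show ?thesis using homog_scale[OF r(1)] unfolding satd_def by blast
    qed
  qed (rule add)
  have "J k \<subseteq> satd n J k" for k
  proof
    fix u assume u: "u \<in> J k"
    have "v * u \<in> J (k + int 0)" if "v \<in> homog n (int 0)" for v using graded_mult[OF J that u] by simp
    then show "u \<in> satd n J k" using gradedD(2)[OF J u] unfolding satd_def by blast
  qed
  then have "mpoly.fin_quotient (satd n J (int d)) (J (int d))"
    by (intro fin_quotient_homog[of _ _ n "int d"] sub gradedD(1)[OF J]) (auto simp: satd_def)
  then have "mpoly_quotient_dim (satd n J (int d)) (J (int d)) = enat (mpoly.qdim (satd n J (int d)) (J (int d)))"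
    by (rule mpoly.quotient_dim_qdim[OF gradedD(1)[OF J]])
  then show ?thesis
    unfolding projectively_rigid_def saturation_homog[OF f, folded J_def] jacobian_ideal_homog[OF f, folded J_def]
    by (simp add: zero_enat_def)
qed

text \<open>\<open>pt\<close> and \<open>ix\<close> are the very choices made inside
  \<open>tjurina_at\<close>; Euler's formula then turns each Tjurina ideal into the ideal of the
  germs of all partials.\<close>

lemma total_tjurina_eq:
  assumes f: "f \<in> homog n (int d)" and d: "d \<ge> 1"
  obtains pt ix where "\<And>P. P \<in> singular_points n f \<Longrightarrow> pt P \<in> singular_coords n f \<and> ix P \<le> n \<and> pt P (ix P) \<noteq> 0 \<and> proj_point (pt P) = P"
    "total_tjurina n f = (\<Sum>P\<in>singular_points n f. mfps_quotient_dim (convergent_series ({..n} - {ix P}))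
        (local_ideal n (\<lambda>j. mpoly_deriv j f) (ix P) (pt P)))"
proof -
  define pt where "pt P = (SOME p. p \<in> P)" for P :: "(nat \<Rightarrow> complex) set"
  define ix where "ix P = (SOME i. i \<le> n \<and> pt P i \<noteq> 0)" for P
  have *: "pt P \<in> singular_coords n f \<and> ix P \<le> n \<and> pt P (ix P) \<noteq> 0 \<and> proj_point (pt P) = P"
    if P: "P \<in> singular_points n f" for P
  proof -
    obtain x where x: "x \<in> singular_coords n f" "P = proj_point x" using P by (auto simp: singular_points_def)
    have "pt P \<in> P" unfolding pt_def using someI[of "\<lambda>p. p \<in> P" x] x(2) proj_point_self by blast
    then obtain c where c: "pt P = (\<lambda>i. c * x i)" "c \<noteq> 0" unfolding x(2) proj_point_def by auto
    have s: "pt P \<in> singular_coords n f" unfolding c(1) by (rule singular_coords_scale[OF f x(1) c(2)])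
    then have "\<exists>i\<le>n. pt P i \<noteq> 0" by (auto simp: singular_coords_def homog_coords_def)
    then have "ix P \<le> n \<and> pt P (ix P) \<noteq> 0" unfolding ix_def by (rule someI_ex)
    moreover have "proj_point (pt P) = P" unfolding x(2) by (rule proj_point_scale[OF c(2)]) (simp add: c(1) flip: x(2))
    ultimately show ?thesis using s by blast
  qed
  show ?thesis
  proof (rule that[OF *])
    show "total_tjurina n f = (\<Sum>P\<in>singular_points n f. mfps_quotient_dim (convergent_series ({..n} - {ix P}))
        (local_ideal n (\<lambda>j. mpoly_deriv j f) (ix P) (pt P)))"
      unfolding total_tjurina_def
    proof (rule sum.cong[OF refl])
      fix P assume "P \<in> singular_points n f"
      then have "ix P \<le> n" using * by blast
      have "tjurina_at n f P = tjurina_number ({..n} - {ix P}) (local_equation f (ix P) (pt P))"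
        by (simp add: tjurina_at_def pt_def ix_def Let_def)
      then show "tjurina_at n f P = mfps_quotient_dim (convergent_series ({..n} - {ix P}))
        (local_ideal n (\<lambda>j. mpoly_deriv j f) (ix P) (pt P))"
        unfolding tjurina_number_def tjurina_ideal_eq[OF f d \<open>ix P \<le> n\<close>] .
    qed
  qed
qed

text \<open>Since \<open>d - 1\<close> lies strictly below the supremum, some admissible
  \<open>q\<close> exceeds it, so \<open>q \<ge> d\<close>; this also covers an infinite
  threshold.\<close>

lemma milnor_dim_eq_if_coincidence:
  assumes d: "d \<ge> 1" and ct: "enat d \<le> coincidence_threshold n f fs"
  shows "milnor_dim n f (int d) = milnor_dim n fs (int d)"
proof -
  let ?A = "{enat q | q. \<forall>k \<le> int q. milnor_dim n f k = milnor_dim n fs k}"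
  have "enat (d - 1) < Sup ?A"
    using ct d unfolding coincidence_threshold_def by (metis (no_types, lifting) diff_less enat_ord_simps(2) less_le_trans less_one not_gr_zero not_less)
  then obtain q where "enat (d - 1) < enat q" "\<forall>k \<le> int q. milnor_dim n f k = milnor_dim n fs k"
    unfolding less_Sup_iff by auto
  then show ?thesis by auto
qed

theorem corollary4p5:
  fixes n d :: nat and f fs :: mpoly and T :: int
  assumes "d \<ge> 1"
    and "f \<in> homog n (int d)" and "f \<noteq> 0"
    and "isolated_singularities n f"
    and "fs \<in> homog n (int d)" and "smooth_hypersurface n fs"
    and "T = (int n + 1) * (int d - 2)"
    and "enat d \<le> coincidence_threshold n f fs"
  shows "projectively_rigid n d f \<longleftrightarrow> milnor_dim n f (T - int d) = total_tjurina n f"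
proof -
  note d = assms(1) and f = assms(2) and fs = assms(5)
  define F where "F = (\<lambda>i. mpoly_deriv i f)"
  define e where "e = int d - 1"
  define J where "J = gen n F (\<lambda>_. e) {..n}"
  have J_eq: "gen n (\<lambda>i. mpoly_deriv i f) (\<lambda>_. int d - 1) {..n} = J"
    by (simp add: J_def F_def e_def)
  have F: "F i \<in> homog n e" for i unfolding F_def e_def by (rule homog_deriv[OF f])
  have zero: "zero_of n J c \<longleftrightarrow> c \<in> singular_coords n f" for c
    using zero_of_jacobian_iff[OF f d, of c] unfolding J_eq .
  note milnor = milnor_dim_eq_HF[OF f, unfolded J_eq] and rigid = projectively_rigid_iff[OF f, unfolded J_eq]
  have J: "graded n J" unfolding J_def using F by (intro graded_gen) auto
  show ?thesis
  proof (cases "d = 1")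
    case True
    \<comment> \<open>For \<open>d = 1\<close> the partials have degree 0, while \<open>CI\<close>
      requires positive degrees. As \<open>f \<noteq> 0\<close>, Euler's formula makes some partial
      a nonzero constant, so \<open>J\<close> is everything and both sides of the equivalence
      hold.\<close>
    have "\<exists>j\<le>n. F j \<noteq> 0"
    proof (rule ccontr)
      assume "\<not> ?thesis"
      then have "mpoly_scale (of_nat d) f = 0" unfolding euler[OF f, symmetric] by (simp add: F_def)
      then show False using d assms(3) by simp
    qed
    then obtain j where j: "j \<le> n" "F j \<noteq> 0" by blast
    have e0: "e = 0" using True by (simp add: e_def)
    obtain c where c: "F j = single 0 c" using homog_zero_degree F[of j] unfolding e0 by blast
    have "c \<noteq> 0" using c j by auto
    have full: "homog n k \<subseteq> J k" for k
    proof
      fix h assume h: "h \<in> homog n k"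
      have "mpoly_scale (1 / c) h * F j \<in> J k"
        using gen_mem[of "{..n}" j F n "\<lambda>_. e"] j e0
        by (intro graded_mult[OF J homog_scale[OF h], of _ 0]) (auto simp: J_def)
      moreover have "mpoly_scale (1 / c) h * F j = h"
        unfolding c using \<open>c \<noteq> 0\<close> by (simp add: mpoly_scale_def mult.commute mult.left_commute mult_single)
      ultimately show "h \<in> J k" by simp
    qed
    have "HF n J k = 0" for k using HF_0_iff[OF J] full by blast
    moreover have "artinian n J" unfolding artinian_def using full by blast
    then have "singular_points n f = {}" using artinian_no_zero zero by (auto simp: singular_points_def)
    moreover have "satd n J (int d) = J (int d)"
    proof
      show "satd n J (int d) \<subseteq> J (int d)" using full by (auto simp: satd_def)
      show "J (int d) \<subseteq> satd n J (int d)"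
        using gradedD(2)[OF J] graded_mult[OF J, of _ "int 0"] unfolding satd_def by fastforce
    qed
    ultimately show ?thesis
      unfolding milnor rigid total_tjurina_def using mpoly.qdim_same[OF gradedD(1)[OF J]] by (simp add: zero_enat_def)
  next
    case False
    then have e: "e \<ge> 1" using d by (simp add: e_def)
    define Fs where "Fs = (\<lambda>i. mpoly_deriv i fs)"
    define Js where "Js = gen n Fs (\<lambda>_. e) {..n}"
    have Js_eq: "gen n (\<lambda>i. mpoly_deriv i fs) (\<lambda>_. int d - 1) {..n} = Js"
      by (simp add: Js_def Fs_def e_def)
    have Fs: "Fs i \<in> homog n e" for i unfolding Fs_def e_def by (rule homog_deriv[OF fs])
    have no: "\<exists>i\<le>n. mpoly_eval (Fs i) p \<noteq> 0" if "p \<in> homog_coords n" for p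
    proof (rule ccontr)
      assume "\<not> ?thesis"
      then have z: "mpoly_eval (mpoly_deriv i fs) p = 0" if "i \<le> n" for i using that by (auto simp: Fs_def)
      then have "p \<in> singular_coords n fs"
        using that eval_zero_if_deriv_zero[OF fs d z] by (auto simp: singular_coords_def)
      then show False using assms(6) by (auto simp: smooth_hypersurface_def singular_points_def)
    qed
    have finS: "finite (singular_points n f)" by (rule finite_singular_points[OF f assms(4)])
    have fin: "finite (proj_point ` {c. zero_of n J c})"
      using finS unfolding zero singular_points_def by simp
    obtain l K \<tau> where l: "l \<in> homog n 1" "\<And>c. zero_of n J c \<Longrightarrow> mpoly_eval l c \<noteq> 0"
      and art: "artinian n (adj n J l 1)" and K: "K \<ge> 0" "\<And>k. k \<ge> K \<Longrightarrow> colon n J l 1 k \<subseteq> J k"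
      and \<tau>: "\<And>k. k \<ge> K \<Longrightarrow> HF n J k = \<tau>"
      and defect: "\<And>k. HF n J ((int n + 1) * (e - 1) - k) + HF n J k
        = HF n Js k + \<tau> + mpoly.qdim (satd n J k) (J k)"
      using defect_formula[OF e F fin[unfolded J_def] Fs no] unfolding J_def Js_def by blast
    interpret zero_scheme n F e K l J
      by unfold_locales (use J_def e F fin l art K in auto)
    obtain pt ix where
      pt: "\<And>P. P \<in> singular_points n f \<Longrightarrow> pt P \<in> singular_coords n f \<and> ix P \<le> n \<and> pt P (ix P) \<noteq> 0 \<and> proj_point (pt P) = P"
      and total: "total_tjurina n f = (\<Sum>P\<in>singular_points n f. mfps_quotient_dim (convergent_series ({..n} - {ix P}))
        (local_ideal n (\<lambda>j. mpoly_deriv j f) (ix P) (pt P)))"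
      using total_tjurina_eq[OF f d] by blast
    have "total_tjurina n f = enat \<tau>"
      unfolding total F_def[symmetric]
    proof (rule local_dims_eq_HF[OF finS])
      show "inj_on (\<lambda>P. proj_point (pt P)) (singular_points n f)" using pt by (auto simp: inj_on_def)
      show "\<exists>P\<in>singular_points n f. proj_point c = proj_point (pt P)" if "zero_of n J c" for c
        using that pt by (auto simp: zero singular_points_def)
    qed (use pt \<tau> zero in auto)
    moreover have "HF n J (int d) = HF n Js (int d)"
      using milnor_dim_eq_if_coincidence[OF d assms(8)]
      unfolding milnor milnor_dim_eq_HF[OF fs, unfolded Js_eq] by simp
    moreover have "T = (int n + 1) * (e - 1)" by (simp add: assms(7) e_def)
    ultimately show ?thesis
      unfolding milnor rigid using defect[of "int d"] by auto
  qed
qed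

end
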